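(* Let $a>1$, $\sigma^2>0$, $d\in(0,\frac{\sigma^2}{a^2-1})$, $Z_i$ i.i.d. $\mathcal{N}(0,\sigma^2)$, $U_0=0$, $U_i=aU_{i-1}+Z_i$. Then there exists a constant $p>0$ such that $$\mathbb{P}[U_1^n\in\mathcal{T}(n,p)]\ge1-\Theta\!\left(\frac1{\log n}\right),$$ where $\mathcal{T}(n,p)$ is the typical set defined below.
   Context: Notation. $\mathsf{d}(x_1^n,y_1^n)=\frac1n\sum(x_i-y_i)^2$. $\mathsf{F}$: $n\times n$ lower-triangular with ones on the diagonal, $-a$ on the first subdiagonal, zeros elsewhere; $\mu_{n,1}\le\cdots\le\mu_{n,n}$ eigenvalues of $\mathsf{F}'\mathsf{F}$; $\sigma_{n,i}^2=\sigma^2/\mu_{n,i}$; $\mathsf{S}$ orthogonal with $\mathsf{S}'(\mathsf{F}'\mathsf{F})^{-1}\mathsf{S}=\mathrm{diag}(1/\mu_{n,i})$, and $x_1^n=\mathsf{S}'u_1^n$. $\theta_n>0$ solves $d=\frac1n\sum\min(\theta_n,\sigma_{n,i}^2)$; $Y_1^{\star n}$ has independent coordinates $Y_i^\star\sim\mathcal{N}(0,\nu_{n,i}^2)$, $\nu_{n,i}^2=\max(0,\sigma_{n,i}^2-\theta_n)$. $\hat a_{\mathrm{ML}}(u_1^n)=\frac{\sum_{i=1}^{n-1}u_iu_{i+1}}{\sum_{i=1}^{n-1}u_i^2}$. Proxy: for each $u_1^n$, let $\hat X_1^n$ be Gaussian with independent coordinates $\hat X_i\sim\mathcal{N}(0,\hat\sigma_{n,i}^2)$,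 $\hat\sigma_{n,1}^2=\sigma^2\hat a_{\mathrm{ML}}(u_1^n)^{2n}$, $\hat\sigma_{n,i}^2=\sigma^2/(1+\hat a_{\mathrm{ML}}(u_1^n)^2-2\hat a_{\mathrm{ML}}(u_1^n)\cos\frac{i\pi}{n+1})$ for $2\le i\le n$. For random vectors $A_1^n,B_1^n$, $\mathbb{R}(A_1^n,B_1^n,d)=\inf\{\frac1nD(P_{F_1^n|A_1^n}\|P_{B_1^n}|P_{A_1^n}):\mathbb{E}[\mathsf{d}(A_1^n,F_1^n)]\le d\}$ (conditional relative entropy). Let $\hat F_1^{\star n}$ (jointly with $\hat X_1^n$) attain $\mathbb{R}(\hat X_1^n,Y_1^{\star n},d)$, and set $m_i(u_1^n)=\mathbb{E}[(\hat F_i^\star-x_i)^2\mid\hat X_i=x_i]$. Typical set: with $\eta_n=\sqrt{\log\log n/n}$, $\mathcal{T}(n,p)$ is the set of $u_1^n\in\mathbb{R}^n$ with (1) $|\hat a_{\mathrm{ML}}(u_1^n)-a|\le\eta_n$; (2) $\left|\frac1n\sum_{i=1}^n(x_i^2/\sigma_{n,i}^2)^k-(2k-1)!!\right|\le2$ for $k=1,2,3$; (3) $\left|\frac1n\sum_{i=1}^nm_i(u_1^n)-d\right|\le p\eta_n$. *)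

theory Defs
  imports "HOL-Probability.Probability" "HOL-Library.Landau_Symbols"
begin

text \<open>Vectors in R^n are functions nat => real, coordinates 1..n; n x n matrices are
  functions nat => nat => real with indices in 1..n.\<close>

definition Fmat :: "real \<Rightarrow> nat \<Rightarrow> nat \<Rightarrow> real" where
  "Fmat a i j = (if i = j then 1 else if i = Suc j then - a else 0)"

definition FtF :: "real \<Rightarrow> nat \<Rightarrow> nat \<Rightarrow> nat \<Rightarrow> real" where
  "FtF a n i j = (\<Sum>k=1..n. Fmat a k i * Fmat a k j)"

text \<open>The inverse of F'F (F has determinant 1, so F'F is invertible).\<close>
definition FtF_inv :: "real \<Rightarrow> nat \<Rightarrow> nat \<Rightarrow> nat \<Rightarrow> real" where
  "FtF_inv a n = (SOME G. \<forall>i\<in>{1..n}. \<forall>j\<in>{1..n}.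
      (\<Sum>k=1..n. FtF a n i k * G k j) = (if i = j then 1 else 0))"

text \<open>Eigenvalues mu_{n,1} <= ... <= mu_{n,n} of F'F together with an orthogonal S such that
  S'(F'F)^{-1} S = diag(1/mu_{n,i}).\<close>
definition eig_data :: "real \<Rightarrow> nat \<Rightarrow> (nat \<Rightarrow> real) \<times> (nat \<Rightarrow> nat \<Rightarrow> real)" where
  "eig_data a n = (SOME (\<mu>, S).
      (\<forall>i\<in>{1..n}. \<forall>j\<in>{1..n}. i \<le> j \<longrightarrow> \<mu> i \<le> \<mu> j) \<and>
      (\<forall>i\<in>{1..n}. \<forall>j\<in>{1..n}. (\<Sum>k=1..n. S k i * S k j) = (if i = j then 1 else 0)) \<and>
      (\<forall>i\<in>{1..n}. \<forall>j\<in>{1..n}.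
         (\<Sum>k=1..n. \<Sum>l=1..n. S k i * FtF_inv a n k l * S l j) = (if i = j then 1 / \<mu> i else 0)))"

definition mu :: "real \<Rightarrow> nat \<Rightarrow> nat \<Rightarrow> real" where
  "mu a n = fst (eig_data a n)"

definition Smat :: "real \<Rightarrow> nat \<Rightarrow> nat \<Rightarrow> nat \<Rightarrow> real" where
  "Smat a n = snd (eig_data a n)"

text \<open>x_1^n = S' u_1^n\<close>
definition xvec :: "real \<Rightarrow> nat \<Rightarrow> (nat \<Rightarrow> real) \<Rightarrow> nat \<Rightarrow> real" where
  "xvec a n u i = (\<Sum>k=1..n. Smat a n k i * u k)"

text \<open>sigma_{n,i}^2 = sigma^2 / mu_{n,i}\<close>
definition sig2 :: "real \<Rightarrow> real \<Rightarrow> nat \<Rightarrow> nat \<Rightarrow> real" where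
  "sig2 a \<sigma>2 n i = \<sigma>2 / mu a n i"

definition theta :: "real \<Rightarrow> real \<Rightarrow> real \<Rightarrow> nat \<Rightarrow> real" where
  "theta a \<sigma>2 d n = (SOME \<theta>. \<theta> > 0 \<and> d = (1 / real n) * (\<Sum>i=1..n. min \<theta> (sig2 a \<sigma>2 n i)))"

definition nu2 :: "real \<Rightarrow> real \<Rightarrow> real \<Rightarrow> nat \<Rightarrow> nat \<Rightarrow> real" where
  "nu2 a \<sigma>2 d n i = max 0 (sig2 a \<sigma>2 n i - theta a \<sigma>2 d n)"

text \<open>Law of a centred Gaussian on the real line with variance v (point mass at 0 if v = 0).\<close>
definition gauss1 :: "real \<Rightarrow> real measure" where
  "gauss1 v = (if v > 0 then density lborel (\<lambda>x. ennreal (normal_density 0 (sqrt v) x))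
               else return lborel 0)"

text \<open>R^n with its Borel sigma-algebra.\<close>
definition Rn :: "nat \<Rightarrow> (nat \<Rightarrow> real) measure" where
  "Rn n = PiM {1..n} (\<lambda>_. lborel)"

text \<open>Law of a Gaussian vector with independent coordinates of variances v i.\<close>
definition gaussN :: "nat \<Rightarrow> (nat \<Rightarrow> real) \<Rightarrow> (nat \<Rightarrow> real) measure" where
  "gaussN n v = PiM {1..n} (\<lambda>i. gauss1 (v i))"

text \<open>Law of Y^{*n}.\<close>
definition Ystar :: "real \<Rightarrow> real \<Rightarrow> real \<Rightarrow> nat \<Rightarrow> (nat \<Rightarrow> real) measure" where
  "Ystar a \<sigma>2 d n = gaussN n (nu2 a \<sigma>2 d n)"

definition aML :: "nat \<Rightarrow> (nat \<Rightarrow> real) \<Rightarrow> real" where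
  "aML n u = (\<Sum>i=1..n-1. u i * u (i+1)) / (\<Sum>i=1..n-1. (u i)^2)"

definition sighat2 :: "real \<Rightarrow> nat \<Rightarrow> (nat \<Rightarrow> real) \<Rightarrow> nat \<Rightarrow> real" where
  "sighat2 \<sigma>2 n u i = (if i = 1 then \<sigma>2 * (aML n u) ^ (2 * n)
      else \<sigma>2 / (1 + (aML n u)^2 - 2 * aML n u * cos (real i * pi / real (n + 1))))"

text \<open>Law of the proxy \<open>X^n\<close> (hat) associated with u.\<close>
definition Xhat :: "real \<Rightarrow> nat \<Rightarrow> (nat \<Rightarrow> real) \<Rightarrow> (nat \<Rightarrow> real) measure" where
  "Xhat \<sigma>2 n u = gaussN n (sighat2 \<sigma>2 n u)"

definition distortion :: "nat \<Rightarrow> (nat \<Rightarrow> real) \<Rightarrow> (nat \<Rightarrow> real) \<Rightarrow> real" where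
  "distortion n x y = (1 / real n) * (\<Sum>i=1..n. (x i - y i)^2)"

text \<open>Relative entropy D(P || Q) (in nats), equal to infinity unless P << Q and the
  log-likelihood ratio is P-integrable.  (KL_divergence b Q P is D(P||Q) in the library.)\<close>
definition relent :: "'a measure \<Rightarrow> 'a measure \<Rightarrow> ennreal" where
  "relent P Q = (if absolutely_continuous Q P \<and> integrable P (entropy_density (exp 1) Q P)
                 then ennreal (KL_divergence (exp 1) Q P) else \<infinity>)"

text \<open>Conditional relative entropy D(P_{F|A} || P_B | P_A), where the conditional law of F
  given A = x is the probability kernel K x.\<close>
definition cond_relent :: "'a measure \<Rightarrow> ('a \<Rightarrow> 'b measure) \<Rightarrow> 'b measure \<Rightarrow> ennreal" where
  "cond_relent PA K PB = (\<integral>\<^sup>+ x. relent (K x) PB \<partial>PA)"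

text \<open>Joint law of (A, F) when A ~ PA and F given A = x has law K x.\<close>
definition joint :: "nat \<Rightarrow> (nat \<Rightarrow> real) measure \<Rightarrow> ((nat \<Rightarrow> real) \<Rightarrow> (nat \<Rightarrow> real) measure)
    \<Rightarrow> ((nat \<Rightarrow> real) \<times> (nat \<Rightarrow> real)) measure" where
  "joint n PA K = bind PA (\<lambda>x. distr (K x) (PA \<Otimes>\<^sub>M Rn n) (\<lambda>y. (x, y)))"

text \<open>Admissible test channels in the definition of R(A,B,d).\<close>
definition admissible :: "nat \<Rightarrow> (nat \<Rightarrow> real) measure \<Rightarrow> real
    \<Rightarrow> ((nat \<Rightarrow> real) \<Rightarrow> (nat \<Rightarrow> real) measure) \<Rightarrow> bool" where
  "admissible n PA d K \<longleftrightarrow> K \<in> PA \<rightarrow>\<^sub>M prob_algebra (Rn n) \<and>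
     (\<integral>\<^sup>+ z. ennreal (distortion n (fst z) (snd z)) \<partial>joint n PA K) \<le> ennreal d"

text \<open>R(A_1^n, B_1^n, d) for A ~ PA, B ~ PB.\<close>
definition RR :: "nat \<Rightarrow> (nat \<Rightarrow> real) measure \<Rightarrow> (nat \<Rightarrow> real) measure \<Rightarrow> real \<Rightarrow> ennreal" where
  "RR n PA PB d = (INF K\<in>{K. admissible n PA d K}. cond_relent PA K PB / ennreal (real n))"

text \<open>Joint law of (X-hat, F-hat-star) attaining R(X-hat, Y-star, d).\<close>
definition opt_joint :: "real \<Rightarrow> real \<Rightarrow> real \<Rightarrow> nat \<Rightarrow> (nat \<Rightarrow> real)
    \<Rightarrow> ((nat \<Rightarrow> real) \<times> (nat \<Rightarrow> real)) measure" where
  "opt_joint a \<sigma>2 d n u = (SOME J. \<exists>K. admissible n (Xhat \<sigma>2 n u) d K \<and>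
      cond_relent (Xhat \<sigma>2 n u) K (Ystar a \<sigma>2 d n) / ennreal (real n)
        = RR n (Xhat \<sigma>2 n u) (Ystar a \<sigma>2 d n) d \<and>
      J = joint n (Xhat \<sigma>2 n u) K)"

text \<open>m_i(u) = E[(F-hat-star_i - x_i)^2 | X-hat_i = x_i], the conditional expectation given the
  event {X-hat_i = x_i} defined pointwise as the limit of elementary conditional
  expectations given {|X-hat_i - x_i| < e}, e -> 0+.\<close>
definition mfun :: "real \<Rightarrow> real \<Rightarrow> real \<Rightarrow> nat \<Rightarrow> (nat \<Rightarrow> real) \<Rightarrow> nat \<Rightarrow> real" where
  "mfun a \<sigma>2 d n u i = (let J = opt_joint a \<sigma>2 d n u; x = xvec a n u i in
     Lim (at_right 0) (\<lambda>e.
       (\<integral>z. indicator {z. \<bar>fst z i - x\<bar> < e} z * (snd z i - x)^2 \<partial>J)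
       / measure J {z \<in> space J. \<bar>fst z i - x\<bar> < e}))"

definition eta :: "nat \<Rightarrow> real" where
  "eta n = sqrt (ln (ln (real n)) / real n)"

text \<open>(2k-1)!!\<close>
definition odd_dfact :: "nat \<Rightarrow> real" where
  "odd_dfact k = (\<Prod>j<k. real (2 * j + 1))"

definition typset :: "real \<Rightarrow> real \<Rightarrow> real \<Rightarrow> nat \<Rightarrow> real \<Rightarrow> (nat \<Rightarrow> real) set" where
  "typset a \<sigma>2 d n p = {u.
     \<bar>aML n u - a\<bar> \<le> eta n \<and>
     (\<forall>k\<in>{1,2,3::nat}. \<bar>(1 / real n) * (\<Sum>i=1..n. (xvec a n u i ^ 2 / sig2 a \<sigma>2 n i) ^ k)
                          - odd_dfact k\<bar> \<le> 2) \<and>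
     \<bar>(1 / real n) * (\<Sum>i=1..n. mfun a \<sigma>2 d n u i) - d\<bar> \<le> p * eta n}"

text \<open>The Gauss-Markov process U_0 = 0, U_i = a U_{i-1} + Z_i.\<close>
primrec Uproc :: "real \<Rightarrow> (nat \<Rightarrow> 'a \<Rightarrow> real) \<Rightarrow> nat \<Rightarrow> 'a \<Rightarrow> real" where
  "Uproc a Z 0 \<omega> = 0"
| "Uproc a Z (Suc i) \<omega> = a * Uproc a Z i \<omega> + Z (Suc i) \<omega>"

end

theory Submission
  imports Defs "Jordan_Normal_Form.Determinant" "HOL-Real_Asymp.Real_Asymp"
begin

text \<open>
The matrix \<open>F'F\<close> is a rank-one perturbation of a tridiagonal Toeplitz matrix. Its eigenvectors are
\<open>k \<mapsto> sin (k x)\<close> with \<open>sin ((n+1) x) = a sin (n x)\<close>, one root \<open>x\<close> strictly between consecutive multiples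
of \<open>pi / (n+1)\<close>, and one vector \<open>k \<mapsto> sinh (k x)\<close> whose eigenvalue is at most \<open>a ^ (2 - 2 n)\<close>. So all
eigenvalues but the first are within \<open>O(1/n)\<close> of those of the Toeplitz matrix.

By a Donsker--Varadhan bound the test channel attaining the proxy rate is unique: it is the Gaussian
channel proportional to \<open>exp (- k / 2 * |x - y|\<^sup>2)\<close> with respect to the law of \<open>Y\<close>, where the multiplier \<open>k\<close>
makes the distortion constraint tight. Hence
\<open>m_i(u) = x_i\<^sup>2 / (1 + k nu_i)\<^sup>2 + nu_i / (1 + k nu_i)\<close>. For every \<open>u\<close> whose maximum likelihood estimate
is within \<open>eta_n\<close> of \<open>a\<close>, the multiplier is within \<open>O(eta_n)\<close> of the deterministic value \<open>1 / theta_n\<close>,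
because reverse water-filling keeps a positive fraction of the coordinates active.

It remains to bound three probabilities. The estimation error is at most the norm of \<open>Z\<close> divided by \<open>|U_{n-1}|\<close>,
which is exponentially small outside an event of probability \<open>O(1/n)\<close>. The empirical moments follow from
Chebyshev's inequality. For the distortion average Chebyshev's inequality only gives \<open>1 / log log n\<close>, so
a Chernoff bound for weighted chi-square sums is used; at scale \<open>eta_n\<close> it gives \<open>2 / log n\<close>.
\<close>

section \<open>The eigenvalues of F'F\<close>

text \<open>Four objects of the definitions are Hilbert choices: the inverse of \<open>F'F\<close>,
  the eigendata, the water level and the optimal joint law. Each needs an existence proof, and two
  are moreover identified: the eigenvalues by comparison with an explicit eigensystem, the joint law
  by uniqueness. The sign of an eigenvector stays open, which is harmless because only squares of
  the coordinates of x enter. The obstacle is coordinate 1. Its variance \<open>s n 1\<close> grows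
  exponentially, so it stays out of the uniform estimates and is tamed by the denominator
  \<open>(1 + k * \<nu>)^2\<close>, whose \<open>\<nu>\<close> is of the order of
  \<open>s n 1\<close> itself; the remaining constant is divided by n. Moreover the reproduction law
  keeps the variances of the true source, so the proxy does not obey water-filling and its
  multiplier solves a perturbed equation. The gap between \<open>d\<close> and
  \<open>\<sigma>2 / (a^2 - 1)\<close> makes that equation nondegenerate. The rotated coordinates
  are handled through pair moments and one joint exponential moment. Measurability of the typical
  event is a genuine obligation, since \<open>measure\<close> is 0 on nonmeasurable sets.\<close>

lemma square_left_right_inverse:
  fixes A B :: "nat \<Rightarrow> nat \<Rightarrow> real"
  assumes "\<And>i j. i \<in> {1..n} \<Longrightarrow> j \<in> {1..n} \<Longrightarrow> (\<Sum>k=1..n. A i k * B k j) = (if i = j then 1 else 0)"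
    and "i \<in> {1..n}" "j \<in> {1..n}"
  shows "(\<Sum>k=1..n. B i k * A k j) = (if i = j then 1 else 0)"
proof -
  define MA where "MA = mat n n (\<lambda>(i,j). A (Suc i) (Suc j))"
  define MB where "MB = mat n n (\<lambda>(i,j). B (Suc i) (Suc j))"
  have sh: "(\<Sum>k = 0..<n. f (Suc k)) = (\<Sum>k=1..n. f k)" for f :: "nat \<Rightarrow> real"
    using sum.shift_bounds_Suc_ivl[of f 0 n] by (simp add: atLeastLessThanSuc_atLeastAtMost)
  have "MA * MB = 1\<^sub>m n"
  proof (rule eq_matI)
    fix i j assume "i < dim_row (1\<^sub>m n :: real mat)" "j < dim_col (1\<^sub>m n :: real mat)"
    then show "(MA * MB) $$ (i, j) = 1\<^sub>m n $$ (i, j)"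
      using assms(1)[of "Suc i" "Suc j"] sh[of "\<lambda>k. A (Suc i) k * B k (Suc j)"]
      by (auto simp: MA_def MB_def scalar_prod_def)
  qed (auto simp: MA_def MB_def)
  then have "MB * MA = 1\<^sub>m n"
    using mat_mult_left_right_inverse[of MA n MB] by (auto simp: MA_def MB_def)
  then have "(MB * MA) $$ (i - 1, j - 1) = 1\<^sub>m n $$ (i - 1, j - 1)" by simp
  then show ?thesis
    using assms(2,3) sh[of "\<lambda>k. B i k * A k j"]
    by (auto simp: MA_def MB_def scalar_prod_def split: if_splits)
qed

text \<open>Expanding both products leaves the Gram matrix of the rows. The lemma serves every
  change of basis: coordinates in the eigenvectors, the overlap of two eigenbases, and the rotation
  of the noise.\<close>

lemma orthonormal_rows_parseval:
  fixes A :: "nat \<Rightarrow> nat \<Rightarrow> real"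
  assumes "\<And>p q. p \<in> {1..n} \<Longrightarrow> q \<in> {1..n} \<Longrightarrow> (\<Sum>i=1..n. A p i * A q i) = (if p = q then 1 else 0)"
  shows "(\<Sum>i=1..n. (\<Sum>p=1..n. v p * A p i) * (\<Sum>q=1..n. w q * A q i)) = (\<Sum>p=1..n. v p * w p)"
proof -
  have "(\<Sum>i=1..n. (\<Sum>p=1..n. v p * A p i) * (\<Sum>q=1..n. w q * A q i))
      = (\<Sum>i=1..n. \<Sum>p=1..n. \<Sum>q=1..n. v p * w q * (A p i * A q i))"
    unfolding sum_product by (simp add: mult_ac)
  also have "\<dots> = (\<Sum>p=1..n. \<Sum>i=1..n. \<Sum>q=1..n. v p * w q * (A p i * A q i))" by (rule sum.swap)
  also have "\<dots> = (\<Sum>p=1..n. \<Sum>q=1..n. v p * w q * (\<Sum>i=1..n. A p i * A q i))"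
    unfolding sum_distrib_left by (intro sum.cong refl sum.swap)
  also have "\<dots> = (\<Sum>p=1..n. \<Sum>q=1..n. if q = p then v p * w q else 0)"
    using assms by (intro sum.cong refl) (simp del: One_nat_def)
  also have "\<dots> = (\<Sum>p=1..n. v p * w p)" by (intro sum.cong refl) simp
  finally show ?thesis .
qed

lemma Fmat_apply:
  assumes "k \<in> {1..n}"
  shows "(\<Sum>j=1..n. Fmat a k j * w j) = w k - (if k = 1 then 0 else a * w (k - 1))"
proof -
  have "(\<Sum>j=1..n. Fmat a k j * w j) = (\<Sum>j=1..n. (if j = k then w k else 0) + (if j = k - 1 then - a * w (k-1) else 0))"
    using assms by (intro sum.cong) (auto simp: Fmat_def)
  also have "\<dots> = w k - (if k = 1 then 0 else a * w (k - 1))"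
    using assms by (cases "k = 1") (auto simp: sum.distrib)
  finally show ?thesis .
qed

lemma FtF_sym: "FtF a n i j = FtF a n j i"
  by (simp add: FtF_def mult.commute)

lemma FtF_apply:
  "(\<Sum>j=1..n. FtF a n i j * w j) = (\<Sum>k=1..n. Fmat a k i * (\<Sum>j=1..n. Fmat a k j * w j))"
  unfolding FtF_def sum_distrib_left sum_distrib_right
  by (subst sum.swap) (simp add: mult.assoc)

lemma FtF_form:
  "(\<Sum>i=1..n. v i * (\<Sum>j=1..n. FtF a n i j * w j))
     = (\<Sum>k=1..n. (\<Sum>i=1..n. Fmat a k i * v i) * (\<Sum>j=1..n. Fmat a k j * w j))"
  unfolding FtF_apply sum_distrib_left[of "v _"] sum_distrib_right[of "\<lambda>i. Fmat a _ i * v i"]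
  by (subst sum.swap) (simp add: mult_ac)

lemma FtF_selfadjoint:
  "(\<Sum>i=1..n. v i * (\<Sum>j=1..n. FtF a n i j * w j)) = (\<Sum>j=1..n. (\<Sum>i=1..n. FtF a n j i * v i) * w j)"
  unfolding sum_distrib_left sum_distrib_right
  by (subst sum.swap) (simp add: mult_ac FtF_sym)

text \<open>\<open>F'F\<close> is the tridiagonal Toeplitz matrix with diagonal
  \<open>1 + a^2\<close> and off-diagonal \<open>- a\<close>, except that its last diagonal entry is
  1. The boundary values \<open>w 0 = 0\<close> and \<open>w (Suc n) = a * w n\<close> supply the
  missing neighbours and absorb that corner; \<open>c\<close> becomes \<open>cos x\<close> or
  \<open>cosh x\<close>.\<close>

lemma FtF_eigenvector:
  assumes i: "i \<in> {1..n}" and w0: "w 0 = 0" and wn: "w (Suc n) = a * w n"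
    and rec: "\<And>k. w (Suc (Suc k)) = 2 * c * w (Suc k) - w k"
  shows "(\<Sum>j=1..n. FtF a n i j * w j) = (1 + a^2 - 2 * a * c) * w i"
proof -
  have F: "(\<Sum>j=1..n. Fmat a k j * w j) = w k - a * w (k - 1)" if "k \<in> {1..n}" for k
    using that by (subst Fmat_apply) (auto simp: w0)
  have "(\<Sum>j=1..n. FtF a n i j * w j) = (\<Sum>k=1..n. Fmat a k i * (w k - a * w (k - 1)))"
    unfolding FtF_apply by (intro sum.cong refl arg_cong2[where f = "(*)"] F)
  also have "\<dots> = (\<Sum>k=1..n. (if k = i then w i - a * w (i - 1) else 0)
      + (if k = Suc i then - a * (w (Suc i) - a * w i) else 0))"
    by (intro sum.cong) (auto simp: Fmat_def)
  also have "\<dots> = (w i - a * w (i - 1)) - a * (w (Suc i) - a * w i)"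
    using i wn by (cases "i = n") (auto simp: sum.distrib)
  also have "\<dots> = (1 + a^2 - 2 * a * c) * w i"
  proof -
    obtain m where m: "i = Suc m" using i by (cases i) auto
    show ?thesis unfolding m by (simp add: rec[of m] algebra_simps power2_eq_square)
  qed
  finally show ?thesis .
qed

text \<open>Eigenvalues of the Toeplitz matrix without the corner correction; index 0 gives the edge
  \<open>(a - 1)^2\<close> of the limiting spectrum. From index 2 on, \<open>sighat2\<close> uses
  the same expression with the estimate in place of \<open>a\<close>.\<close>

definition xi :: "real \<Rightarrow> nat \<Rightarrow> nat \<Rightarrow> real" where
  "xi a n i = 1 + a^2 - 2 * a * cos (real i * pi / real (n + 1))"

lemma xi_strict_mono:
  assumes "a > 0" "i < j" "j \<le> n + 1"
  shows "xi a n i < xi a n j"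
proof -
  have "cos (real j * pi / real (n + 1)) < cos (real i * pi / real (n + 1))"
  proof (rule cos_monotone_0_pi)
    show "real i * pi / real (n + 1) < real j * pi / real (n + 1)"
      using assms by (intro divide_strict_right_mono mult_strict_right_mono) auto
    have "real j * pi \<le> real (n + 1) * pi"
      using assms by (intro mult_right_mono) auto
    then show "real j * pi / real (n + 1) \<le> pi"
      by (simp add: divide_le_eq mult.commute)
  qed auto
  then show ?thesis using assms by (simp add: xi_def)
qed

lemma xi_mono:
  assumes "a > 0" "i \<le> j" "j \<le> n + 1"
  shows "xi a n i \<le> xi a n j"
  using xi_strict_mono[of a i j n] assms by (cases "i = j") auto

text \<open>At the grid points \<open>\<phi> j\<close> the first sine vanishes and \<open>h\<close>
  equals \<open>a * (-1) ^ j * sin (\<phi> j)\<close>, so it changes sign on each interval. The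
  first interval is left out: \<open>h\<close> vanishes trivially at 0, and the remaining eigenvalue
  belongs to the hyperbolic vector. \<open>w 1 \<noteq> 0\<close> records that the eigenvector is
  nonzero.\<close>

lemma eigenvalue_between:
  assumes "a > 1" "i \<in> {2..n}"
  shows "\<exists>l w. w 1 \<noteq> 0 \<and> (\<forall>k\<in>{1..n}. (\<Sum>j=1..n. FtF a n k j * w j) = l * w k)
     \<and> xi a n (i - 1) < l \<and> l < xi a n (i::nat)"
proof -
  define \<phi> where "\<phi> j = real j * pi / real (n + 1)" for j :: nat
  define h where "h x = sin (real (Suc n) * x) - a * sin (real n * x)" for x
  have h\<phi>: "h (\<phi> j) = a * (-1) ^ j * sin (\<phi> j)" for j
  proof -
    have 1: "real (Suc n) * \<phi> j = real j * pi" by (simp add: \<phi>_def del: of_nat_Suc)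
    have 2: "real n * \<phi> j = real j * pi - \<phi> j" using 1 by (simp add: algebra_simps)
    show ?thesis unfolding h_def 1 2 by (simp add: sin_diff mult.commute[of "real j"])
  qed
  have pos: "0 < \<phi> j \<and> \<phi> j < pi" if "j \<ge> 1" "j \<le> n" for j
  proof -
    have "real j * pi < real (n + 1) * pi"
      using that by (intro mult_strict_right_mono) auto
    then show ?thesis using that by (simp add: \<phi>_def divide_less_eq mult.commute)
  qed
  have lt: "\<phi> (i - 1) < \<phi> i"
    unfolding \<phi>_def using assms by (intro divide_strict_right_mono mult_strict_right_mono) auto
  have s: "sin (\<phi> i) > 0" "sin (\<phi> (i - 1)) > 0"
    using assms by (auto intro!: sin_gt_zero pos[THEN conjunct1] pos[THEN conjunct2])
  have cont: "continuous_on {\<phi> (i-1)..\<phi> i} h" unfolding h_def by (intro continuous_intros)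
  obtain m where m: "i = Suc m" using assms by (cases i) auto
  have "\<exists>x. \<phi> (i - 1) < x \<and> x < \<phi> i \<and> h x = 0"
  proof (cases "even i")
    case True
    then have "h (\<phi> (i - 1)) < 0" "h (\<phi> i) > 0" using s assms unfolding h\<phi> m by auto
    then obtain x where "x \<ge> \<phi> (i-1)" "x \<le> \<phi> i" "h x = 0"
      using IVT'[OF _ _ _ cont, of 0] lt by force
    then show ?thesis using \<open>h (\<phi> (i - 1)) < 0\<close> \<open>h (\<phi> i) > 0\<close>
      by (intro exI[of _ x]) (metis less_eq_real_def less_irrefl)
  next
    case False
    then have "h (\<phi> (i - 1)) > 0" "h (\<phi> i) < 0" using s assms unfolding h\<phi> m by auto
    then obtain x where "x \<ge> \<phi> (i-1)" "x \<le> \<phi> i" "h x = 0"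
      using IVT2'[OF _ _ _ cont, of 0] lt by force
    then show ?thesis using \<open>h (\<phi> (i - 1)) > 0\<close> \<open>h (\<phi> i) < 0\<close>
      by (intro exI[of _ x]) (metis less_eq_real_def less_irrefl)
  qed
  then obtain x where x: "\<phi> (i - 1) < x" "x < \<phi> i" "h x = 0" by blast
  have p: "0 < \<phi> (i - 1)" "\<phi> i < pi" using assms pos[of i] pos[of "i-1"] by auto
  define w where "w k = sin (real k * x)" for k :: nat
  have rec: "w (Suc (Suc k)) = 2 * cos x * w (Suc k) - w k" for k
  proof -
    have e: "real (Suc (Suc k)) * x = real (Suc k) * x + x" "real k * x = real (Suc k) * x - x"
      by (simp_all add: algebra_simps)
    show ?thesis unfolding w_def e sin_add sin_diff by simp
  qed
  have "w 1 \<noteq> 0" using x p sin_gt_zero[of x] by (simp add: w_def)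
  moreover have "\<forall>k\<in>{1..n}. (\<Sum>j=1..n. FtF a n k j * w j) = (1 + a^2 - 2 * a * cos x) * w k"
    using rec x(3) by (intro ballI FtF_eigenvector) (auto simp: w_def h_def)
  moreover have "cos x < cos (\<phi> (i - 1))" "cos (\<phi> i) < cos x"
    using x p by (auto intro!: cos_monotone_0_pi)
  then have "xi a n (i - 1) < 1 + a^2 - 2 * a * cos x" "1 + a^2 - 2 * a * cos x < xi a n i"
    using assms by (auto simp: xi_def \<phi>_def)
  ultimately show ?thesis by blast
qed

text \<open>Here \<open>h\<close> vanishes at 0 with slope \<open>n + 1 - a * n\<close>, negative by
  assumption, while at \<open>ln a\<close> it equals \<open>(a - 1 / a) / (2 * a ^ n)\<close>, which
  is positive. A root strictly inside puts \<open>cosh x\<close> between 1 and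
  \<open>(a + 1 / a) / 2\<close>, and these two bounds are exactly \<open>l < xi a n 0\<close> and
  \<open>0 < l\<close>.\<close>

lemma eigenvalue_small:
  assumes "a > 1" "n \<ge> 1" "real n + 1 < a * real n"
  shows "\<exists>l w. w 1 \<noteq> 0 \<and> (\<forall>k\<in>{1..n}. (\<Sum>j=1..n. FtF a n k j * w j) = l * w k)
     \<and> 0 < l \<and> l < xi a n 0"
proof -
  define h where "h x = sinh (real (Suc n) * x) - a * sinh (real n * x)" for x :: real
  have d: "(h has_real_derivative (real (Suc n) - a * real n)) (at 0)"
    unfolding h_def by (auto intro!: derivative_eq_intros)
  have "real (Suc n) - a * real n < 0" using assms by simp
  from DERIV_neg_dec_right[OF d this] obtain e where e: "e > 0" "\<And>y. 0 < y \<Longrightarrow> y < e \<Longrightarrow> h y < h 0"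
    by (auto simp: h_def)
  \<comment> \<open>The search starts strictly right of 0, since 0 itself is a root; halving
    \<open>ln a\<close> keeps the starting point inside the interval.\<close>
  define y where "y = min (e/2) (ln a / 2)"
  have y: "0 < y" "y < e" "y < ln a" using e assms by (auto simp: y_def min_def field_simps)
  then have hy: "h y < 0" using e(2)[of y] by (simp add: h_def)
  have pw: "exp (real k * ln a) = a ^ k" for k
    using assms by (simp add: exp_of_nat_mult)
  have "h (ln a) = (a - inverse a) * inverse (a ^ n) / 2"
  proof -
    have "sinh (real k * ln a) = (a ^ k - inverse (a ^ k)) / 2" for k
      unfolding sinh_def by (simp add: pw exp_minus)
    then have "h (ln a) = (a ^ Suc n - inverse (a ^ Suc n)) / 2 - a * ((a ^ n - inverse (a ^ n)) / 2)"
      unfolding h_def by presburger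
    moreover have "(a * X - b * Y) / 2 - a * ((X - Y) / 2) = (a - b) * Y / 2" for X Y b :: real
      by (simp add: field_simps)
    ultimately show ?thesis by (simp add: inverse_mult_distrib)
  qed
  also have "\<dots> > 0" using assms by (auto simp: field_simps) (metis less_1_mult)
  finally have ha: "h (ln a) > 0" .
  have cont: "continuous_on {y..ln a} h" unfolding h_def by (intro continuous_intros)
  obtain x where x: "x \<ge> y" "x \<le> ln a" "h x = 0" using IVT'[OF _ _ _ cont, of 0] hy ha y by force
  have x': "0 < x" "x < ln a" using x y ha by (auto simp: less_le)
  define w where "w k = sinh (real k * x)" for k :: nat
  have rec: "w (Suc (Suc k)) = 2 * cosh x * w (Suc k) - w k" for k
  proof -
    have e: "real (Suc (Suc k)) * x = real (Suc k) * x + x" "real k * x = real (Suc k) * x - x"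
      by (simp_all add: algebra_simps)
    show ?thesis unfolding w_def e sinh_add sinh_diff by simp
  qed
  have "w 1 \<noteq> 0" using x' by (simp add: w_def)
  moreover have "\<forall>k\<in>{1..n}. (\<Sum>j=1..n. FtF a n k j * w j) = (1 + a^2 - 2 * a * cosh x) * w k"
    using rec x(3) by (intro ballI FtF_eigenvector) (auto simp: w_def h_def)
  moreover have "cosh 0 < cosh x" using x' by (intro cosh_real_strict_mono) auto
  moreover have "cosh x < cosh (ln a)" using x' by (intro cosh_real_strict_mono) auto
  moreover have "cosh (ln a) = (a + inverse a) / 2" using assms by (simp add: cosh_def exp_minus)
  ultimately have "w 1 \<noteq> 0" "\<forall>k\<in>{1..n}. (\<Sum>j=1..n. FtF a n k j * w j) = (1 + a^2 - 2 * a * cosh x) * w k"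
      "cosh x > 1" "cosh x < (a + inverse a) / 2" by auto
  moreover from this(4) have "2 * a * cosh x < 1 + a^2"
    using assms by (simp add: field_simps power2_eq_square)
  ultimately show ?thesis using assms
    by (intro exI[of _ "1 + a^2 - 2 * a * cosh x"] exI[of _ w]) (auto simp: xi_def)
qed

text \<open>The values \<open>xi\<close> separate the n eigenvalues, so these are distinct and
  self-adjointness makes the vectors orthogonal; normalising them completes the system.\<close>

lemma orthonormal_eigensystem_exists:
  assumes a: "a > 1" and n: "n \<ge> 1" "real n + 1 < a * real n"
  obtains S l where "\<And>i j. i \<in> {1..n} \<Longrightarrow> j \<in> {1..n} \<Longrightarrow> (\<Sum>k=1..n. S k i * S k j) = (if i = j then 1 else (0::real))"
    and "\<And>i k. i \<in> {1..n} \<Longrightarrow> k \<in> {1..n} \<Longrightarrow> (\<Sum>j=1..n. FtF a n k j * S j i) = l i * S k i"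
    and "\<And>i. i \<in> {2..n} \<Longrightarrow> xi a n (i - 1) < l i \<and> l i < xi a n i" and "0 < l 1"
    and "\<And>i j. i \<in> {1..n} \<Longrightarrow> j \<in> {1..n} \<Longrightarrow> i < j \<Longrightarrow> l i < l j"
proof -
  define good where "good l w \<longleftrightarrow> w 1 \<noteq> (0::real) \<and> (\<forall>k\<in>{1..n}. (\<Sum>j=1..n. FtF a n k j * w j) = l * w k)" for l w
  have "\<exists>p. good (fst p) (snd p) \<and> (i \<in> {2..n} \<longrightarrow> xi a n (i - 1) < fst p \<and> fst p < xi a n i)
     \<and> (i = 1 \<longrightarrow> 0 < fst p \<and> fst p < xi a n 0)" if "i \<in> {1..n}" for i
  proof (cases "i = 1")
    case True
    then show ?thesis using eigenvalue_small[OF a n] by (auto simp: good_def)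
  next
    case False
    then have "i \<in> {2..n}" using that by auto
    from eigenvalue_between[OF a this] show ?thesis using False by (auto simp: good_def)
  qed
  then obtain p where p: "\<And>i. i \<in> {1..n} \<Longrightarrow> good (fst (p i)) (snd (p i)) \<and>
     (i \<in> {2..n} \<longrightarrow> xi a n (i - 1) < fst (p i) \<and> fst (p i) < xi a n i)
     \<and> (i = 1 \<longrightarrow> 0 < fst (p i) \<and> fst (p i) < xi a n 0)" by metis
  define l where "l i = fst (p i)" for i
  define w where "w i = snd (p i)" for i
  define N where "N i = (\<Sum>k=1..n. w i k * w i k)" for i
  define S where "S k i = w i k / sqrt (N i)" for k i
  have w1: "w i 1 \<noteq> 0" if "i \<in> {1..n}" for i using p[OF that] by (auto simp: good_def w_def)
  have eig: "(\<Sum>j=1..n. FtF a n k j * w i j) = l i * w i k" if "i \<in> {1..n}" "k \<in> {1..n}" for i k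
    using p[OF that(1)] that(2) by (auto simp: good_def w_def l_def)
  have bd: "xi a n (i - 1) < l i \<and> l i < xi a n i" if "i \<in> {2..n}" for i
    using p[of i] that by (auto simp: l_def)
  have l1: "0 < l 1" "l 1 < xi a n 0" using p[of 1] n by (auto simp: l_def)
  have step: "l i \<le> xi a n i" if "i \<in> {1..n}" for i
    using l1 bd[of i] xi_strict_mono[of a 0 1 n] a n that by (cases "i = 1") auto
  have mono: "l i < l j" if "i \<in> {1..n}" "j \<in> {1..n}" "i < j" for i j
  proof -
    have "xi a n i \<le> xi a n (j - 1)"
      using a that by (intro xi_mono) auto
    then show ?thesis using step[of i] bd[of j] that by auto
  qed
  have orth: "(\<Sum>k=1..n. w i k * w j k) = 0" if "i \<in> {1..n}" "j \<in> {1..n}" "i \<noteq> j" for i j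
  proof -
    have "l j * (\<Sum>k=1..n. w i k * w j k) = (\<Sum>k=1..n. w i k * (\<Sum>m=1..n. FtF a n k m * w j m))"
      unfolding sum_distrib_left[of "l j"] using that eig by (intro sum.cong) (simp_all add: mult_ac del: One_nat_def)
    also have "\<dots> = (\<Sum>m=1..n. (\<Sum>k=1..n. FtF a n m k * w i k) * w j m)" by (rule FtF_selfadjoint)
    also have "\<dots> = l i * (\<Sum>k=1..n. w i k * w j k)"
      unfolding sum_distrib_left[of "l i"] using that eig by (intro sum.cong) (simp_all add: mult_ac del: One_nat_def)
    finally show ?thesis using mono[of i j] mono[of j i] that by (cases "i < j") auto
  qed
  have Npos: "N i > 0" if "i \<in> {1..n}" for i
    unfolding N_def using w1[OF that] n by (intro sum_pos2[of _ 1]) (auto simp: zero_less_mult_iff)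
  have orthS: "(\<Sum>k=1..n. S k i * S k j) = (if i = j then 1 else 0)" if "i \<in> {1..n}" "j \<in> {1..n}" for i j
  proof -
    have "(\<Sum>k=1..n. S k i * S k j) = (\<Sum>k=1..n. w i k * w j k) / (sqrt (N i) * sqrt (N j))"
      by (simp add: S_def sum_divide_distrib)
    then show ?thesis using orth[OF that] Npos[OF that(1)] by (auto simp: N_def)
  qed
  have eigS: "(\<Sum>j=1..n. FtF a n k j * S j i) = l i * S k i" if "i \<in> {1..n}" "k \<in> {1..n}" for i k
    using eig[OF that] by (simp add: S_def sum_divide_distrib[symmetric])
  show ?thesis by (rule that[OF orthS eigS bd l1(1) mono])
qed

section \<open>Identification of the eigendata chosen by \<open>eig_data\<close>\<close>

locale ar_dim =
  fixes a :: real and n :: nat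
  assumes a1: "a > 1" and n1: "n \<ge> 1" and n2: "real n + 1 < a * real n"
begin

text \<open>\<open>FtF_inv\<close> is a chosen right inverse; the spectral formula
  \<open>S diag(1/l) S'\<close> shows that one exists.\<close>

lemma FtF_inv_right:
  assumes "i \<in> {1..n}" "j \<in> {1..n}"
  shows "(\<Sum>k=1..n. FtF a n i k * FtF_inv a n k j) = (if i = j then 1 else 0)"
proof -
  obtain l S where S: "\<And>i j. i \<in> {1..n} \<Longrightarrow> j \<in> {1..n} \<Longrightarrow> (\<Sum>k=1..n. S k i * S k j) = (if i = j then 1 else (0::real))"
    and eig: "\<And>i k. i \<in> {1..n} \<Longrightarrow> k \<in> {1..n} \<Longrightarrow> (\<Sum>j=1..n. FtF a n k j * S j i) = l i * S k i"
    and bd: "\<And>i. i \<in> {2..n} \<Longrightarrow> xi a n (i - 1) < l i \<and> l i < xi a n i" and l1: "0 < l 1"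
    and mono: "\<And>i j. i \<in> {1..n} \<Longrightarrow> j \<in> {1..n} \<Longrightarrow> i < j \<Longrightarrow> l i < l j"
    by (rule orthonormal_eigensystem_exists[OF a1 n1 n2], rule that, assumption+)
  have lpos: "l i > 0" if "i \<in> {1..n}" for i
    using l1 mono[of 1 i] n1 that by (cases "i = 1") auto
  have S': "(\<Sum>k=1..n. S i k * S j k) = (if i = j then 1 else 0)" if "i \<in> {1..n}" "j \<in> {1..n}" for i j
    using square_left_right_inverse[of n "\<lambda>i k. S k i" "\<lambda>k j. S k j", OF S that] by simp
  define G where "G k j = (\<Sum>m=1..n. S k m * S j m / l m)" for k j
  have "(\<Sum>k=1..n. FtF a n i k * G k j) = (if i = j then 1 else 0)" if "i \<in> {1..n}" "j \<in> {1..n}" for i j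
  proof -
    have "(\<Sum>k=1..n. FtF a n i k * G k j) = (\<Sum>m=1..n. (\<Sum>k=1..n. FtF a n i k * S k m) * (S j m / l m))"
      unfolding G_def sum_distrib_left sum_distrib_right by (subst sum.swap) (simp add: mult_ac)
    also have "\<dots> = (\<Sum>m=1..n. S i m * S j m)"
    proof (intro sum.cong refl)
      fix m assume m: "m \<in> {1..n}"
      show "(\<Sum>k=1..n. FtF a n i k * S k m) * (S j m / l m) = S i m * S j m"
        unfolding eig[OF m that(1)] using lpos[OF m] by simp
    qed
    finally show ?thesis using S'[OF that] by simp
  qed
  then have "\<exists>G. \<forall>i\<in>{1..n}. \<forall>j\<in>{1..n}. (\<Sum>k=1..n. FtF a n i k * G k j) = (if i = j then 1 else 0)"
    by blast
  from someI_ex[OF this] show ?thesis using assms unfolding FtF_inv_def by blast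
qed

text \<open>Only the right-inverse equation is available. So the entry is multiplied by
  \<open>l i\<close>, the eigenvalue is traded for \<open>F'F\<close> acting on the left vector, and
  self-adjointness moves \<open>F'F\<close> onto \<open>FtF_inv\<close>.\<close>

lemma FtF_inv_diag:
  fixes S :: "nat \<Rightarrow> nat \<Rightarrow> real"
  assumes S: "\<And>i j. i \<in> {1..n} \<Longrightarrow> j \<in> {1..n} \<Longrightarrow> (\<Sum>k=1..n. S k i * S k j) = (if i = j then 1 else 0)"
    and eig: "\<And>i k. i \<in> {1..n} \<Longrightarrow> k \<in> {1..n} \<Longrightarrow> (\<Sum>j=1..n. FtF a n k j * S j i) = l i * S k i"
    and lpos: "\<And>i. i \<in> {1..n} \<Longrightarrow> l i \<noteq> 0"
    and ij: "i \<in> {1..n}" "j \<in> {1..n}"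
  shows "(\<Sum>k=1..n. \<Sum>m=1..n. S k i * FtF_inv a n k m * S m j) = (if i = j then 1 / l i else 0)"
proof -
  have "l i * (\<Sum>k=1..n. \<Sum>m=1..n. S k i * FtF_inv a n k m * S m j)
     = (\<Sum>k=1..n. (\<Sum>p=1..n. FtF a n k p * S p i) * (\<Sum>m=1..n. FtF_inv a n k m * S m j))"
    unfolding sum_distrib_left
  proof (intro sum.cong refl)
    fix k m assume k: "k \<in> {1..n}"
    show "l i * (S k i * FtF_inv a n k m * S m j) =
        (\<Sum>p=1..n. FtF a n k p * S p i) * (FtF_inv a n k m * S m j)"
      unfolding eig[OF ij(1) k] by (simp add: mult_ac)
  qed
  also have "\<dots> = (\<Sum>p=1..n. S p i * (\<Sum>k=1..n. FtF a n p k * (\<Sum>m=1..n. FtF_inv a n k m * S m j)))"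
    by (rule FtF_selfadjoint[symmetric])
  also have "\<dots> = (\<Sum>p=1..n. S p i * (\<Sum>m=1..n. (\<Sum>k=1..n. FtF a n p k * FtF_inv a n k m) * S m j))"
    unfolding sum_distrib_left sum_distrib_right
    by (rule sum.cong[OF refl], subst sum.swap) (simp add: mult_ac)
  also have "\<dots> = (\<Sum>p=1..n. S p i * (\<Sum>m=1..n. (if p = m then 1 else 0) * S m j))"
    by (intro sum.cong refl arg_cong2[where f = "(*)"] FtF_inv_right)
  also have "\<dots> = (\<Sum>p=1..n. S p i * S p j)"
  proof (intro sum.cong refl arg_cong2[where f = "(*)"])
    fix p assume p: "p \<in> {1..n}"
    have "(\<Sum>m=1..n. (if p = m then 1 else 0) * S m j) = (\<Sum>m=1..n. if m = p then S m j else 0)"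
      by (intro sum.cong) auto
    then show "(\<Sum>m=1..n. (if p = m then 1 else 0) * S m j) = S p j" using p by simp
  qed
  also have "\<dots> = (if i = j then 1 else 0)" using S[OF ij] .
  finally have "l i * (\<Sum>k=1..n. \<Sum>m=1..n. S k i * FtF_inv a n k m * S m j) = (if i = j then 1 else 0)" .
  moreover have "x = (if i = j then 1 / l i else 0)" if "l i * x = (if i = j then 1 else 0)" for x
    using that lpos[OF ij(1)] by (auto simp: field_simps split: if_splits)
  ultimately show ?thesis by blast
qed

lemma eig_data_props:
  "(\<forall>i\<in>{1..n}. \<forall>j\<in>{1..n}. i \<le> j \<longrightarrow> mu a n i \<le> mu a n j) \<and>
   (\<forall>i\<in>{1..n}. \<forall>j\<in>{1..n}. (\<Sum>k=1..n. Smat a n k i * Smat a n k j) = (if i = j then 1 else 0)) \<and>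
   (\<forall>i\<in>{1..n}. \<forall>j\<in>{1..n}.
      (\<Sum>k=1..n. \<Sum>l=1..n. Smat a n k i * FtF_inv a n k l * Smat a n l j) = (if i = j then 1 / mu a n i else 0))"
proof -
  obtain l S where S: "\<And>i j. i \<in> {1..n} \<Longrightarrow> j \<in> {1..n} \<Longrightarrow> (\<Sum>k=1..n. S k i * S k j) = (if i = j then 1 else (0::real))"
    and eig: "\<And>i k. i \<in> {1..n} \<Longrightarrow> k \<in> {1..n} \<Longrightarrow> (\<Sum>j=1..n. FtF a n k j * S j i) = l i * S k i"
    and bd: "\<And>i. i \<in> {2..n} \<Longrightarrow> xi a n (i - 1) < l i \<and> l i < xi a n i" and l1: "0 < l 1"
    and mono: "\<And>i j. i \<in> {1..n} \<Longrightarrow> j \<in> {1..n} \<Longrightarrow> i < j \<Longrightarrow> l i < l j"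
    by (rule orthonormal_eigensystem_exists[OF a1 n1 n2], rule that, assumption+)
  have mono': "l i \<le> l j" if "i \<in> {1..n}" "j \<in> {1..n}" "i \<le> j" for i j
    using mono[OF that(1,2)] that(3) by (cases "i = j") auto
  have lpos: "l i \<noteq> 0" if "i \<in> {1..n}" for i
    using l1 mono'[of 1 i] that n1 by auto
  define Q where "Q \<mu> S \<longleftrightarrow>
      (\<forall>i\<in>{1..n}. \<forall>j\<in>{1..n}. i \<le> j \<longrightarrow> \<mu> i \<le> \<mu> j) \<and>
      (\<forall>i\<in>{1..n}. \<forall>j\<in>{1..n}. (\<Sum>k=1..n. S k i * S k j) = (if i = j then 1 else 0)) \<and>
      (\<forall>i\<in>{1..n}. \<forall>j\<in>{1..n}.
         (\<Sum>k=1..n. \<Sum>l=1..n. S k i * FtF_inv a n k l * S l j) = (if i = j then 1 / \<mu> i else (0::real)))"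
    for \<mu> :: "nat \<Rightarrow> real" and S
  have "Q l S" unfolding Q_def
  proof (intro conjI ballI impI)
    fix i j assume ij: "i \<in> {1..n}" "j \<in> {1..n}"
    show "(\<Sum>k=1..n. S k i * S k j) = (if i = j then 1 else 0)" by (rule S[OF ij])
    show "(\<Sum>k=1..n. \<Sum>m=1..n. S k i * FtF_inv a n k m * S m j) = (if i = j then 1 / l i else 0)"
      by (rule FtF_inv_diag[OF S eig lpos ij])
    show "l i \<le> l j" if "i \<le> j" by (rule mono'[OF ij that])
  qed
  then have ex: "\<exists>d. case d of (\<mu>, S) \<Rightarrow> Q \<mu> S" by (intro exI[of _ "(l, S)"]) simp
  have e: "eig_data a n = (SOME d. case d of (\<mu>, S) \<Rightarrow> Q \<mu> S)"
    unfolding eig_data_def Q_def by (rule refl)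
  from someI_ex[OF ex] have "case eig_data a n of (\<mu>, S) \<Rightarrow> Q \<mu> S"
    unfolding e .
  then have "Q (mu a n) (Smat a n)"
    unfolding mu_def Smat_def by (simp only: case_prod_beta)
  then show ?thesis unfolding Q_def .
qed

lemma mu_mono: "i \<in> {1..n} \<Longrightarrow> j \<in> {1..n} \<Longrightarrow> i \<le> j \<Longrightarrow> mu a n i \<le> mu a n j"
  using eig_data_props by blast

lemma Smat_orth:
  "i \<in> {1..n} \<Longrightarrow> j \<in> {1..n} \<Longrightarrow> (\<Sum>k=1..n. Smat a n k i * Smat a n k j) = (if i = j then 1 else 0)"
  using eig_data_props by blast

lemma Smat_orth':
  assumes "i \<in> {1..n}" "j \<in> {1..n}"
  shows "(\<Sum>k=1..n. Smat a n i k * Smat a n j k) = (if i = j then 1 else 0)"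
  using square_left_right_inverse[of n "\<lambda>i k. Smat a n k i" "\<lambda>k j. Smat a n k j", OF Smat_orth assms] by simp

text \<open>Stated with a division because \<open>mu a n i \<noteq> 0\<close> is still open: by the
  convention x / 0 = 0 a vanishing \<open>mu\<close> would make a whole column of
  \<open>Smat\<close> zero, against orthonormality. This is how \<open>mu_nonzero\<close>
  follows.\<close>

lemma Smat_eig_aux:
  assumes i: "i \<in> {1..n}" and k: "k \<in> {1..n}"
  shows "(\<Sum>j=1..n. FtF a n k j * Smat a n j i) / mu a n i = Smat a n k i"
proof -
  let ?T = "Smat a n" and ?G = "FtF_inv a n"
  have GT: "(\<Sum>m=1..n. ?G p m * ?T m i) = ?T p i / mu a n i" if p: "p \<in> {1..n}" for p
  proof -
    \<comment> \<open>Inserting \<open>S S' = I\<close> turns \<open>G S\<close> into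
      \<open>S (S' G S)\<close>, and the inner matrix is diagonal by the choice of
      \<open>eig_data\<close>.\<close>
    have "(\<Sum>m=1..n. ?G p m * ?T m i) = (\<Sum>q=1..n. (if p = q then 1 else 0) * (\<Sum>m=1..n. ?G q m * ?T m i))"
    proof -
      have "(\<Sum>q=1..n. (if p = q then 1 else 0) * (\<Sum>m=1..n. ?G q m * ?T m i))
        = (\<Sum>q=1..n. if q = p then (\<Sum>m=1..n. ?G q m * ?T m i) else 0)" by (intro sum.cong) auto
      then show ?thesis using p by simp
    qed
    also have "\<dots> = (\<Sum>q=1..n. (\<Sum>j=1..n. ?T p j * ?T q j) * (\<Sum>m=1..n. ?G q m * ?T m i))"
      by (intro sum.cong refl arg_cong2[where f = "(*)"] Smat_orth'[symmetric] p)
    also have "\<dots> = (\<Sum>j=1..n. ?T p j * (\<Sum>q=1..n. \<Sum>m=1..n. ?T q j * ?G q m * ?T m i))"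
      unfolding sum_distrib_right sum_distrib_left
      by (subst sum.swap, simp only: mult.assoc, rule sum.swap)
    also have "\<dots> = (\<Sum>j=1..n. ?T p j * (if j = i then 1 / mu a n j else 0))"
      using eig_data_props i by (intro sum.cong refl arg_cong2[where f = "(*)"]) auto
    also have "\<dots> = (\<Sum>j=1..n. if j = i then ?T p j / mu a n j else 0)" by (intro sum.cong) auto
    also have "\<dots> = ?T p i / mu a n i" using i by simp
    finally show ?thesis .
  qed
  have "(\<Sum>j=1..n. FtF a n k j * ?T j i) / mu a n i = (\<Sum>j=1..n. FtF a n k j * (\<Sum>m=1..n. ?G j m * ?T m i))"
    unfolding sum_divide_distrib by (intro sum.cong refl) (simp add: GT del: One_nat_def)
  also have "\<dots> = (\<Sum>m=1..n. (\<Sum>j=1..n. FtF a n k j * ?G j m) * ?T m i)"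
    unfolding sum_distrib_right sum_distrib_left by (subst sum.swap) (simp add: mult_ac)
  also have "\<dots> = (\<Sum>m=1..n. (if k = m then 1 else 0) * ?T m i)"
    using k by (intro sum.cong refl arg_cong2[where f = "(*)"] FtF_inv_right)
  also have "\<dots> = (\<Sum>m=1..n. if m = k then ?T m i else 0)" by (intro sum.cong) auto
  also have "\<dots> = ?T k i" using k by simp
  finally show ?thesis .
qed

lemma mu_nonzero: "i \<in> {1..n} \<Longrightarrow> mu a n i \<noteq> 0"
proof
  assume i: "i \<in> {1..n}" and "mu a n i = 0"
  then have "Smat a n k i = 0" if "k \<in> {1..n}" for k using Smat_eig_aux[OF i that] by simp
  then have "(\<Sum>k=1..n. Smat a n k i * Smat a n k i) = 0" by (intro sum.neutral) (auto simp del: One_nat_def)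
  then show False using Smat_orth[OF i i] by simp
qed

lemma Smat_eig:
  assumes "i \<in> {1..n}" "k \<in> {1..n}"
  shows "(\<Sum>j=1..n. FtF a n k j * Smat a n j i) = mu a n i * Smat a n k i"
  using Smat_eig_aux[OF assms] mu_nonzero[OF assms(1)] by (simp add: field_simps)

end

text \<open>Upward induction from 1 gives \<open>i \<le> f i\<close>, downward induction from n
  gives the converse. The lemma matches two ordered lists of eigenvalues.\<close>

lemma strict_mono_self_map_id:
  fixes f :: "nat \<Rightarrow> nat"
  assumes "\<And>i. i \<in> {1..n} \<Longrightarrow> f i \<in> {1..n}" "\<And>i j. i \<in> {1..n} \<Longrightarrow> j \<in> {1..n} \<Longrightarrow> i < j \<Longrightarrow> f i < f j"
    and "i \<in> {1..n}"
  shows "f i = i"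
proof -
  have ge: "i \<le> n \<longrightarrow> i \<le> f i" if "i \<ge> 1" for i
    using that
  proof (induction i rule: nat_induct_at_least)
    case base
    then show ?case using assms(1)[of 1] by auto
  next
    case (Suc i)
    then show ?case using assms(2)[of i "Suc i"] by auto
  qed
  have le: "i \<ge> 1 \<longrightarrow> f i \<le> i" if "i \<le> n" for i
    using that
  proof (induction i rule: inc_induct)
    case base
    then show ?case using assms(1)[of n] by auto
  next
    case (step i)
    then show ?case using assms(2)[of i "Suc i"] by auto
  qed
  show ?thesis using ge[of i] le[of i] assms(3) by auto
qed

context ar_dim
begin

text \<open>The overlap matrix \<open>P\<close> of the chosen eigenvectors with the explicit ones is
  orthogonal and satisfies \<open>(mu a n i - l j) * P i j = 0\<close>. As the \<open>l j\<close>
  are distinct, each row of \<open>P\<close> has a single nonzero entry, at \<open>f i\<close>; the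
  order on both sides then forces \<open>f\<close> to be the identity, which transfers the
  interlacing to \<open>mu\<close>.\<close>

lemma mu_bounds:
  "i \<in> {2..n} \<Longrightarrow> xi a n (i - 1) < mu a n i \<and> mu a n i < xi a n i" "0 < mu a n 1"
proof -
  obtain l S where S: "\<And>i j. i \<in> {1..n} \<Longrightarrow> j \<in> {1..n} \<Longrightarrow> (\<Sum>k=1..n. S k i * S k j) = (if i = j then 1 else (0::real))"
    and eig: "\<And>i k. i \<in> {1..n} \<Longrightarrow> k \<in> {1..n} \<Longrightarrow> (\<Sum>j=1..n. FtF a n k j * S j i) = l i * S k i"
    and bd: "\<And>i. i \<in> {2..n} \<Longrightarrow> xi a n (i - 1) < l i \<and> l i < xi a n i" and l1: "0 < l 1"
    and mono: "\<And>i j. i \<in> {1..n} \<Longrightarrow> j \<in> {1..n} \<Longrightarrow> i < j \<Longrightarrow> l i < l j"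
    by (rule orthonormal_eigensystem_exists[OF a1 n1 n2], rule that, assumption+)
  have S': "(\<Sum>k=1..n. S i k * S j k) = (if i = j then 1 else 0)" if "i \<in> {1..n}" "j \<in> {1..n}" for i j
    using square_left_right_inverse[of n "\<lambda>i k. S k i" "\<lambda>k j. S k j", OF S that] by simp
  let ?T = "Smat a n"
  define P where "P i j = (\<Sum>k=1..n. ?T k i * S k j)" for i j
  have P0: "(mu a n i - l j) * P i j = 0" if "i \<in> {1..n}" "j \<in> {1..n}" for i j
  proof -
    have "l j * P i j = (\<Sum>k=1..n. ?T k i * (\<Sum>m=1..n. FtF a n k m * S m j))"
      unfolding P_def sum_distrib_left[of "l j"] using that eig by (intro sum.cong) (simp_all add: mult_ac del: One_nat_def)
    also have "\<dots> = (\<Sum>m=1..n. (\<Sum>k=1..n. FtF a n m k * ?T k i) * S m j)" by (rule FtF_selfadjoint)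
    also have "\<dots> = mu a n i * P i j"
      unfolding P_def sum_distrib_left[of "mu a n i"] using that Smat_eig by (intro sum.cong) (simp_all add: mult_ac del: One_nat_def)
    finally show ?thesis by auto
  qed
  have PP: "(\<Sum>k=1..n. P i k * P j k) = (if i = j then 1 else 0)" if "i \<in> {1..n}" "j \<in> {1..n}" for i j
    unfolding P_def by (rule trans[OF orthonormal_rows_parseval[OF S'] Smat_orth[OF that]])
  have "\<exists>j. j \<in> {1..n} \<and> P i j \<noteq> 0" if "i \<in> {1..n}" for i
  proof (rule ccontr)
    assume "\<not> ?thesis"
    then have "\<forall>j\<in>{1..n}. P i j = 0" by blast
    then have "(\<Sum>k=1..n. P i k * P i k) = 0" by (intro sum.neutral) (simp del: One_nat_def)
    then show False using PP[OF that that] by simp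
  qed
  then obtain f where f: "\<And>i. i \<in> {1..n} \<Longrightarrow> f i \<in> {1..n} \<and> P i (f i) \<noteq> 0" by metis
  have muf: "mu a n i = l (f i)" if "i \<in> {1..n}" for i
    using P0[of i "f i"] f[OF that] that by auto
  have linj: "i = j" if "l i = l j" "i \<in> {1..n}" "j \<in> {1..n}" for i j
    using mono[of i j] mono[of j i] that by (cases i j rule: linorder_cases) auto
  have Pz: "P i k = 0" if "i \<in> {1..n}" "k \<in> {1..n}" "k \<noteq> f i" for i k
    using P0[of i k] linj[of "f i" k] muf[of i] f[of i] that by auto
  \<comment> \<open>If \<open>f i = f j\<close>, rows i and j of \<open>P\<close> would be supported
    on the same column, against their orthogonality; this also excludes repeated values of
    \<open>mu\<close>.\<close>
  have fmono: "f i < f j" if ij: "i \<in> {1..n}" "j \<in> {1..n}" "i < j" for i j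
  proof -
    have "f i \<noteq> f j"
    proof
      assume e: "f i = f j"
      have "(\<Sum>k=1..n. P i k * P j k) = (\<Sum>k=1..n. if k = f i then P i k * P j k else 0)"
        using Pz ij by (intro sum.cong) (auto simp del: One_nat_def)
      also have "\<dots> = P i (f i) * P j (f j)" using f[OF ij(1)] e by simp
      finally show False using PP[OF ij(1,2)] ij f by auto
    qed
    moreover have "\<not> f j < f i" using mono[of "f j" "f i"] f ij muf mu_mono[of i j] by fastforce
    ultimately show ?thesis by simp
  qed
  have "f i = i" if "i \<in> {1..n}" for i
    using strict_mono_self_map_id[of n f i] f fmono that by blast
  then have "mu a n i = l i" if "i \<in> {1..n}" for i using muf that by auto
  then show "i \<in> {2..n} \<Longrightarrow> xi a n (i - 1) < mu a n i \<and> mu a n i < xi a n i" "0 < mu a n 1"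
    using bd l1 n1 by auto
qed

lemma mu_pos: "i \<in> {1..n} \<Longrightarrow> 0 < mu a n i"
  using mu_bounds(2) mu_mono[of 1 i] n1 by fastforce

lemma xi_pos: "(a - 1)\<^sup>2 \<le> xi a n i"
proof -
  have "2 * a * cos (real i * pi / real (n + 1)) \<le> 2 * a * 1" using a1 by (intro mult_left_mono) auto
  then show ?thesis by (simp add: xi_def power2_eq_square algebra_simps)
qed

lemma mu_ge: "i \<in> {2..n} \<Longrightarrow> (a - 1)\<^sup>2 \<le> mu a n i"
  using mu_bounds(1)[of i] xi_pos[of "i - 1"] by linarith

lemma parseval:
  "(\<Sum>i=1..n. (\<Sum>k=1..n. v k * Smat a n k i) * (\<Sum>k=1..n. w k * Smat a n k i)) = (\<Sum>k=1..n. v k * w k)"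
  by (rule orthonormal_rows_parseval[OF Smat_orth'])

lemma FtF_Smat_transpose:
  assumes "i \<in> {1..n}"
  shows "(\<Sum>k=1..n. (\<Sum>m=1..n. FtF a n k m * v m) * Smat a n k i) = mu a n i * (\<Sum>k=1..n. v k * Smat a n k i)"
proof -
  have "(\<Sum>k=1..n. (\<Sum>m=1..n. FtF a n k m * v m) * Smat a n k i)
      = (\<Sum>k=1..n. v k * (\<Sum>m=1..n. FtF a n k m * Smat a n m i))"
    by (rule FtF_selfadjoint[symmetric])
  also have "\<dots> = mu a n i * (\<Sum>k=1..n. v k * Smat a n k i)"
    unfolding sum_distrib_left[of "mu a n i"] using assms Smat_eig by (intro sum.cong) (simp_all add: mult_ac del: One_nat_def)
  finally show ?thesis .
qed

text \<open>The Rayleigh quotient of the vector with entries \<open>a ^ k\<close>, which \<open>F\<close> maps to a multiple of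
  the first unit vector.\<close>

lemma mu_1_le: "mu a n 1 * a ^ (2 * n - 2) \<le> 1"
proof -
  let ?c = "\<lambda>i. \<Sum>k=1..n. a ^ k * Smat a n k i"
  have F: "(\<Sum>j=1..n. Fmat a k j * a ^ j) = (if k = 1 then a else 0)" if "k \<in> {1..n}" for k
  proof -
    from that obtain m where "k = Suc m" by (cases k) auto
    then show ?thesis unfolding Fmat_apply[OF that] by auto
  qed
  have "mu a n 1 * (\<Sum>k=1..n. a ^ k * a ^ k) = (\<Sum>i=1..n. mu a n 1 * (?c i * ?c i))"
    unfolding sum_distrib_left[symmetric] parseval[of "\<lambda>k. a ^ k" "\<lambda>k. a ^ k"] ..
  also have "\<dots> \<le> (\<Sum>i=1..n. (mu a n i * ?c i) * ?c i)"
    unfolding mult.assoc using mu_mono[of 1] n1 by (intro sum_mono mult_right_mono) auto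
  also have "\<dots> = (\<Sum>i=1..n. (\<Sum>k=1..n. (\<Sum>m=1..n. FtF a n k m * a ^ m) * Smat a n k i) * ?c i)"
    by (intro sum.cong refl arg_cong2[where f = "(*)"] FtF_Smat_transpose[symmetric])
  also have "\<dots> = (\<Sum>k=1..n. (\<Sum>m=1..n. FtF a n k m * a ^ m) * a ^ k)" by (rule parseval)
  also have "\<dots> = (\<Sum>k=1..n. (\<Sum>j=1..n. Fmat a k j * a ^ j) * (\<Sum>j=1..n. Fmat a k j * a ^ j))"
    by (subst FtF_form[symmetric]) (simp add: mult.commute)
  also have "\<dots> = (\<Sum>k=1..n. (if k = 1 then a else 0) * (if k = 1 then a else 0))"
    by (intro sum.cong refl arg_cong2[where f = "(*)"] F)
  also have "\<dots> = (\<Sum>k=1..n. (if k = 1 then a * a else 0))" by (intro sum.cong) auto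
  also have "\<dots> = a * a" using n1 by simp
  finally have "mu a n 1 * (\<Sum>k=1..n. a ^ k * a ^ k) \<le> a * a" .
  \<comment> \<open>The last term of the squared norm alone yields the exponent
    \<open>2 * n - 2\<close>.\<close>
  moreover have "a ^ n * a ^ n \<le> (\<Sum>k=1..n. a ^ k * a ^ k)"
    using a1 n1 by (intro member_le_sum) auto
  ultimately have "mu a n 1 * (a ^ n * a ^ n) \<le> a * a"
    using mu_bounds(2) by (smt (verit) mult_left_mono)
  moreover obtain m where "n = Suc m" using n1 by (cases n) auto
  ultimately have "a * a * (mu a n 1 * a ^ (2 * n - 2)) \<le> a * a * 1"
    by (simp add: algebra_simps power_add mult_2 mult_2_right)
  then show ?thesis using a1 by (subst (asm) mult_le_cancel_left_pos) auto
qed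

lemma sum_quotients:
  "(\<Sum>k\<in>A. f k / s * (g k / t)) = (\<Sum>k\<in>A. f k * g k) / (s * t :: real)"
  unfolding sum_divide_distrib times_divide_times_eq ..

text \<open>Row i is the i-th left singular vector of \<open>F\<close>; column i of
  \<open>Smat\<close> is the matching right one and \<open>sqrt (mu a n i)\<close> the singular
  value.\<close>

definition Omat :: "nat \<Rightarrow> nat \<Rightarrow> real" where
  "Omat i k = (\<Sum>j=1..n. Fmat a k j * Smat a n j i) / sqrt (mu a n i)"

lemma Omat_orth:
  assumes "i \<in> {1..n}" "j \<in> {1..n}"
  shows "(\<Sum>k=1..n. Omat i k * Omat j k) = (if i = j then 1 else 0)"
proof -
  have "(\<Sum>k=1..n. Omat i k * Omat j k)
      = (\<Sum>k=1..n. Smat a n k i * (\<Sum>m=1..n. FtF a n k m * Smat a n m j)) / (sqrt (mu a n i) * sqrt (mu a n j))"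
    unfolding FtF_form Omat_def by (rule sum_quotients)
  also have "(\<Sum>k=1..n. Smat a n k i * (\<Sum>m=1..n. FtF a n k m * Smat a n m j)) = mu a n j * (\<Sum>k=1..n. Smat a n k i * Smat a n k j)"
    unfolding sum_distrib_left[of "mu a n j"] using assms Smat_eig by (intro sum.cong) (simp_all add: mult_ac del: One_nat_def)
  finally show ?thesis using Smat_orth[OF assms] mu_pos[OF assms(1)] by auto
qed

text \<open>\<open>F u\<close> is the vector of innovations, \<open>u 0 = 0\<close> making its first
  entry conform. In the singular bases \<open>F\<close> is diagonal, so each scaled coordinate of x
  is a row of an orthogonal matrix applied to the noise.\<close>

lemma xvec_eq:
  assumes i: "i \<in> {1..n}" and u0: "u 0 = 0"
  shows "sqrt (mu a n i) * xvec a n u i = (\<Sum>k=1..n. Omat i k * (u k - a * u (k - 1)))"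
proof -
  have "(\<Sum>k=1..n. Omat i k * (u k - a * u (k - 1)))
      = (\<Sum>k=1..n. Omat i k * (\<Sum>j=1..n. Fmat a k j * u j))"
    using u0 by (intro sum.cong refl arg_cong2[where f = "(*)"]) (subst Fmat_apply, auto)
  also have "\<dots> = (\<Sum>k=1..n. u k * (\<Sum>m=1..n. FtF a n k m * Smat a n m i)) / sqrt (mu a n i)"
    unfolding FtF_form Omat_def
    using sum_quotients[of "\<lambda>k. \<Sum>j=1..n. Fmat a k j * Smat a n j i" "sqrt (mu a n i)"
        "\<lambda>k. \<Sum>j=1..n. Fmat a k j * u j" 1 "{1..n}"]
    by (simp add: mult.commute)
  also have "(\<Sum>k=1..n. u k * (\<Sum>m=1..n. FtF a n k m * Smat a n m i)) = mu a n i * xvec a n u i"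
    unfolding sum_distrib_left[of "mu a n i"] xvec_def using i Smat_eig by (intro sum.cong) (simp_all add: mult_ac del: One_nat_def)
  also have "mu a n i * xvec a n u i / sqrt (mu a n i) = (mu a n i / sqrt (mu a n i)) * xvec a n u i"
    by simp
  also have "mu a n i / sqrt (mu a n i) = sqrt (mu a n i)"
    using mu_pos[OF i] by (simp add: real_div_sqrt)
  finally show ?thesis ..
qed

end

section \<open>Water-filling and the perturbed multiplier\<close>

text \<open>Mean squared error of the scalar Gaussian channel with multiplier \<open>k\<close> and
  reproduction variance \<open>v\<close>. Being affine in \<open>s\<close>, it serves both for a
  source variance \<open>s\<close> and, given the source value x, for
  \<open>s = x^2\<close>.\<close>

definition cdist :: "real \<Rightarrow> real \<Rightarrow> real \<Rightarrow> real" where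
  "cdist k v s = s / (1 + k * v)\<^sup>2 + v / (1 + k * v)"

text \<open>On an active coordinate \<open>1 + k * v\<close> equals \<open>s / \<theta>\<close>, and
  the two summands are \<open>\<theta>^2 / s\<close> and \<open>\<theta> - \<theta>^2 / s\<close>.
  This singles out \<open>1 / \<theta>\<close> as the multiplier of the true source.\<close>

lemma cdist_waterfilling:
  assumes "\<theta> > 0" "s > 0"
  shows "cdist (1 / \<theta>) (max 0 (s - \<theta>)) s = min \<theta> s"
proof (cases "s \<le> \<theta>")
  case False
  then have "1 + 1 / \<theta> * (s - \<theta>) = s / \<theta>" using assms by (simp add: field_simps)
  then have "cdist (1 / \<theta>) (max 0 (s - \<theta>)) s = s / (s / \<theta>)\<^sup>2 + (s - \<theta>) / (s / \<theta>)"
    using False by (simp add: cdist_def)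
  also have "\<dots> = \<theta>" using assms by (simp add: field_simps power2_eq_square)
  finally show ?thesis using False by simp
qed (use assms in \<open>simp add: cdist_def\<close>)

lemma inverse_square_diff:
  fixes k k' v :: real
  assumes "k > 0" "k' > 0" "v \<ge> 0"
  shows "1 / (1 + k * v)\<^sup>2 - 1 / (1 + k' * v)\<^sup>2
     = (k' - k) * (v / (1 + k * v) / (1 + k' * v)\<^sup>2 + v / (1 + k * v)\<^sup>2 / (1 + k' * v))"
proof -
  define p q where "p = 1 + k * v" and "q = 1 + k' * v"
  have "p > 0" "q > 0" using assms by (auto simp: p_def q_def add_pos_nonneg)
  moreover have "(k' - k) * v = q - p" by (simp add: p_def q_def algebra_simps)
  moreover from calculation have "1 / p\<^sup>2 - 1 / q\<^sup>2 = (q - p) * (1 / p / q\<^sup>2 + 1 / p\<^sup>2 / q)"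
    by (simp add: field_simps power2_eq_square)
  ultimately have "1 / p\<^sup>2 - 1 / q\<^sup>2 = ((k' - k) * v) * (1 / p / q\<^sup>2 + 1 / p\<^sup>2 / q)"
    by simp
  then show ?thesis by (simp add: p_def q_def algebra_simps)
qed

text \<open>The point is uniformity in \<open>s\<close>, which is exponentially large for the first
  coordinate: \<open>s \<le> v + \<theta>\<close>, and each factor \<open>v\<close> is paid by a
  denominator through \<open>v / (1 + k * v) \<le> 1 / k0\<close>. Only the normalised square
  \<open>y\<close> survives in the bound.\<close>

lemma cdist_lipschitz:
  assumes k0: "0 < k0" "k0 \<le> k" "k0 \<le> k'" and \<theta>: "\<theta> > 0" and s: "s \<ge> 0" and y: "y \<ge> 0"
    and v: "v = max 0 (s - \<theta>)"
  shows "\<bar>cdist k v (s * y) - cdist k' v (s * y)\<bar> \<le> \<bar>k - k'\<bar> * (2 * (1 / k0\<^sup>2 + \<theta> / k0) * y + 1 / k0\<^sup>2)"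
proof -
  define p q where "p = 1 + k * v" and "q = 1 + k' * v"
  have v0: "v \<ge> 0" and sv: "s \<le> v + \<theta>" using v by auto
  have p1: "p \<ge> 1" and q1: "q \<ge> 1" using v0 k0 by (auto simp: p_def q_def)
  have pk: "v / p \<le> 1 / k0" and qk: "v / q \<le> 1 / k0"
  proof -
    have "k0 * v \<le> k * v" "k0 * v \<le> k' * v" using v0 k0 by (auto intro: mult_right_mono)
    then have "k0 * v \<le> p" "k0 * v \<le> q" by (auto simp: p_def q_def)
    then show "v / p \<le> 1 / k0" "v / q \<le> 1 / k0"
      using k0 p1 q1 by (auto simp: field_simps)
  qed
  have key: "s * (v / p' / q'\<^sup>2) \<le> 1 / k0\<^sup>2 + \<theta> / k0"
    if "p' \<ge> 1" "q' \<ge> 1" "v / p' \<le> 1 / k0" "v / q' \<le> 1 / k0" for p' q'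
  proof -
    have r: "1 / q' \<le> 1" using that by simp
    have "s * (v / p' / q'\<^sup>2) \<le> (v + \<theta>) * (v / p' / q'\<^sup>2)"
      using sv v0 that by (intro mult_right_mono) auto
    also have "\<dots> = (v / q') * (v / p') * (1 / q') + \<theta> * ((v / p') * ((1 / q') * (1 / q')))"
      by (simp add: field_simps add_divide_distrib power2_eq_square)
    also have "\<dots> \<le> (1 / k0) * (1 / k0) * 1 + \<theta> * ((1 / k0) * (1 * 1))"
      using that r v0 k0 \<theta> by (intro add_mono mult_mono mult_nonneg_nonneg) auto
    finally show ?thesis by (simp add: power2_eq_square)
  qed
  have e1: "cdist k v (s * y) - cdist k' v (s * y)
     = (s * (1 / p\<^sup>2 - 1 / q\<^sup>2)) * y + (v / p - v / q)"
    by (simp add: cdist_def p_def q_def algebra_simps)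
  have e2: "s * (1 / p\<^sup>2 - 1 / q\<^sup>2) = (k' - k) * (s * (v / p / q\<^sup>2) + s * (v / q / p\<^sup>2))"
    using inverse_square_diff[of k k' v] k0 v0 by (simp add: p_def q_def algebra_simps)
  have "p > 0" "q > 0" using p1 q1 by auto
  then have e3: "v / p - v / q = (k' - k) * ((v / p) * (v / q))"
    by (simp add: p_def q_def field_simps)
  have b1: "s * (v / p / q\<^sup>2) + s * (v / q / p\<^sup>2) \<le> 2 * (1 / k0\<^sup>2 + \<theta> / k0)"
    using key[of p q] key[of q p] p1 q1 pk qk by auto
  have b2: "(v / p) * (v / q) \<le> 1 / k0\<^sup>2"
    using mult_mono[OF pk qk] v0 p1 q1 k0 by (simp add: power2_eq_square)
  have "\<bar>cdist k v (s * y) - cdist k' v (s * y)\<bar>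
     = \<bar>k - k'\<bar> * \<bar>(s * (v / p / q\<^sup>2) + s * (v / q / p\<^sup>2)) * y + (v / p) * (v / q)\<bar>"
    unfolding e1 e2 e3 mult.assoc distrib_left[symmetric] abs_mult by (simp add: abs_minus_commute)
  also have "\<bar>(s * (v / p / q\<^sup>2) + s * (v / q / p\<^sup>2)) * y + (v / p) * (v / q)\<bar>
     = (s * (v / p / q\<^sup>2) + s * (v / q / p\<^sup>2)) * y + (v / p) * (v / q)"
    using s v0 p1 q1 y by (intro abs_of_nonneg) auto
  also have "\<dots> \<le> 2 * (1 / k0\<^sup>2 + \<theta> / k0) * y + 1 / k0\<^sup>2"
    using b1 b2 y by (intro add_mono mult_right_mono) auto
  finally show ?thesis by (simp add: mult_left_mono)
qed

text \<open>The gap is the drop of the second summand, whose derivative in the multiplier is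
  \<open>- (v / (1 + k * v))^2\<close>; the first summand decreases as well. This quantitative
  monotonicity is what allows the distortion to be inverted.\<close>

lemma cdist_gap:
  assumes "0 < k" "k \<le> k'" "k' \<le> k1" "0 \<le> v" "v \<le> B" "0 \<le> s"
  shows "(k' - k) * (v\<^sup>2 / (1 + k1 * B)\<^sup>2) \<le> cdist k v s - cdist k' v s"
proof -
  define p q where "p = 1 + k * v" and "q = 1 + k' * v"
  have p1: "p \<ge> 1" and q1: "q \<ge> 1" using assms by (auto simp: p_def q_def)
  have pq: "p \<le> q" using assms by (auto simp: p_def q_def mult_right_mono)
  have q2: "q \<le> 1 + k1 * B" using assms by (auto simp: q_def intro!: mult_mono)
  have "v / p - v / q = (k' - k) * (v\<^sup>2 / (p * q))"
    using p1 q1 by (simp add: p_def q_def field_simps power2_eq_square)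
  moreover have "v\<^sup>2 / (1 + k1 * B)\<^sup>2 \<le> v\<^sup>2 / (p * q)"
    unfolding power2_eq_square using pq q2 p1 q1 assms by (intro divide_left_mono mult_mono) auto
  then have "(k' - k) * (v\<^sup>2 / (1 + k1 * B)\<^sup>2) \<le> (k' - k) * (v\<^sup>2 / (p * q))"
    using assms by (intro mult_left_mono) auto
  moreover have "s / q\<^sup>2 \<le> s / p\<^sup>2"
    using pq p1 q1 assms by (intro divide_left_mono power_mono) auto
  ultimately show ?thesis unfolding cdist_def p_def[symmetric] q_def[symmetric] by linarith
qed

lemma cdist_antimono:
  assumes "0 < k" "k \<le> k'" "0 \<le> v" "0 \<le> s"
  shows "cdist k' v s \<le> cdist k v s"
proof -
  have "0 \<le> (k' - k) * (v\<^sup>2 / (1 + k' * v)\<^sup>2)" using assms by (auto intro!: mult_nonneg_nonneg divide_nonneg_nonneg)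
  with cdist_gap[OF assms(1,2) order_refl assms(3) order_refl assms(4)] show ?thesis by linarith
qed

lemma cdist_strict_antimono:
  assumes "0 < k" "k < k'" "0 < v" "0 \<le> s"
  shows "cdist k' v s < cdist k v s"
proof -
  have "0 < 1 + k' * v" using assms by (auto intro!: add_pos_pos)
  then have "0 < (k' - k) * (v\<^sup>2 / (1 + k' * v)\<^sup>2)" using assms by (auto intro!: mult_pos_pos divide_pos_pos)
  with cdist_gap[of k k' k' v v s] assms show ?thesis by linarith
qed

lemma continuous_on_cdist:
  assumes "v \<ge> 0"
  shows "continuous_on {0<..} (\<lambda>k. cdist k v s)"
proof -
  have "1 + k * v \<noteq> 0" if "k \<in> {0<..}" for k
    using that assms by (smt (verit) greaterThan_iff mult_nonneg_nonneg)
  then show ?thesis unfolding cdist_def by (intro continuous_intros) auto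
qed

section \<open>The average of the limiting spectrum\<close>

lemma xi_diff_le:
  assumes "a > 0" "i \<ge> 1"
  shows "xi a n i - xi a n (i - 1) \<le> 2 * a * pi / real (n + 1)"
proof -
  let ?x = "real (i - 1) * pi / real (n + 1)" and ?y = "real i * pi / real (n + 1)"
  have xy: "?y - ?x = pi / real (n + 1)"
  proof -
    have "?y - ?x = (real i - real (i - 1)) * pi / real (n + 1)"
      by (simp add: diff_divide_distrib left_diff_distrib)
    then show ?thesis using assms by (simp add: of_nat_diff)
  qed
  have "?x < ?y" using xy by (smt (verit) divide_pos_pos of_nat_0_less_iff pi_gt_zero zero_less_Suc Suc_eq_plus1)
  from MVT2[OF this, of cos "\<lambda>x. - sin x"] obtain z where
    "cos ?y - cos ?x = (?y - ?x) * - sin z" by (auto intro!: derivative_eq_intros)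
  then have "cos ?x - cos ?y = pi / real (n + 1) * sin z" unfolding xy by simp
  also have "\<dots> \<le> pi / real (n + 1) * 1" by (intro mult_left_mono) auto
  finally have "2 * a * (cos ?x - cos ?y) \<le> 2 * a * (pi / real (n + 1))"
    using assms by (intro mult_left_mono) auto
  then show ?thesis by (simp add: xi_def algebra_simps)
qed

text \<open>The Poisson integral \<open>1 / (a\<^sup>2 - 1)\<close> as a limit of Riemann sums: the terms are decreasing,
  so each one dominates an increment of the explicit antiderivative.\<close>

lemma sum_inverse_xi_lower:
  assumes a: "a > 1" and c: "c < 1 / (a\<^sup>2 - 1)"
  shows "eventually (\<lambda>n. c < (1 / real n) * (\<Sum>i=2..n. 1 / xi a n i)) sequentially"
proof -
  \<comment> \<open>Since \<open>1 + a^2 - 2 * a * cos x\<close> equals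
    \<open>(a - 1)^2 * cos (x/2)^2 + (a + 1)^2 * sin (x/2)^2\<close>, the half-angle substitution
    scales \<open>tan (x/2)\<close> by the ratio \<open>b\<close>.\<close>
  define b where "b = (a + 1) / (a - 1)"
  have a2: "a\<^sup>2 > 1" using a by (simp add: one_less_power)
  have b: "b > 0" using a by (simp add: b_def)
  define A where "A x = 2 / (a\<^sup>2 - 1) * arctan (b * tan (x / 2))" for x
  define f where "f x = 1 / (1 + a\<^sup>2 - 2 * a * cos x)" for x
  have fden: "1 + a\<^sup>2 - 2 * a * cos x > 0" for x
  proof -
    have "2 * a * cos x \<le> 2 * a * 1" using a by (intro mult_left_mono) auto
    moreover have "(a - 1)\<^sup>2 > 0" using a by simp
    ultimately show ?thesis by (simp add: power2_eq_square algebra_simps)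
  qed
  have fnn: "0 \<le> f x" for x unfolding f_def using fden[of x] by simp
  have dA: "(A has_real_derivative f x) (at x)" if "0 \<le> x" "x < pi" for x
  proof -
    let ?c = "cos (x / 2)" and ?s = "sin (x / 2)"
    have c0: "?c \<noteq> 0" using that cos_gt_zero_pi[of "x/2"] by auto
    have "(A has_real_derivative 2 / (a\<^sup>2 - 1) * (inverse (1 + (b * tan (x/2))\<^sup>2) * (b * (inverse (?c\<^sup>2) * (1/2))))) (at x)"
      unfolding A_def
    proof (rule DERIV_cmult)
      show "((\<lambda>x. arctan (b * tan (x / 2))) has_real_derivative
          inverse (1 + (b * tan (x/2))\<^sup>2) * (b * (inverse (?c\<^sup>2) * (1/2)))) (at x)"
        using c0 by (auto intro!: derivative_eq_intros)
    qed
    moreover have "2 / (a\<^sup>2 - 1) * (inverse (1 + (b * tan (x/2))\<^sup>2) * (b * (inverse (?c\<^sup>2) * (1/2)))) = f x"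
    proof -
      have pos: "?c\<^sup>2 + b\<^sup>2 * ?s\<^sup>2 > 0" using c0 by (simp add: add_pos_nonneg)
      have "inverse (1 + (b * tan (x/2))\<^sup>2) * inverse (?c\<^sup>2) = 1 / (?c\<^sup>2 + b\<^sup>2 * ?s\<^sup>2)"
        using c0 by (simp add: tan_def field_simps power2_eq_square)
      moreover have "(a - 1)\<^sup>2 * (?c\<^sup>2 + b\<^sup>2 * ?s\<^sup>2) = 1 + a\<^sup>2 - 2 * a * cos x"
      proof -
        have "(a - 1)\<^sup>2 * (?c\<^sup>2 + b\<^sup>2 * ?s\<^sup>2) = (a - 1)\<^sup>2 * ?c\<^sup>2 + (a + 1)\<^sup>2 * ?s\<^sup>2"
        proof -
          have "b * (a - 1) = a + 1" using a by (simp add: b_def)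
          then have "(a - 1)\<^sup>2 * b\<^sup>2 = (a + 1)\<^sup>2" by (simp add: mult.commute flip: power_mult_distrib)
          then show ?thesis by (simp add: distrib_left flip: mult.assoc)
        qed
        also have "\<dots> = (a\<^sup>2 + 1) * (?c\<^sup>2 + ?s\<^sup>2) - 2 * a * (?c\<^sup>2 - ?s\<^sup>2)"
        proof -
          have "(a - 1)\<^sup>2 * C + (a + 1)\<^sup>2 * S = (a\<^sup>2 + 1) * (C + S) - 2 * a * (C - S)" for C S :: real
            by (simp add: algebra_simps power2_eq_square)
          then show ?thesis .
        qed
        also have "?c\<^sup>2 - ?s\<^sup>2 = cos x" using cos_double[of "x/2"] by simp
        finally show ?thesis by simp
      qed
      moreover have "b * (a - 1)\<^sup>2 = a\<^sup>2 - 1" using a by (simp add: b_def field_simps power2_eq_square)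
      ultimately have e: "inverse (1 + (b * tan (x/2))\<^sup>2) * inverse (?c\<^sup>2) = 1 / (?c\<^sup>2 + b\<^sup>2 * ?s\<^sup>2)"
        "f x = 1 / ((a - 1)\<^sup>2 * (?c\<^sup>2 + b\<^sup>2 * ?s\<^sup>2))" "a\<^sup>2 - 1 = b * (a - 1)\<^sup>2"
        by (simp_all add: f_def)
      have "2 / X * (I * (b * (J * (1/2)))) = b / X * (I * J)" for X I J :: real by simp
      then have "2 / (a\<^sup>2 - 1) * (inverse (1 + (b * tan (x/2))\<^sup>2) * (b * (inverse (?c\<^sup>2) * (1/2))))
        = b / (a\<^sup>2 - 1) * (inverse (1 + (b * tan (x/2))\<^sup>2) * inverse (?c\<^sup>2))" .
      also have "\<dots> = f x" unfolding e using b by simp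
      finally show ?thesis .
    qed
    ultimately show ?thesis by simp
  qed
  define \<phi> where "\<phi> n i = real i * pi / real (n + 1)" for n i :: nat
  have fx: "1 / xi a n i = f (\<phi> n i)" for n i by (simp add: f_def \<phi>_def xi_def)
  have lower: "A (\<phi> n n) - A (\<phi> n 2) \<le> pi / real (n + 1) * (\<Sum>i=2..n. 1 / xi a n i)" if "n \<ge> 2" for n
  proof -
    have step: "A (\<phi> n (Suc i)) - A (\<phi> n i) \<le> pi / real (n + 1) * f (\<phi> n i)" if i: "i \<in> {2..<n}" for i
    proof -
      have lt: "\<phi> n i < \<phi> n (Suc i)" by (simp add: \<phi>_def divide_strict_right_mono)
      have "real (Suc i) * pi < real (n + 1) * pi" using i by (intro mult_strict_right_mono) auto
      then have up: "\<phi> n (Suc i) < pi" by (simp add: \<phi>_def divide_less_eq mult.commute)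
      have lo: "0 \<le> \<phi> n i" by (simp add: \<phi>_def)
      from MVT2[OF lt, of A f] dA lo up obtain z where z: "\<phi> n i < z" "z < \<phi> n (Suc i)"
          "A (\<phi> n (Suc i)) - A (\<phi> n i) = (\<phi> n (Suc i) - \<phi> n i) * f z" by force
      have "\<phi> n (Suc i) - \<phi> n i = pi / real (n + 1)"
        by (simp add: \<phi>_def diff_divide_distrib[symmetric] left_diff_distrib[symmetric])
      moreover have "f z \<le> f (\<phi> n i)"
      proof -
        have "cos z \<le> cos (\<phi> n i)" using z lo up by (intro cos_monotone_0_pi_le) auto
        then show ?thesis unfolding f_def using fden a by (intro divide_left_mono) (auto intro: mult_pos_pos)
      qed
      ultimately show ?thesis unfolding z(3) by (intro mult_mono) (auto simp: fnn)
    qed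
    have "A (\<phi> n n) - A (\<phi> n 2) = (\<Sum>i=2..<n. A (\<phi> n (Suc i)) - A (\<phi> n i))"
      using sum_Suc_diff'[OF that, of "\<lambda>i. A (\<phi> n i)"] by simp
    also have "\<dots> \<le> (\<Sum>i=2..<n. pi / real (n + 1) * f (\<phi> n i))" by (intro sum_mono step)
    also have "\<dots> \<le> (\<Sum>i=2..n. pi / real (n + 1) * f (\<phi> n i))"
      by (intro sum_mono2) (auto simp: fnn)
    finally show ?thesis by (simp add: fx sum_distrib_left)
  qed
  have "(\<lambda>n. \<phi> n 2 / 2) \<longlonglongrightarrow> 0" unfolding \<phi>_def by real_asymp
  then have "(\<lambda>n. tan (\<phi> n 2 / 2)) \<longlonglongrightarrow> tan 0" by (rule isCont_tendsto_compose[OF isCont_tan, rotated]) simp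
  then have "(\<lambda>n. A (\<phi> n 2)) \<longlonglongrightarrow> 2 / (a\<^sup>2 - 1) * arctan (b * tan 0)"
    unfolding A_def by (intro tendsto_intros)
  \<comment> \<open>\<open>A\<close> is not evaluated at pi, where \<open>tan (x/2)\<close> has its
    pole: the last grid point stays below pi, so the tangent tends to infinity and the arctangent to
    \<open>pi / 2\<close>.\<close>
  moreover have "filterlim (\<lambda>n. \<phi> n n / 2) (at_left (pi / 2)) sequentially"
    unfolding filterlim_at
  proof
    show "(\<lambda>n. \<phi> n n / 2) \<longlonglongrightarrow> pi / 2" unfolding \<phi>_def by real_asymp
    show "\<forall>\<^sub>F n in sequentially. \<phi> n n / 2 \<in> {..<pi / 2} \<and> \<phi> n n / 2 \<noteq> pi / 2"
      by (intro always_eventually) (auto simp: \<phi>_def divide_simps)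
  qed
  then have "filterlim (\<lambda>n. b * tan (\<phi> n n / 2)) at_top sequentially"
    by (intro filterlim_tendsto_pos_mult_at_top[OF tendsto_const b] filterlim_compose[OF filterlim_tan_at_left])
  then have "(\<lambda>n. A (\<phi> n n)) \<longlonglongrightarrow> 2 / (a\<^sup>2 - 1) * (pi / 2)"
    unfolding A_def by (intro tendsto_intros filterlim_compose[OF tendsto_arctan_at_top])
  ultimately have "(\<lambda>n. (A (\<phi> n n) - A (\<phi> n 2)) / pi) \<longlonglongrightarrow> (2 / (a\<^sup>2 - 1) * (pi / 2) - 2 / (a\<^sup>2 - 1) * arctan (b * tan 0)) / pi"
    by (intro tendsto_intros) auto
  also have "(2 / (a\<^sup>2 - 1) * (pi / 2) - 2 / (a\<^sup>2 - 1) * arctan (b * tan 0)) / pi = 1 / (a\<^sup>2 - 1)"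
  proof -
    have "(2 / X * (pi / 2) - 2 / X * arctan (b * tan 0)) / pi = 1 / X" for X :: real by simp
    then show ?thesis .
  qed
  finally have "\<forall>\<^sub>F n in sequentially. c < (A (\<phi> n n) - A (\<phi> n 2)) / pi" using c by (rule order_tendstoD)
  then show ?thesis using eventually_ge_at_top[of 2]
  proof eventually_elim
    case (elim n)
    let ?S = "\<Sum>i=2..n. 1 / xi a n i"
    have S: "?S \<ge> 0" by (intro sum_nonneg) (simp add: fx fnn)
    have "(A (\<phi> n n) - A (\<phi> n 2)) / pi \<le> (1 / real (n + 1)) * ?S"
      using lower[OF elim(2)] by (simp add: field_simps)
    also have "\<dots> \<le> (1 / real n) * ?S" using S elim(2) by (intro mult_right_mono) (auto simp: field_simps)
    finally show ?case using elim(1) by linarith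
  qed
qed

section \<open>The water level for large n\<close>

locale rd_setup =
  fixes a \<sigma>2 d :: real
  assumes a1: "a > 1" and \<sigma>2: "\<sigma>2 > 0" and d0: "0 < d" and dmax: "d < \<sigma>2 / (a\<^sup>2 - 1)"
begin

text \<open>\<open>\<sigma>2\<close> divided by the lower edge of the limiting spectrum; it bounds
  every variance except the first, and the water level.\<close>

definition Msup :: real where "Msup = \<sigma>2 / (a - 1)\<^sup>2"

lemma Msup_pos: "Msup > 0" using a1 \<sigma>2 by (simp add: Msup_def)

abbreviation "s n i \<equiv> sig2 a \<sigma>2 n i"
abbreviation "\<nu> n i \<equiv> nu2 a \<sigma>2 d n i"
abbreviation "\<theta> n \<equiv> theta a \<sigma>2 d n"

text \<open>Half of the room that \<open>d\<close> leaves below the limiting average variance; the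
  Riemann sums eventually exceed \<open>d + delta\<close>.\<close>

definition delta :: real where "delta = (\<sigma>2 / (a\<^sup>2 - 1) - d) / 2"

lemma delta_pos: "delta > 0" using dmax by (simp add: delta_def)

text \<open>The clauses in order: indices from 2 on exist; the hyperbolic root exists; the first
  variance alone can supply the distortion \<open>d\<close>, so a water level exists; the first
  coordinate stays active; the other coordinates keep a positive average reproduction
  variance.\<close>

definition large :: "nat \<Rightarrow> bool" where
  "large n \<longleftrightarrow> n \<ge> 2 \<and> real n + 1 < a * real n \<and> real n * d \<le> \<sigma>2 * a ^ (2 * n - 2) \<and>
     2 * Msup \<le> \<sigma>2 * a ^ (2 * n - 2) \<and> d + delta < (1 / real n) * (\<Sum>i=2..n. \<sigma>2 / xi a n i)"

lemma eventually_large: "eventually large sequentially"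
proof -
  have 1: "eventually (\<lambda>n. real n + 1 < a * real n) sequentially" using a1 by real_asymp
  have 2: "eventually (\<lambda>n. real n * d \<le> \<sigma>2 * a ^ (2 * n - 2)) sequentially"
    using a1 \<sigma>2 d0 by real_asymp
  have 3: "eventually (\<lambda>n. 2 * Msup \<le> \<sigma>2 * a ^ (2 * n - 2)) sequentially"
    using a1 \<sigma>2 Msup_pos by real_asymp
  have "d + (X - d) / 2 < X" if "d < X" for X using that by (simp add: field_simps)
  from this[OF dmax] have "(d + delta) / \<sigma>2 < (\<sigma>2 / (a\<^sup>2 - 1)) / \<sigma>2"
    using \<sigma>2 unfolding delta_def by (intro divide_strict_right_mono)
  then have "(d + delta) / \<sigma>2 < 1 / (a\<^sup>2 - 1)" using \<sigma>2 by simp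
  from sum_inverse_xi_lower[OF a1 this]
  have "eventually (\<lambda>n. d + delta < (1 / real n) * (\<Sum>i=2..n. \<sigma>2 / xi a n i)) sequentially"
  proof eventually_elim
    case (elim n)
    have "(\<Sum>i=2..n. \<sigma>2 / xi a n i) = \<sigma>2 * (\<Sum>i=2..n. 1 / xi a n i)" by (simp add: sum_distrib_left)
    then show ?case using elim \<sigma>2 by (simp add: field_simps)
  qed
  with 1 2 3 eventually_ge_at_top[of 2] show ?thesis unfolding large_def by eventually_elim simp
qed

context
  fixes n :: nat
  assumes large: "large n"
begin

interpretation ar_dim a n
  using large a1 by unfold_locales (auto simp: large_def)

lemma n2': "n \<ge> 2" using large by (simp add: large_def)

lemma s_pos: "i \<in> {1..n} \<Longrightarrow> s n i > 0"
  using mu_pos \<sigma>2 by (simp add: sig2_def)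

lemma s_le: "i \<in> {2..n} \<Longrightarrow> s n i \<le> Msup"
  unfolding sig2_def Msup_def using mu_ge[of i] mu_pos[of i] \<sigma>2 a1 by (intro divide_left_mono) auto

lemma s_ge_xi: "i \<in> {2..n} \<Longrightarrow> \<sigma>2 / xi a n i \<le> s n i"
  unfolding sig2_def using mu_bounds(1)[of i] mu_pos[of i] \<sigma>2
  by (intro divide_left_mono) (auto intro!: mult_pos_pos)

lemma s1_ge: "\<sigma>2 * a ^ (2 * n - 2) \<le> s n 1"
proof -
  have "mu a n 1 * a ^ (2 * n - 2) \<le> 1" by (rule mu_1_le)
  then have "\<sigma>2 * (mu a n 1 * a ^ (2 * n - 2)) \<le> \<sigma>2 * 1" using \<sigma>2 by (intro mult_left_mono) auto
  then show ?thesis using mu_pos[of 1] n1 by (simp add: sig2_def field_simps)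
qed

lemma theta_props: "\<theta> n > 0" "d = (1 / real n) * (\<Sum>i=1..n. min (\<theta> n) (s n i))"
proof -
  define f where "f t = (1 / real n) * (\<Sum>i=1..n. min t (s n i))" for t
  have "f 0 = 0" using s_pos by (simp add: f_def min_def less_imp_le)
  \<comment> \<open>At level \<open>s n 1\<close> the first coordinate alone contributes
    \<open>n * d\<close>, which provides the upper end for the intermediate value theorem.\<close>
  have "real n * d \<le> min (s n 1) (s n 1)" using large s1_ge by (simp add: large_def)
  also have "\<dots> \<le> (\<Sum>i=1..n. min (s n 1) (s n i))"
    using s_pos n1 by (intro member_le_sum) (auto simp: less_imp_le)
  finally have "d \<le> f (s n 1)" using n1 by (simp add: f_def field_simps)
  moreover have "continuous_on {0..s n 1} f" unfolding f_def by (intro continuous_intros)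
  ultimately obtain t where t: "0 \<le> t" "f t = d"
    using IVT'[of f 0 d "s n 1"] \<open>f 0 = 0\<close> d0 s_pos[of 1] n1 by auto
  then have "t > 0 \<and> d = f t" using \<open>f 0 = 0\<close> d0 by (cases "t = 0") auto
  then have "\<exists>\<theta>>0. d = f \<theta>" by blast
  from someI_ex[OF this] show "\<theta> n > 0" "d = (1 / real n) * (\<Sum>i=1..n. min (\<theta> n) (s n i))"
    unfolding theta_def f_def by blast+
qed

lemma theta_ge: "d \<le> \<theta> n"
proof -
  have "d \<le> (1 / real n) * (\<Sum>i=1..n. \<theta> n)"
    by (subst theta_props(2)) (intro mult_left_mono sum_mono, auto)
  then show ?thesis using n1 by simp
qed

lemma nu_nonneg: "0 \<le> \<nu> n i" by (simp add: nu2_def)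

lemma nu_le: "i \<in> {2..n} \<Longrightarrow> \<nu> n i \<le> Msup"
  using s_le[of i] theta_props(1) Msup_pos by (simp add: nu2_def)

text \<open>A variance splits as \<open>s = min \<theta> s + \<nu>\<close>. The first parts average
  to at most \<open>d\<close>, so what the bulk average has in excess of \<open>d\<close> is left to
  \<open>\<nu>\<close>. The assumption \<open>d < \<sigma>2 / (a^2 - 1)\<close> acts here, through
  \<open>delta\<close>.\<close>

lemma sum_nu_ge: "delta \<le> (1 / real n) * (\<Sum>i=2..n. \<nu> n i)"
proof -
  have sp: "{1..n} = insert 1 {2..n}" using n1 by auto
  have "(\<Sum>i=2..n. min (\<theta> n) (s n i)) \<le> (\<Sum>i=1..n. min (\<theta> n) (s n i))"
    unfolding sp using theta_props(1) s_pos[of 1] n1 by simp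
  then have "(1 / real n) * (\<Sum>i=2..n. min (\<theta> n) (s n i)) \<le> d"
    unfolding theta_props(2)[symmetric] by (subst theta_props(2)) (intro mult_left_mono, auto)
  moreover have "(1 / real n) * (\<Sum>i=2..n. \<sigma>2 / xi a n i) \<le> (1 / real n) * (\<Sum>i=2..n. \<nu> n i + min (\<theta> n) (s n i))"
    using s_ge_xi by (intro mult_left_mono sum_mono) (auto simp: nu2_def max_def min_def)
  ultimately show ?thesis using large by (simp add: large_def sum.distrib distrib_left)
qed

lemma theta_less: "\<theta> n < Msup"
proof (rule ccontr)
  assume "\<not> ?thesis"
  then have "(\<Sum>i=2..n. \<nu> n i) = 0"
    using s_le by (intro sum.neutral) (fastforce simp: nu2_def)
  then show False using sum_nu_ge delta_pos by simp
qed

lemma nu1_ge: "s n 1 / 2 \<le> \<nu> n 1" and s1_ge_Msup: "2 * Msup \<le> s n 1"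
proof -
  show "2 * Msup \<le> s n 1" using large s1_ge by (simp add: large_def)
  moreover have "s n 1 - \<theta> n \<le> \<nu> n 1" by (simp add: nu2_def)
  ultimately show "s n 1 / 2 \<le> \<nu> n 1" using theta_less by linarith
qed

lemma cdist_star: "(1 / real n) * (\<Sum>i=1..n. cdist (1 / \<theta> n) (\<nu> n i) (s n i)) = d"
proof -
  have "(\<Sum>i=1..n. cdist (1 / \<theta> n) (\<nu> n i) (s n i)) = (\<Sum>i=1..n. min (\<theta> n) (s n i))"
    unfolding nu2_def by (intro sum.cong refl cdist_waterfilling theta_props s_pos)
  then show ?thesis using theta_props(2) by simp
qed

text \<open>The tangent of the square at \<open>delta / 2\<close> gives
  \<open>v^2 \<ge> delta * v - delta^2 / 4\<close>; averaging leaves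
  \<open>delta^2 - delta^2 / 4\<close>, hence the factor 3/4.\<close>

lemma sum_nu_square_ge: "3 / 4 * delta\<^sup>2 \<le> (1 / real n) * (\<Sum>i=2..n. (\<nu> n i)\<^sup>2)"
proof -
  have "(\<Sum>i=2..n. delta * \<nu> n i - delta\<^sup>2 / 4) \<le> (\<Sum>i=2..n. (\<nu> n i)\<^sup>2)"
  proof (intro sum_mono)
    fix i
    have "0 \<le> (\<nu> n i - delta / 2)\<^sup>2" by simp
    then show "delta * \<nu> n i - delta\<^sup>2 / 4 \<le> (\<nu> n i)\<^sup>2"
      by (simp add: power2_eq_square algebra_simps)
  qed
  moreover have "(\<Sum>i=2..n. delta * \<nu> n i - delta\<^sup>2 / 4) = delta * (\<Sum>i=2..n. \<nu> n i) - real (n - 1) * (delta\<^sup>2 / 4)"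
    by (simp add: sum_subtractf sum_distrib_left)
  moreover have "delta * (real n * delta) \<le> delta * (\<Sum>i=2..n. \<nu> n i)"
    using sum_nu_ge delta_pos n1 by (intro mult_left_mono) (auto simp: field_simps)
  moreover have "real (n - 1) * (delta\<^sup>2 / 4) \<le> real n * (delta\<^sup>2 / 4)"
    by (intro mult_right_mono) auto
  ultimately have "real n * (3 / 4 * delta\<^sup>2) \<le> (\<Sum>i=2..n. (\<nu> n i)\<^sup>2)"
    by (simp add: power2_eq_square algebra_simps)
  then show ?thesis using n1 by (simp add: field_simps)
qed

text \<open>Coordinate 1 escapes the bound \<open>Msup\<close>, so it contributes bare monotonicity
  and the slope comes from the other coordinates.\<close>

lemma sum_cdist_gap:
  assumes "0 < k" "k \<le> k'" "k' \<le> k1" and t: "\<And>i. i \<in> {1..n} \<Longrightarrow> 0 \<le> t i"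
  shows "(k' - k) * (3 / 4 * delta\<^sup>2 / (1 + k1 * Msup)\<^sup>2)
     \<le> (1 / real n) * (\<Sum>i=1..n. cdist k (\<nu> n i) (t i)) - (1 / real n) * (\<Sum>i=1..n. cdist k' (\<nu> n i) (t i))"
proof -
  have sp: "{1..n} = insert 1 {2..n}" using n1 by auto
  have "(k' - k) * (3 / 4 * delta\<^sup>2 / (1 + k1 * Msup)\<^sup>2)
      \<le> (k' - k) * ((1 / real n) * (\<Sum>i=2..n. (\<nu> n i)\<^sup>2) / (1 + k1 * Msup)\<^sup>2)"
    using sum_nu_square_ge assms by (intro mult_left_mono divide_right_mono) auto
  also have "\<dots> = (1 / real n) * (\<Sum>i=2..n. (k' - k) * ((\<nu> n i)\<^sup>2 / (1 + k1 * Msup)\<^sup>2))"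
    by (simp add: sum_distrib_left sum_divide_distrib)
  also have "\<dots> \<le> (1 / real n) * (\<Sum>i=2..n. cdist k (\<nu> n i) (t i) - cdist k' (\<nu> n i) (t i))"
    using assms nu_le nu_nonneg by (intro mult_left_mono sum_mono cdist_gap) auto
  also have "\<dots> \<le> (1 / real n) * (\<Sum>i=1..n. cdist k (\<nu> n i) (t i) - cdist k' (\<nu> n i) (t i))"
    unfolding sp using cdist_antimono[of k k' "\<nu> n 1" "t 1"] assms nu_nonneg n1
    by (intro mult_left_mono) auto
  finally show ?thesis by (simp add: sum_subtractf right_diff_distrib)
qed

lemma nu1_pos: "0 < \<nu> n 1"
  using nu1_ge s1_ge_Msup Msup_pos by linarith

context
  fixes e :: real and u :: "nat \<Rightarrow> real"
  assumes e: "1 / real n \<le> e" "e \<le> 1" "e \<le> (a - 1) / 2" "e \<le> a\<^sup>2 - a"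
    and u: "\<bar>aML n u - a\<bar> \<le> e"
begin

text \<open>Origin of the conditions on \<open>e\<close>: \<open>(a - 1) / 2\<close> keeps the
  estimate away from 1, where the proxy spectrum would degenerate; \<open>a^2 - a\<close> caps it by
  \<open>a^2\<close>; and \<open>1 / n \<le> e\<close> lets \<open>e\<close> absorb discretisation
  errors.\<close>

lemma aML_bounds: "(a - 1) / 2 \<le> aML n u - 1" "aML n u \<le> a\<^sup>2" "\<bar>aML n u - a\<bar> \<le> 1"
  using e u by (auto simp: abs_le_iff field_simps)

lemma xi_aML_ge: "((a - 1) / 2)\<^sup>2 \<le> 1 + (aML n u)\<^sup>2 - 2 * aML n u * cos x"
proof -
  let ?b = "aML n u"
  have b: "?b \<ge> 1" using aML_bounds(1) a1 by (simp add: field_simps)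
  have "2 * ?b * cos x \<le> 2 * ?b * 1" using b by (intro mult_left_mono) auto
  moreover have "((a - 1) / 2)\<^sup>2 \<le> (?b - 1)\<^sup>2"
    using aML_bounds(1) a1 by (intro power_mono) auto
  ultimately show ?thesis by (simp add: power2_eq_square algebra_simps)
qed

lemma sighat_pos: "sighat2 \<sigma>2 n u i > 0"
proof -
  have "((a - 1) / 2)\<^sup>2 > 0" using a1 by simp
  then have "1 + (aML n u)\<^sup>2 - 2 * aML n u * cos x > 0" for x
    using xi_aML_ge[of x] by linarith
  moreover have "aML n u > 0" using aML_bounds(1) a1 by (simp add: field_simps)
  ultimately show ?thesis using \<sigma>2 by (auto simp: sighat2_def)
qed

text \<open>Two errors add up in the denominator: the estimate instead of \<open>a\<close> costs at
  most \<open>(2 * a + 3) * e\<close>, and the grid point instead of the true eigenvalue costs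
  \<open>2 * a * pi / (n + 1)\<close>. Both denominators stay away from 0.\<close>

lemma sighat_diff:
  assumes i: "i \<in> {2..n}"
  shows "\<bar>sighat2 \<sigma>2 n u i - s n i\<bar> \<le> \<sigma>2 * ((2 * a * pi + 2 * a + 3) * e) / (((a - 1) / 2)\<^sup>2 * (a - 1)\<^sup>2)"
proof -
  let ?b = "aML n u" and ?x = "real i * pi / real (n + 1)"
  have "0 \<le> 1 / real n" by simp
  with e(1) have e0: "0 \<le> e" by linarith
  define y where "y = 1 + ?b\<^sup>2 - 2 * ?b * cos ?x"
  have y: "((a - 1) / 2)\<^sup>2 \<le> y" unfolding y_def by (rule xi_aML_ge)
  have p: "((a - 1) / 2)\<^sup>2 > 0" "(a - 1)\<^sup>2 > 0" using a1 by auto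
  have m: "(a - 1)\<^sup>2 \<le> mu a n i" using mu_ge[OF i] .
  have "y - xi a n i = (?b - a) * (?b + a - 2 * cos ?x)"
    by (simp add: y_def xi_def power2_eq_square algebra_simps)
  then have "\<bar>y - xi a n i\<bar> = \<bar>?b - a\<bar> * \<bar>?b + a - 2 * cos ?x\<bar>" by (simp add: abs_mult)
  also have "\<dots> \<le> e * (2 * a + 3)"
  proof (rule mult_mono)
    have "-1 \<le> cos ?x" "cos ?x \<le> 1" by simp_all
    then show "\<bar>?b + a - 2 * cos ?x\<bar> \<le> 2 * a + 3" using aML_bounds(1,3) a1 unfolding abs_le_iff by argo
  qed (use u e in auto)
  finally have d1: "\<bar>y - xi a n i\<bar> \<le> (2 * a + 3) * e" by (simp add: mult.commute)
  have "xi a n i - xi a n (i - 1) \<le> 2 * a * pi / real (n + 1)"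
    using i a1 by (intro xi_diff_le) auto
  also have "\<dots> \<le> 2 * a * pi * e"
  proof -
    have "1 / real (n + 1) \<le> 1 / real n" using n1 by (intro divide_left_mono) auto
    then have "1 / real (n + 1) \<le> e" using e(1) by linarith
    then have "2 * a * pi * (1 / real (n + 1)) \<le> 2 * a * pi * e" using a1 by (intro mult_left_mono) auto
    then show ?thesis by simp
  qed
  finally have d2: "\<bar>xi a n i - mu a n i\<bar> \<le> 2 * a * pi * e"
    using mu_bounds(1)[OF i] by (simp add: abs_le_iff)
  have d3: "\<bar>mu a n i - y\<bar> \<le> (2 * a * pi + 2 * a + 3) * e"
    using d1 d2 by (simp add: abs_le_iff algebra_simps)
  have "sighat2 \<sigma>2 n u i - s n i = \<sigma>2 / y - \<sigma>2 / mu a n i"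
    using i by (auto simp: sighat2_def sig2_def y_def)
  also have "\<dots> = \<sigma>2 * (mu a n i - y) / (y * mu a n i)"
  proof -
    have "y > 0" "mu a n i > 0" using y m p by linarith+
    then show ?thesis by (simp add: field_simps)
  qed
  finally have "\<bar>sighat2 \<sigma>2 n u i - s n i\<bar> = \<sigma>2 * \<bar>mu a n i - y\<bar> / (y * mu a n i)"
  proof -
    have "y > 0" "mu a n i > 0" using y m p by linarith+
    then show "\<bar>sighat2 \<sigma>2 n u i - s n i\<bar> = \<sigma>2 * \<bar>mu a n i - y\<bar> / (y * mu a n i)"
      if "sighat2 \<sigma>2 n u i - s n i = \<sigma>2 * (mu a n i - y) / (y * mu a n i)"
      unfolding that using \<sigma>2 by (simp add: abs_mult)
  qed
  also have "\<dots> \<le> \<sigma>2 * ((2 * a * pi + 2 * a + 3) * e) / (((a - 1) / 2)\<^sup>2 * (a - 1)\<^sup>2)"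
  proof (rule frac_le)
    show "\<sigma>2 * \<bar>mu a n i - y\<bar> \<le> \<sigma>2 * ((2 * a * pi + 2 * a + 3) * e)"
      using d3 \<sigma>2 by (intro mult_left_mono) auto
    show "0 < ((a - 1) / 2)\<^sup>2 * (a - 1)\<^sup>2" using p by (rule mult_pos_pos)
    show "((a - 1) / 2)\<^sup>2 * (a - 1)\<^sup>2 \<le> y * mu a n i" using y m p by (intro mult_mono) linarith+
    show "0 \<le> \<sigma>2 * ((2 * a * pi + 2 * a + 3) * e)" using \<sigma>2 a1 e(1)
      by (intro mult_nonneg_nonneg add_nonneg_nonneg e0) auto
  qed
  finally show ?thesis .
qed

text \<open>Closeness of the two first variances is not claimed. The estimate is at most
  \<open>a^2\<close>, so the proxy variance is at most \<open>\<sigma>2 * a ^ (4 * n)\<close>, hence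
  at most a multiple of \<open>(s n 1)^2\<close>, while the denominator is at least
  \<open>(k0 * s n 1 / 2)^2\<close> because \<open>\<nu> n 1\<close> is at least half of
  \<open>s n 1\<close>.\<close>

lemma first_coordinate_bound:
  assumes "0 < k0" "k0 \<le> k"
  shows "(sighat2 \<sigma>2 n u 1 + s n 1) / (1 + k * \<nu> n 1)\<^sup>2 \<le> 4 * (a ^ 4 / \<sigma>2 + 1 / (2 * Msup)) / k0\<^sup>2"
proof -
  let ?s = "s n 1"
  have sp: "?s > 0" using s1_ge_Msup Msup_pos by linarith
  have "(aML n u) ^ (2 * n) \<le> (a\<^sup>2) ^ (2 * n)"
    using aML_bounds a1 by (intro power_mono) (auto simp: field_simps)
  also have "\<dots> = a ^ 4 * (a ^ (2 * n - 2))\<^sup>2"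
  proof -
    have "2 * (2 * n) = 4 + (2 * n - 2) * 2" using n1 by simp
    then show ?thesis by (simp only: power_mult[symmetric] power_add[symmetric])
  qed
  finally have "sighat2 \<sigma>2 n u 1 \<le> \<sigma>2 * (a ^ 4 * (a ^ (2 * n - 2))\<^sup>2)"
    using \<sigma>2 by (simp add: sighat2_def)
  also have "\<dots> = a ^ 4 / \<sigma>2 * (\<sigma>2 * a ^ (2 * n - 2))\<^sup>2"
    using \<sigma>2 by (simp add: power_mult_distrib power2_eq_square)
  also have "\<dots> \<le> a ^ 4 / \<sigma>2 * ?s\<^sup>2"
    using s1_ge \<sigma>2 a1 by (intro mult_left_mono power_mono) auto
  finally have 1: "sighat2 \<sigma>2 n u 1 \<le> a ^ 4 / \<sigma>2 * ?s\<^sup>2" .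
  have "2 * Msup * ?s \<le> ?s * ?s" using s1_ge_Msup sp by (intro mult_right_mono) auto
  then have 2: "?s \<le> 1 / (2 * Msup) * ?s\<^sup>2"
    using Msup_pos by (simp add: field_simps power2_eq_square)
  have 3: "k0 * (?s / 2) \<le> 1 + k * \<nu> n 1"
  proof -
    have "k0 * (?s / 2) \<le> k * \<nu> n 1" using assms nu1_ge sp by (intro mult_mono) auto
    then show ?thesis by simp
  qed
  have "(sighat2 \<sigma>2 n u 1 + s n 1) / (1 + k * \<nu> n 1)\<^sup>2
     \<le> ((a ^ 4 / \<sigma>2 + 1 / (2 * Msup)) * ?s\<^sup>2) / (k0 * (?s / 2))\<^sup>2"
    using 1 2 3 sp assms sighat_pos[of 1] by (intro frac_le power_mono) (auto simp: distrib_right)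
  also have "\<dots> = 4 * (a ^ 4 / \<sigma>2 + 1 / (2 * Msup)) / k0\<^sup>2"
    using sp assms by (simp add: power2_eq_square field_simps)
  finally show ?thesis .
qed

end

end

section \<open>The multiplier of the proxy\<close>

definition Csig :: real where
  "Csig = \<sigma>2 * (2 * a * pi + 2 * a + 3) / (((a - 1) / 2)\<^sup>2 * (a - 1)\<^sup>2)
      + 4 * (a ^ 4 / \<sigma>2 + 1 / (2 * Msup)) / (1 / (2 * Msup))\<^sup>2"

definition slope :: real where "slope = 3 / 4 * delta\<^sup>2 / (1 + 2 / d * Msup)\<^sup>2"

text \<open>\<open>Csig * e\<close> bounds the change of the average distortion between true and
  proxy variances, and \<open>slope\<close> is a lower bound for its rate of decrease at multipliers
  up to \<open>2 / d\<close>. Shifting the multiplier by \<open>Ckap * e\<close> thus moves the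
  distortion by at least \<open>(Csig + 1) * e\<close>, which beats the perturbation.\<close>

definition Ckap :: real where "Ckap = (Csig + 1) / slope"

lemma Csig_pos: "Csig > 0"
  unfolding Csig_def using \<sigma>2 a1 Msup_pos by (intro add_pos_pos divide_pos_pos mult_pos_pos) auto

lemma slope_pos: "slope > 0"
  unfolding slope_def using delta_pos d0 Msup_pos
  by (intro divide_pos_pos mult_pos_pos zero_less_power add_pos_pos) auto

lemma Ckap_pos: "Ckap > 0" using Csig_pos slope_pos by (simp add: Ckap_def)

text \<open>Expected distortion of the proxy under the channel with multiplier \<open>k\<close>.
  Equality with \<open>d\<close> says that the constraint is tight.\<close>

definition ehat :: "nat \<Rightarrow> real \<Rightarrow> (nat \<Rightarrow> real) \<Rightarrow> real" where
  "ehat n k u = (1 / real n) * (\<Sum>i=1..n. cdist k (\<nu> n i) (sighat2 \<sigma>2 n u i))"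

text \<open>The first coordinate costs a constant divided by n, hence at most that constant times
  \<open>e\<close>; the others cost a multiple of \<open>e\<close> each, as the denominators
  \<open>(1 + k * \<nu> n i)^2\<close> are at least 1.\<close>

lemma ehat_close:
  assumes large: "large n" and e: "1 / real n \<le> e" "e \<le> 1" "e \<le> (a - 1) / 2" "e \<le> a\<^sup>2 - a"
    and u: "\<bar>aML n u - a\<bar> \<le> e" and k: "1 / (2 * Msup) \<le> k"
  shows "\<bar>ehat n k u - (1 / real n) * (\<Sum>i=1..n. cdist k (\<nu> n i) (s n i))\<bar> \<le> Csig * e"
proof -
  define C1 where "C1 = \<sigma>2 * (2 * a * pi + 2 * a + 3) / (((a - 1) / 2)\<^sup>2 * (a - 1)\<^sup>2)"
  define C2 where "C2 = 4 * (a ^ 4 / \<sigma>2 + 1 / (2 * Msup)) / (1 / (2 * Msup))\<^sup>2"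
  have n: "n \<ge> 2" using large by (rule n2')
  have sp: "{1..n} = insert 1 {2..n}" using n by auto
  have k0: "0 < 1 / (2 * Msup)" using Msup_pos by simp
  have "0 < 1 / real n" using n by simp
  with e(1) have e0: "e > 0" by linarith
  have C10: "C1 \<ge> 0" using \<sigma>2 a1 by (simp add: C1_def)
  have t: "\<bar>cdist k (\<nu> n i) (sighat2 \<sigma>2 n u i) - cdist k (\<nu> n i) (s n i)\<bar> = \<bar>sighat2 \<sigma>2 n u i - s n i\<bar> / (1 + k * \<nu> n i)\<^sup>2" for i
    by (simp add: cdist_def diff_divide_distrib[symmetric])
  have w: "(1 + k * \<nu> n i)\<^sup>2 \<ge> 1" for i
  proof -
    have "0 \<le> k * \<nu> n i" using nu_nonneg[OF large] k k0 by (intro mult_nonneg_nonneg) linarith+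
    then show ?thesis by (intro one_le_power) simp
  qed
  have b: "\<bar>cdist k (\<nu> n i) (sighat2 \<sigma>2 n u i) - cdist k (\<nu> n i) (s n i)\<bar> \<le> C1 * e" if "i \<in> {2..n}" for i
  proof -
    have "\<bar>sighat2 \<sigma>2 n u i - s n i\<bar> / (1 + k * \<nu> n i)\<^sup>2 \<le> \<bar>sighat2 \<sigma>2 n u i - s n i\<bar> / 1"
      using w[of i] by (intro divide_left_mono) auto
    also have "\<dots> \<le> C1 * e" using sighat_diff[OF large e u that] by (simp add: C1_def mult.assoc)
    finally show ?thesis unfolding t .
  qed
  have b1: "\<bar>cdist k (\<nu> n 1) (sighat2 \<sigma>2 n u 1) - cdist k (\<nu> n 1) (s n 1)\<bar> \<le> C2"
  proof -
    have "\<bar>sighat2 \<sigma>2 n u 1 - s n 1\<bar> / (1 + k * \<nu> n 1)\<^sup>2 \<le> (sighat2 \<sigma>2 n u 1 + s n 1) / (1 + k * \<nu> n 1)\<^sup>2"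
      using sighat_pos[OF large e u, of 1] s_pos[OF large, of 1] n by (intro divide_right_mono) auto
    also have "\<dots> \<le> C2" unfolding C2_def by (rule first_coordinate_bound[OF large e u k0 k])
    finally show ?thesis unfolding t .
  qed
  have "\<bar>ehat n k u - (1 / real n) * (\<Sum>i=1..n. cdist k (\<nu> n i) (s n i))\<bar>
     = (1 / real n) * \<bar>\<Sum>i=1..n. cdist k (\<nu> n i) (sighat2 \<sigma>2 n u i) - cdist k (\<nu> n i) (s n i)\<bar>"
  proof -
    have "\<bar>r * x - r * y\<bar> = r * \<bar>x - y\<bar>" if "r \<ge> 0" for r x y :: real
      using that by (simp add: abs_mult flip: right_diff_distrib)
    from this[of "1 / real n"] show ?thesis unfolding ehat_def sum_subtractf by simp
  qed
  also have "\<dots> \<le> (1 / real n) * (\<Sum>i=1..n. \<bar>cdist k (\<nu> n i) (sighat2 \<sigma>2 n u i) - cdist k (\<nu> n i) (s n i)\<bar>)"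
    by (intro mult_left_mono sum_abs) auto
  also have "\<dots> \<le> (1 / real n) * (C2 + (\<Sum>i=2..n. C1 * e))"
  proof -
    have "(\<Sum>i=2..n. \<bar>cdist k (\<nu> n i) (sighat2 \<sigma>2 n u i) - cdist k (\<nu> n i) (s n i)\<bar>) \<le> (\<Sum>i=2..n. C1 * e)"
      by (intro sum_mono b)
    then show ?thesis unfolding sp using b1 by (intro mult_left_mono) (auto simp del: sum_constant)
  qed
  also have "\<dots> = C2 * (1 / real n) + real (n - 1) / real n * (C1 * e)"
    by (simp add: distrib_left)
  also have "\<dots> \<le> C2 * e + 1 * (C1 * e)"
    using e(1) n C10 e0 b1 by (intro add_mono mult_left_mono mult_right_mono) auto
  finally have "\<bar>ehat n k u - (1 / real n) * (\<Sum>i=1..n. cdist k (\<nu> n i) (s n i))\<bar> \<le> (C1 + C2) * e"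
    by (simp only: distrib_right mult_1_left add.commute)
  moreover have "Csig = C1 + C2" by (simp only: Csig_def C1_def C2_def)
  ultimately show ?thesis by simp
qed

text \<open>At the true variances the distortion differs from \<open>d\<close> by at least
  \<open>(Csig + 1) * e\<close> at both points \<open>1 / \<theta> n - Ckap * e\<close> and
  \<open>1 / \<theta> n + Ckap * e\<close>; the proxy changes it by at most \<open>Csig * e\<close>,
  so the signs persist. As \<open>1 / \<theta> n\<close> lies between \<open>1 / Msup\<close> and
  \<open>1 / d\<close>, the conditions on \<open>Ckap * e\<close> keep the interval between
  \<open>1 / (2 * Msup)\<close> and \<open>2 / d\<close>.\<close>

lemma ehat_root_exists:
  assumes large: "large n" and e: "1 / real n \<le> e" "e \<le> 1" "e \<le> (a - 1) / 2" "e \<le> a\<^sup>2 - a"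
    and e': "Ckap * e \<le> 1 / (2 * Msup)" "Ckap * e \<le> 1 / d"
    and u: "\<bar>aML n u - a\<bar> \<le> e"
  shows "\<exists>k. 1 / (2 * Msup) \<le> k \<and> \<bar>k - 1 / \<theta> n\<bar> \<le> Ckap * e \<and> ehat n k u = d"
proof -
  let ?D = "\<lambda>k. (1 / real n) * (\<Sum>i=1..n. cdist k (\<nu> n i) (s n i))"
  let ?c = "1 / \<theta> n" and ?t = "Ckap * e"
  have n: "n \<ge> 2" using large by (rule n2')
  have "0 < 1 / real n" using n by simp
  with e(1) have e0: "e > 0" by linarith
  have t0: "?t > 0" using Ckap_pos e0 by simp
  have th: "\<theta> n > 0" "\<theta> n < Msup" "d \<le> \<theta> n"
    using theta_props[OF large] theta_less[OF large] theta_ge[OF large] by auto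
  have c1: "1 / Msup \<le> ?c" using th Msup_pos by (intro divide_left_mono) auto
  have c2: "?c \<le> 1 / d" using th d0 by (intro divide_left_mono) auto
  have k0: "0 < 1 / (2 * Msup)" using Msup_pos by simp
  have h: "1 / Msup = 1 / (2 * Msup) + 1 / (2 * Msup)" by (simp add: field_simps)
  have lo: "1 / (2 * Msup) \<le> ?c - ?t" using c1 e' h by linarith
  have hi: "?c + ?t \<le> 2 / d" using c2 e'(2) add_divide_distrib[of 1 1 d] by linarith
  have snn: "i \<in> {1..n} \<Longrightarrow> 0 \<le> s n i" for i using s_pos[OF large, of i] by auto
  have ts: "?t * slope = (Csig + 1) * e" using slope_pos by (simp add: Ckap_def)
  have D: "?D ?c = d" by (rule cdist_star[OF large])
  have "?t * slope \<le> ?D (?c - ?t) - ?D ?c"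
    using sum_cdist_gap[OF large, of "?c - ?t" ?c "2 / d" "s n"] lo k0 hi t0 snn
    by (simp add: slope_def)
  then have g1: "?D (?c - ?t) \<ge> d + (Csig + 1) * e" using D ts by simp
  have "?t * slope \<le> ?D ?c - ?D (?c + ?t)"
    using sum_cdist_gap[OF large, of ?c "?c + ?t" "2 / d" "s n"] hi t0 snn th
    by (simp add: slope_def)
  then have g2: "?D (?c + ?t) \<le> d - (Csig + 1) * e" using D ts by simp
  have h1: "ehat n (?c - ?t) u \<ge> d"
    using ehat_close[OF large e u lo] g1 e0 by (simp add: abs_le_iff algebra_simps)
  have h2: "ehat n (?c + ?t) u \<le> d"
    using ehat_close[OF large e u, of "?c + ?t"] lo t0 g2 e0 by (simp add: abs_le_iff algebra_simps)
  have "{?c - ?t..?c + ?t} \<subseteq> {0<..}"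
    using less_le_trans[OF k0 lo] by (auto intro: less_le_trans)
  then have cont: "continuous_on {?c - ?t..?c + ?t} (\<lambda>k. ehat n k u)"
    unfolding ehat_def
    by (intro continuous_intros continuous_on_subset[OF continuous_on_cdist] nu_nonneg[OF large])
  from IVT2'[OF h2 h1 _ cont] t0 obtain k where "?c - ?t \<le> k" "k \<le> ?c + ?t" "ehat n k u = d" by auto
  then show ?thesis using lo by (intro exI[of _ k]) (auto simp: abs_le_iff)
qed

text \<open>Strictness comes from coordinate 1, whose reproduction variance is positive.\<close>

lemma ehat_strict_antimono:
  assumes large: "large n" and e: "1 / real n \<le> e" "e \<le> 1" "e \<le> (a - 1) / 2" "e \<le> a\<^sup>2 - a"
    and u: "\<bar>aML n u - a\<bar> \<le> e" and k: "0 < k" "k < k'"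
  shows "ehat n k' u < ehat n k u"
proof -
  have n: "n \<ge> 2" using large by (rule n2')
  have sp: "{1..n} = insert 1 {2..n}" using n by auto
  have "cdist k' (\<nu> n 1) (sighat2 \<sigma>2 n u 1) < cdist k (\<nu> n 1) (sighat2 \<sigma>2 n u 1)"
    using k nu1_pos[OF large] sighat_pos[OF large e u, of 1] by (intro cdist_strict_antimono) auto
  moreover have "(\<Sum>i=2..n. cdist k' (\<nu> n i) (sighat2 \<sigma>2 n u i)) \<le> (\<Sum>i=2..n. cdist k (\<nu> n i) (sighat2 \<sigma>2 n u i))"
    using k nu_nonneg[OF large] sighat_pos[OF large e u]
    by (intro sum_mono cdist_antimono) (auto intro: less_imp_le)
  ultimately show ?thesis unfolding ehat_def sp using n by (intro mult_strict_left_mono) auto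
qed

end

section \<open>The optimal test channel\<close>

text \<open>A one-sided Donsker--Varadhan bound. The term \<open>c - 1\<close> linearises the logarithm of the
  partition function.\<close>

lemma relent_ge:
  fixes \<phi> :: "'a \<Rightarrow> real"
  assumes P: "prob_space P" and Q: "prob_space Q" and sets: "sets P = sets Q"
    and \<phi>: "integrable P \<phi>" and c: "(\<integral>\<^sup>+y. ennreal (exp (\<phi> y)) \<partial>Q) \<le> ennreal c" "c \<ge> 0"
  shows "ennreal ((\<integral>y. \<phi> y \<partial>P) - c + 1) \<le> relent P Q"
proof (cases "absolutely_continuous Q P \<and> integrable P (entropy_density (exp 1) Q P)")
  case True
  interpret P: prob_space P by fact
  interpret Q: prob_space Q by fact
  define f where "f y = enn2real (RN_deriv Q P y)" for y
  have ac: "absolutely_continuous Q P" and int: "integrable P (entropy_density (exp 1) Q P)" using True by auto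
  have [measurable]: "f \<in> borel_measurable Q" unfolding f_def by measurable
  have [measurable]: "f \<in> borel_measurable P" using \<open>f \<in> borel_measurable Q\<close> sets measurable_cong_sets by blast
  have [measurable]: "\<phi> \<in> borel_measurable P" using \<phi> by auto
  then have [measurable]: "\<phi> \<in> borel_measurable Q" using sets measurable_cong_sets by blast
  have ed: "entropy_density (exp 1) Q P = (\<lambda>y. ln (f y))"
    by (simp add: entropy_density_def comp_def f_def log_def)
  have fin: "AE y in Q. RN_deriv Q P y \<noteq> \<infinity>"
    by (rule Q.RN_deriv_finite[OF P.sigma_finite_measure_axioms ac sets])
  then have "density Q (\<lambda>y. ennreal (f y)) = density Q (RN_deriv Q P)"
    by (intro density_cong) (auto simp: f_def less_top[symmetric])
  then have dens: "density Q (\<lambda>y. ennreal (f y)) = P"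
    using Q.density_RN_deriv[OF ac sets] by simp
  have "AE y in density Q (\<lambda>y. ennreal (f y)). 0 < f y"
    by (subst AE_density) auto
  then have fpos: "AE y in P. 0 < f y" unfolding dens .
  have nn: "(\<integral>\<^sup>+y. ennreal (exp (\<phi> y) / f y) \<partial>P) \<le> ennreal c"
  proof -
    have "(\<integral>\<^sup>+y. ennreal (exp (\<phi> y) / f y) \<partial>P) = (\<integral>\<^sup>+y. ennreal (f y) * ennreal (exp (\<phi> y) / f y) \<partial>Q)"
      by (subst dens[symmetric], rule nn_integral_density) measurable
    \<comment> \<open>Only an inequality: where \<open>f\<close> vanishes the left integrand is 0
      while the right one is positive.\<close>
    also have "\<dots> \<le> (\<integral>\<^sup>+y. ennreal (exp (\<phi> y)) \<partial>Q)"
    proof (rule nn_integral_mono)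
      fix y
      have "f y \<ge> 0" by (simp add: f_def)
      then show "ennreal (f y) * ennreal (exp (\<phi> y) / f y) \<le> ennreal (exp (\<phi> y))"
        by (cases "f y = 0") (auto simp flip: ennreal_mult)
    qed
    finally show ?thesis using c by auto
  qed
  have nonneg: "0 \<le> exp (\<phi> y) / f y" for y by (simp add: f_def)
  have i1: "integrable P (\<lambda>y. exp (\<phi> y) / f y)"
    using nn nonneg by (intro integrableI_nonneg) (auto intro: le_less_trans)
  have "ennreal (\<integral>y. exp (\<phi> y) / f y \<partial>P) \<le> ennreal c"
    using nn nn_integral_eq_integral[OF i1] nonneg by simp
  then have i2: "(\<integral>y. exp (\<phi> y) / f y \<partial>P) \<le> c" using c by (simp add: ennreal_le_iff)
  \<comment> \<open>Pointwise this is \<open>z \<le> exp z - 1\<close> with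
    \<open>z = \<phi> y - ln (f y)\<close>.\<close>
  have "(\<integral>y. \<phi> y - ln (f y) \<partial>P) \<le> (\<integral>y. exp (\<phi> y) / f y - 1 \<partial>P)"
  proof (rule integral_mono_AE)
    show "integrable P (\<lambda>y. \<phi> y - ln (f y))" using \<phi> int by (auto simp: ed)
    show "integrable P (\<lambda>y. exp (\<phi> y) / f y - 1)" using i1 by auto
    show "AE y in P. \<phi> y - ln (f y) \<le> exp (\<phi> y) / f y - 1"
      using fpos
    proof eventually_elim
      case (elim y)
      have "exp (\<phi> y) / f y = exp (\<phi> y - ln (f y))" using elim by (simp add: exp_diff)
      then show ?case using exp_ge_add_one_self[of "\<phi> y - ln (f y)"] by linarith
    qed
  qed
  also have "\<dots> = (\<integral>y. exp (\<phi> y) / f y \<partial>P) - 1" using i1 P.prob_space by simp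
  finally have "(\<integral>y. \<phi> y \<partial>P) - (\<integral>y. ln (f y) \<partial>P) \<le> c - 1"
    using \<phi> int i2 by (simp add: ed)
  moreover have "relent P Q = ennreal (\<integral>y. ln (f y) \<partial>P)"
    using True by (simp add: relent_def KL_divergence_def ed)
  ultimately show ?thesis by (simp add: ennreal_leI)
next
  case False
  then have "relent P Q = \<infinity>" unfolding relent_def by (rule if_not_P)
  then show ?thesis by simp
qed

text \<open>\<open>RN_deriv\<close> agrees with \<open>f\<close> only almost everywhere, so the
  entropy density is \<open>ln f\<close> almost everywhere under the tilted law.\<close>

lemma relent_density_eq:
  fixes f :: "'a \<Rightarrow> real"
  assumes Q: "prob_space Q" and f[measurable]: "f \<in> borel_measurable Q" and pos: "\<And>y. f y > 0"
    and int: "integrable (density Q (\<lambda>y. ennreal (f y))) (\<lambda>y. ln (f y))"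
  shows "relent (density Q (\<lambda>y. ennreal (f y))) Q = ennreal (\<integral>y. ln (f y) \<partial>density Q (\<lambda>y. ennreal (f y)))"
proof -
  let ?P = "density Q (\<lambda>y. ennreal (f y))"
  interpret Q: prob_space Q by fact
  have ac: "absolutely_continuous Q ?P" by (rule absolutely_continuousI_density) measurable
  have "density Q (RN_deriv Q ?P) = ?P" by (rule density_RN_deriv_density) measurable
  then have "AE y in Q. RN_deriv Q ?P y = ennreal (f y)"
    by (intro Q.density_unique) auto
  then have "AE y in ?P. RN_deriv Q ?P y = ennreal (f y)"
    by (rule absolutely_continuous_AE[OF _ ac, rotated]) simp
  then have ed: "AE y in ?P. entropy_density (exp 1) Q ?P y = ln (f y)"
    by eventually_elim (use pos in \<open>auto simp: entropy_density_def log_def less_imp_le\<close>)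
  have [measurable]: "entropy_density (exp 1) Q ?P \<in> borel_measurable ?P"
    by (simp add: entropy_density_def comp_def)
  have "integrable ?P (entropy_density (exp 1) Q ?P)"
    using int by (subst integrable_cong_AE[OF _ _ ed]) auto
  moreover have "KL_divergence (exp 1) Q ?P = (\<integral>y. ln (f y) \<partial>?P)"
    unfolding KL_divergence_def by (intro integral_cong_AE ed) auto
  ultimately show ?thesis using ac by (simp add: relent_def)
qed

section \<open>Gaussian product laws and their exponential tilts\<close>

lemma sets_gauss1[simp, measurable_cong]: "sets (gauss1 v) = sets borel"
  by (auto simp: gauss1_def)

lemma space_gauss1[simp]: "space (gauss1 v) = UNIV"
  by (auto simp: gauss1_def)

lemma prob_space_gauss1: "prob_space (gauss1 v)"
  by (auto simp: gauss1_def intro!: prob_space_normal_density prob_space_return)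

lemma sets_gaussN[measurable_cong]: "sets (gaussN n v) = sets (Rn n)"
  unfolding gaussN_def Rn_def by (intro sets_PiM_cong) auto

lemma prob_space_gaussN: "prob_space (gaussN n v)"
  unfolding gaussN_def by (intro prob_space_PiM prob_space_gauss1)

lemma measurable_coord_Rn: "i \<in> {1..n} \<Longrightarrow> (\<lambda>x. x i) \<in> borel_measurable (Rn n)"
  using measurable_component_singleton[of i "{1..n}" "\<lambda>_. lborel"] by (simp add: Rn_def)

lemma measurable_fst_coord: "i \<in> {1..n} \<Longrightarrow> (\<lambda>z. fst z i) \<in> borel_measurable (Rn n \<Otimes>\<^sub>M M)"
  by (rule measurable_compose[OF measurable_fst measurable_coord_Rn])

lemma measurable_snd_coord: "i \<in> {1..n} \<Longrightarrow> (\<lambda>z. snd z i) \<in> borel_measurable (M \<Otimes>\<^sub>M Rn n)"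
  by (rule measurable_compose[OF measurable_snd measurable_coord_Rn])

lemma nn_integral_gaussN_prod:
  assumes "\<And>i. i \<in> {1..n} \<Longrightarrow> h i \<in> borel_measurable borel"
  shows "(\<integral>\<^sup>+y. (\<Prod>i=1..n. h i (y i)) \<partial>gaussN n v) = (\<Prod>i=1..n. \<integral>\<^sup>+y. h i y \<partial>gauss1 (v i))"
proof -
  interpret product_sigma_finite "\<lambda>i. gauss1 (v i)"
    unfolding product_sigma_finite_def
    by (auto intro: prob_space_imp_sigma_finite prob_space_gauss1)
  show ?thesis unfolding gaussN_def
    by (rule product_nn_integral_prod) (use assms in \<open>auto cong: measurable_cong_sets\<close>)
qed

text \<open>In a product tilt every factor but the i-th integrates to 1 and drops out.\<close>

lemma nn_integral_gaussN_coord: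
  assumes i: "i \<in> {1..n}" and h: "h \<in> borel_measurable borel"
    and g: "\<And>j. j \<in> {1..n} \<Longrightarrow> g j \<in> borel_measurable borel" "\<And>j. j \<in> {1..n} \<Longrightarrow> (\<integral>\<^sup>+y. g j y \<partial>gauss1 (v j)) = 1"
  shows "(\<integral>\<^sup>+y. (\<Prod>j=1..n. g j (y j)) * h (y i) \<partial>gaussN n v) = (\<integral>\<^sup>+y. g i y * h y \<partial>gauss1 (v i))"
proof -
  define h' where "h' j y = (if j = i then g j y * h y else g j y)" for j y
  have "(\<Prod>j=1..n. g j (y j)) * h (y i) = (\<Prod>j=1..n. h' j (y j))" for y
  proof -
    have "(\<Prod>j=1..n. h' j (y j)) = h' i (y i) * (\<Prod>j\<in>{1..n} - {i}. h' j (y j))"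
      using i by (intro prod.remove) auto
    also have "(\<Prod>j\<in>{1..n} - {i}. h' j (y j)) = (\<Prod>j\<in>{1..n} - {i}. g j (y j))"
      by (intro prod.cong) (auto simp: h'_def)
    also have "h' i (y i) * \<dots> = h (y i) * (g i (y i) * (\<Prod>j\<in>{1..n} - {i}. g j (y j)))"
      by (simp add: h'_def mult_ac)
    also have "g i (y i) * (\<Prod>j\<in>{1..n} - {i}. g j (y j)) = (\<Prod>j=1..n. g j (y j))"
      using i by (intro prod.remove[symmetric]) auto
    finally show ?thesis by (simp add: mult.commute)
  qed
  then have "(\<integral>\<^sup>+y. (\<Prod>j=1..n. g j (y j)) * h (y i) \<partial>gaussN n v) = (\<Prod>j=1..n. \<integral>\<^sup>+y. h' j y \<partial>gauss1 (v j))"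
  proof -
    have "h' j \<in> borel_measurable borel" if "j \<in> {1..n}" for j
      using g(1)[OF that] h by (cases "j = i") (auto simp: h'_def[abs_def])
    from nn_integral_gaussN_prod[of n h', OF this] show ?thesis
      by (simp only: \<open>\<And>y. (\<Prod>j=1..n. g j (y j)) * h (y i) = (\<Prod>j=1..n. h' j (y j))\<close>)
  qed
  also have "\<dots> = (\<Prod>j=1..n. if j = i then (\<integral>\<^sup>+y. g i y * h y \<partial>gauss1 (v i)) else 1)"
    using g by (intro prod.cong) (auto simp: h'_def)
  also have "\<dots> = (\<integral>\<^sup>+y. g i y * h y \<partial>gauss1 (v i))" using i by simp
  finally show ?thesis .
qed

lemma nn_integral_gaussN_marginal:
  assumes "i \<in> {1..n}" "h \<in> borel_measurable borel"
  shows "(\<integral>\<^sup>+x. h (x i) \<partial>gaussN n v) = (\<integral>\<^sup>+x. h x \<partial>gauss1 (v i))"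
  using nn_integral_gaussN_coord[OF assms, of "\<lambda>_ _. 1" v]
  by (simp add: prob_space.emeasure_space_1[OF prob_space_gauss1] flip: space_gauss1)

lemma nn_integral_normal_square:
  assumes "\<sigma> > 0"
  shows "(\<integral>\<^sup>+y. ennreal (normal_density m \<sigma> y) * ennreal ((y - c)\<^sup>2) \<partial>lborel) = ennreal ((m - c)\<^sup>2 + \<sigma>\<^sup>2)"
proof -
  note b = normal_moment_even[OF assms, of m 1] normal_moment_odd[OF assms, of m 0] normal_moment_even[OF assms, of m 0]
  have 1: "has_bochner_integral lborel (\<lambda>y. normal_density m \<sigma> y * (y - m)\<^sup>2) (\<sigma>\<^sup>2)"
    using b(1) by (simp add: power2_eq_square)
  have 2: "has_bochner_integral lborel (\<lambda>y. normal_density m \<sigma> y * (y - m)) 0"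
    using b(2) by simp
  have 3: "has_bochner_integral lborel (\<lambda>y. normal_density m \<sigma> y) 1"
    using b(3) by simp
  have "has_bochner_integral lborel (\<lambda>y. normal_density m \<sigma> y * (y - m)\<^sup>2
     + normal_density m \<sigma> y * (y - m) * (2 * (m - c)) + normal_density m \<sigma> y * (m - c)\<^sup>2)
     (\<sigma>\<^sup>2 + 0 * (2 * (m - c)) + 1 * (m - c)\<^sup>2)"
    by (intro has_bochner_integral_add has_bochner_integral_mult_left 1 2 3)
  then have "has_bochner_integral lborel (\<lambda>y. normal_density m \<sigma> y * (y - c)\<^sup>2) ((m - c)\<^sup>2 + \<sigma>\<^sup>2)"
    by (simp add: power2_eq_square algebra_simps)
  then show ?thesis
    by (subst ennreal_mult[symmetric]) (auto simp: has_bochner_integral_iff nn_integral_eq_integral)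
qed

text \<open>Density of the channel output, given input \<open>x\<close>, with respect to
  \<open>gauss1 v\<close>: the tilt \<open>exp (- k / 2 * (x - y)^2)\<close> divided by its
  integral, whose negative logarithm is the bracketed summand.\<close>

definition gtilt :: "real \<Rightarrow> real \<Rightarrow> real \<Rightarrow> real \<Rightarrow> real" where
  "gtilt k v x y = exp (- k / 2 * (x - y)\<^sup>2 + (ln (1 + k * v) / 2 + k * x\<^sup>2 / (2 * (1 + k * v))))"

lemma gtilt_pos: "gtilt k v x y > 0" by (simp add: gtilt_def)

text \<open>Bayes' rule for a \<open>N(0, v)\<close> prior and an observation \<open>x\<close> of
  precision \<open>k\<close>: the precisions \<open>1 / v\<close> and \<open>k\<close> add up.
  Completing the square proves it.\<close>

lemma gtilt_normal:
  assumes k: "k > 0" and v: "v > 0"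
  shows "normal_density 0 (sqrt v) y * gtilt k v x y = normal_density (k * v * x / (1 + k * v)) (sqrt (v / (1 + k * v))) y"
proof -
  define p where "p = 1 + k * v"
  have p: "p > 0" using k v by (simp add: p_def add_pos_pos)
  have sq: "exp (ln p / 2) = sqrt p" using p by (simp add: ln_sqrt[symmetric])
  have k': "k = (p - 1) / v" using v by (simp add: p_def)
  have e: "- (y\<^sup>2 / (2 * v)) + (- k / 2 * (x - y)\<^sup>2 + k * x\<^sup>2 / (2 * p)) = - ((y - k * v * x / p)\<^sup>2 / (2 * (v / p)))"
    using v p unfolding k' by (simp add: field_simps power2_eq_square)
  have "gtilt k v x y = exp (ln p / 2 + (- k / 2 * (x - y)\<^sup>2 + k * x\<^sup>2 / (2 * p)))"
    by (simp add: gtilt_def p_def[symmetric] algebra_simps)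
  then have g: "gtilt k v x y = sqrt p * exp (- k / 2 * (x - y)\<^sup>2 + k * x\<^sup>2 / (2 * p))"
    unfolding exp_add[of "ln p / 2"] sq .
  have "normal_density 0 (sqrt v) y * gtilt k v x y
      = 1 / sqrt (2 * pi * v) * sqrt p * exp (- (y\<^sup>2 / (2 * v)) + (- k / 2 * (x - y)\<^sup>2 + k * x\<^sup>2 / (2 * p)))"
    unfolding g exp_add[of "- (y\<^sup>2 / (2 * v))"] using v by (simp add: normal_density_def)
  also have "1 / sqrt (2 * pi * v) * sqrt p = 1 / sqrt (2 * pi * (v / p))"
    using v p by (simp add: real_sqrt_divide real_sqrt_mult)
  finally show ?thesis unfolding e using v p by (simp add: normal_density_def p_def[symmetric])
qed

lemma nn_integral_gtilt:
  assumes k: "k > 0" and v: "v \<ge> 0"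
  shows "(\<integral>\<^sup>+y. ennreal (gtilt k v x y) \<partial>gauss1 v) = 1"
    and "(\<integral>\<^sup>+y. ennreal (gtilt k v x y) * ennreal ((y - c)\<^sup>2) \<partial>gauss1 v)
      = ennreal ((k * v * x / (1 + k * v) - c)\<^sup>2 + v / (1 + k * v))"
proof -
  have p: "1 + k * v > 0" using k v by (simp add: add_pos_nonneg)
  have [measurable]: "(\<lambda>y. gtilt k v x y) \<in> borel_measurable borel" for k v unfolding gtilt_def by measurable
  have "(\<integral>\<^sup>+y. ennreal (gtilt k v x y) \<partial>gauss1 v) = 1 \<and> (\<integral>\<^sup>+y. ennreal (gtilt k v x y) * ennreal ((y - c)\<^sup>2) \<partial>gauss1 v)
      = ennreal ((k * v * x / (1 + k * v) - c)\<^sup>2 + v / (1 + k * v))"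
  proof (cases "v = 0")
    \<comment> \<open>An inactive coordinate: \<open>gauss1 0\<close> is the point mass at 0, where
      the tilt equals 1.\<close>
    case True
    have "gtilt k 0 x 0 = 1" by (simp add: gtilt_def)
    then show ?thesis by (simp add: True gauss1_def nn_integral_return)
  next
    case False
    then have v: "v > 0" using v by simp
    then have s: "sqrt (v / (1 + k * v)) > 0" using p by simp
    have e: "ennreal (normal_density 0 (sqrt v) y) * ennreal (gtilt k v x y)
        = ennreal (normal_density (k * v * x / (1 + k * v)) (sqrt (v / (1 + k * v))) y)" for y
      by (subst ennreal_mult[symmetric]) (auto simp: gtilt_normal[OF k v] less_imp_le[OF gtilt_pos])
    have "(\<integral>\<^sup>+y. ennreal (gtilt k v x y) \<partial>gauss1 v) = (\<integral>\<^sup>+y. ennreal (normal_density (k * v * x / (1 + k * v)) (sqrt (v / (1 + k * v))) y) \<partial>lborel)"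
      using v by (simp add: gauss1_def nn_integral_density e)
    also have "\<dots> = 1"
      using prob_space.emeasure_space_1[OF prob_space_normal_density[OF s]] by (simp add: emeasure_density)
    finally have 1: "(\<integral>\<^sup>+y. ennreal (gtilt k v x y) \<partial>gauss1 v) = 1" .
    have "(\<integral>\<^sup>+y. ennreal (gtilt k v x y) * ennreal ((y - c)\<^sup>2) \<partial>gauss1 v)
        = (\<integral>\<^sup>+y. ennreal (normal_density (k * v * x / (1 + k * v)) (sqrt (v / (1 + k * v))) y) * ennreal ((y - c)\<^sup>2) \<partial>lborel)"
      using v by (simp add: gauss1_def nn_integral_density e flip: mult.assoc)
    also have "\<dots> = ennreal ((k * v * x / (1 + k * v) - c)\<^sup>2 + v / (1 + k * v))"
      using v p by (simp add: nn_integral_normal_square[OF s])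
    finally show ?thesis using 1 by blast
  qed
  then show "(\<integral>\<^sup>+y. ennreal (gtilt k v x y) \<partial>gauss1 v) = 1"
    "(\<integral>\<^sup>+y. ennreal (gtilt k v x y) * ennreal ((y - c)\<^sup>2) \<partial>gauss1 v)
      = ennreal ((k * v * x / (1 + k * v) - c)\<^sup>2 + v / (1 + k * v))" by auto
qed

lemma nn_integral_gauss1_square:
  assumes "v > 0"
  shows "(\<integral>\<^sup>+x. ennreal (x\<^sup>2) \<partial>gauss1 v) = ennreal v"
  using nn_integral_normal_square[of "sqrt v" 0 0] assms by (simp add: gauss1_def nn_integral_density)

lemma ennreal_integral_le_nn_integral:
  assumes "integrable M h"
  shows "ennreal (\<integral>x. h x \<partial>M) \<le> (\<integral>\<^sup>+x. ennreal (h x) \<partial>M)"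
proof -
  have i: "integrable M (\<lambda>x. max 0 (h x))" using assms by auto
  have "(\<integral>x. h x \<partial>M) \<le> (\<integral>x. max 0 (h x) \<partial>M)" using assms i by (intro integral_mono) auto
  then have "ennreal (\<integral>x. h x \<partial>M) \<le> ennreal (\<integral>x. max 0 (h x) \<partial>M)" by (rule ennreal_leI)
  also have "\<dots> = (\<integral>\<^sup>+x. ennreal (max 0 (h x)) \<partial>M)" using i by (intro nn_integral_eq_integral[symmetric]) auto
  also have "\<dots> = (\<integral>\<^sup>+x. ennreal (h x) \<partial>M)" by (intro nn_integral_cong) (auto simp: max_def ennreal_neg)
  finally show ?thesis .
qed

text \<open>The function \<open>(exp t - 1) * q - t * p\<close> has a minimum at 0, so its
  derivative \<open>q - p\<close> vanishes there. With \<open>p\<close> and \<open>q\<close> the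
  probabilities of one event under two channels, a family of bounds becomes an equality.\<close>

lemma sandwich_exp_derivative:
  fixes p q :: real
  assumes "\<And>t. t * p \<le> (exp t - 1) * q"
  shows "p = q"
proof -
  define f where "f t = (exp t - 1) * q - t * p" for t
  have "(f has_real_derivative q - p) (at 0)"
    unfolding f_def by (auto intro!: derivative_eq_intros)
  moreover have "f 0 \<le> f t" for t using assms[of t] by (simp add: f_def)
  ultimately have "q - p = 0" by (intro DERIV_local_min[of f _ 0 1]) auto
  then show ?thesis by simp
qed

section \<open>Joint laws of a source and a test channel\<close>

locale test_channel =
  fixes n :: nat and PA :: "(nat \<Rightarrow> real) measure" and K :: "(nat \<Rightarrow> real) \<Rightarrow> (nat \<Rightarrow> real) measure"
  assumes PA: "prob_space PA" and sets_PA[measurable_cong]: "sets PA = sets (Rn n)"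
    and K[measurable]: "K \<in> PA \<rightarrow>\<^sub>M prob_algebra (Rn n)"
begin

lemma K_sub[measurable]: "K \<in> PA \<rightarrow>\<^sub>M subprob_algebra (Rn n)"
  using K by (rule measurable_prob_algebraD)

lemma space_PA: "space PA = space (Rn n)"
  using sets_PA by (rule sets_eq_imp_space_eq)

lemma space_PA_nonempty: "space PA \<noteq> {}"
  using PA prob_space.not_empty by blast

lemma prob_space_K: "x \<in> space PA \<Longrightarrow> prob_space (K x)"
  using measurable_space[OF K] by (simp add: space_prob_algebra)

lemma sets_K: "x \<in> space PA \<Longrightarrow> sets (K x) = sets (Rn n)"
  using measurable_space[OF K] by (simp add: space_prob_algebra)

lemma kernel_pair: "(\<lambda>x. distr (K x) (PA \<Otimes>\<^sub>M Rn n) (\<lambda>y. (x, y))) \<in> PA \<rightarrow>\<^sub>M subprob_algebra (PA \<Otimes>\<^sub>M Rn n)"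
  by (rule measurable_distr2[OF _ K_sub]) measurable

lemma sets_joint: "sets (joint n PA K) = sets (PA \<Otimes>\<^sub>M Rn n)"
  unfolding joint_def by (rule sets_bind[OF _ space_PA_nonempty]) simp

lemma nn_integral_joint:
  assumes [measurable]: "f \<in> borel_measurable (PA \<Otimes>\<^sub>M Rn n)"
  shows "(\<integral>\<^sup>+z. f z \<partial>joint n PA K) = (\<integral>\<^sup>+x. \<integral>\<^sup>+y. f (x, y) \<partial>K x \<partial>PA)"
  unfolding joint_def nn_integral_bind[OF assms kernel_pair]
proof (rule nn_integral_cong)
  fix x assume x: "x \<in> space PA"
  have [measurable]: "(\<lambda>y. (x, y)) \<in> K x \<rightarrow>\<^sub>M PA \<Otimes>\<^sub>M Rn n"
    using measurable_Pair1'[OF x, of "Rn n"] measurable_cong_sets[OF sets_K[OF x] refl] by blast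
  show "(\<integral>\<^sup>+z. f z \<partial>distr (K x) (PA \<Otimes>\<^sub>M Rn n) (Pair x)) = (\<integral>\<^sup>+y. f (x, y) \<partial>K x)"
    by (rule nn_integral_distr) measurable
qed

text \<open>Section probabilities as reals, so that they can enter Bochner integrals with
  coefficients of either sign.\<close>

definition sec :: "((nat \<Rightarrow> real) \<times> (nat \<Rightarrow> real)) set \<Rightarrow> (nat \<Rightarrow> real) \<Rightarrow> real" where
  "sec S x = measure (K x) {y \<in> space (Rn n). (x, y) \<in> S}"

lemma sec_measurable:
  assumes S: "S \<in> sets (PA \<Otimes>\<^sub>M Rn n)"
  shows "sec S \<in> borel_measurable PA"
proof -
  have "Sigma (space PA) (\<lambda>x. {y \<in> space (Rn n). (x, y) \<in> S}) = S"
    using sets.sets_into_space[OF S] unfolding space_pair_measure by blast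
  with S have "Sigma (space PA) (\<lambda>x. {y \<in> space (Rn n). (x, y) \<in> S}) \<in> sets (PA \<Otimes>\<^sub>M Rn n)" by simp
  then show ?thesis unfolding sec_def by (rule measure_measurable_prob_algebra2[OF _ K])
qed

lemma section_sets:
  assumes S: "S \<in> sets (PA \<Otimes>\<^sub>M Rn n)" and x: "x \<in> space PA"
  shows "{y \<in> space (Rn n). (x, y) \<in> S} \<in> sets (Rn n)"
proof -
  have "{y \<in> space (Rn n). (x, y) \<in> S} = Pair x -` S \<inter> space (Rn n)" by auto
  then show ?thesis using measurable_sets[OF measurable_Pair1'[OF x] S] by (simp only:)
qed

lemma sec_bounds:
  assumes "x \<in> space PA"
  shows "0 \<le> sec S x" "sec S x \<le> 1"
  using prob_space.prob_le_1[OF prob_space_K[OF assms]] by (auto simp: sec_def)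

lemma integrable_sec:
  assumes S: "S \<in> sets (PA \<Otimes>\<^sub>M Rn n)"
  shows "integrable PA (sec S)"
proof -
  interpret prob_space PA by (rule PA)
  show ?thesis using sec_measurable[OF S] sec_bounds
    by (intro integrable_const_bound[of _ 1]) (auto intro!: AE_I2)
qed

lemma emeasure_joint:
  assumes S[measurable]: "S \<in> sets (PA \<Otimes>\<^sub>M Rn n)"
  shows "emeasure (joint n PA K) S = ennreal (\<integral>x. sec S x \<partial>PA)"
proof -
  have "emeasure (joint n PA K) S = (\<integral>\<^sup>+z. indicator S z \<partial>joint n PA K)"
    using S sets_joint by simp
  also have "\<dots> = (\<integral>\<^sup>+x. \<integral>\<^sup>+y. indicator S (x, y) \<partial>K x \<partial>PA)"
    by (rule nn_integral_joint) measurable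
  also have "\<dots> = (\<integral>\<^sup>+x. ennreal (sec S x) \<partial>PA)"
  proof (rule nn_integral_cong)
    fix x assume x: "x \<in> space PA"
    interpret Kx: prob_space "K x" by (rule prob_space_K[OF x])
    have "(\<integral>\<^sup>+y. indicator S (x, y) \<partial>K x) = (\<integral>\<^sup>+y. indicator {y \<in> space (Rn n). (x, y) \<in> S} y \<partial>K x)"
      by (intro nn_integral_cong) (auto simp: indicator_def sets_eq_imp_space_eq[OF sets_K[OF x]])
    also have "\<dots> = emeasure (K x) {y \<in> space (Rn n). (x, y) \<in> S}"
      using section_sets[OF S x] sets_K[OF x] by simp
    finally show "(\<integral>\<^sup>+y. indicator S (x, y) \<partial>K x) = ennreal (sec S x)"
      by (simp add: sec_def Kx.emeasure_eq_measure)
  qed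
  also have "\<dots> = ennreal (\<integral>x. sec S x \<partial>PA)"
    using integrable_sec[OF S] sec_bounds by (intro nn_integral_eq_integral) (auto intro!: AE_I2)
  finally show ?thesis .
qed

lemma measure_joint:
  assumes S: "S \<in> sets (PA \<Otimes>\<^sub>M Rn n)"
  shows "measure (joint n PA K) S = (\<integral>x. sec S x \<partial>PA)"
  unfolding measure_def emeasure_joint[OF S]
  using sec_bounds by (intro enn2real_ennreal integral_nonneg_AE AE_I2) auto

end

section \<open>Optimality and uniqueness of the Gaussian channel\<close>

locale gaussian_tilt =
  fixes n :: nat and k d :: real and sA v :: "nat \<Rightarrow> real"
  assumes n: "n \<ge> 1" and k: "k > 0" and sA: "\<And>i. i \<in> {1..n} \<Longrightarrow> sA i > 0" and v: "\<And>i. i \<in> {1..n} \<Longrightarrow> v i \<ge> 0"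
    and balance: "(1 / real n) * (\<Sum>i=1..n. sA i / (1 + k * v i)\<^sup>2 + v i / (1 + k * v i)) = d"
begin

definition "PA = gaussN n sA"
definition "Q = gaussN n v"

definition gg :: "(nat \<Rightarrow> real) \<Rightarrow> (nat \<Rightarrow> real) \<Rightarrow> real" where
  "gg x y = (\<Prod>i=1..n. gtilt k (v i) (x i) (y i))"

text \<open>Minus the logarithm of the partition function of
  \<open>exp (- k / 2 * |x - y|^2)\<close> under \<open>Q\<close>.\<close>

definition ell :: "(nat \<Rightarrow> real) \<Rightarrow> real" where
  "ell x = (\<Sum>i=1..n. ln (1 + k * v i) / 2 + k * (x i)\<^sup>2 / (2 * (1 + k * v i)))"

definition Kst :: "(nat \<Rightarrow> real) \<Rightarrow> (nat \<Rightarrow> real) measure" where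
  "Kst x = density Q (\<lambda>y. ennreal (gg x y))"

lemma p_pos: "i \<in> {1..n} \<Longrightarrow> 1 + k * v i > 0"
  using k v[of i] by (simp add: add_pos_nonneg)

lemma prob_PA: "prob_space PA" and prob_Q: "prob_space Q"
  unfolding PA_def Q_def by (rule prob_space_gaussN)+

lemma sets_PA[measurable_cong]: "sets PA = sets (Rn n)"
  unfolding PA_def by (rule sets_gaussN)

lemma sets_Q[measurable_cong]: "sets Q = sets (Rn n)"
  unfolding Q_def by (rule sets_gaussN)

lemma sets_Kst[measurable_cong]: "sets (Kst x) = sets (Rn n)"
  unfolding Kst_def by (simp add: sets_Q)

lemma gg_pos: "gg x y > 0"
  unfolding gg_def by (intro prod_pos) (auto simp: gtilt_pos)

text \<open>The output enters only through the distortion. This is why the distortion constraint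
  controls the expected log-ratio under an arbitrary channel.\<close>

lemma ln_gg: "ln (gg x y) = - k / 2 * real n * distortion n x y + ell x"
proof -
  have "ln (gg x y) = (\<Sum>i=1..n. ln (gtilt k (v i) (x i) (y i)))"
    unfolding gg_def by (intro ln_prod) (auto simp: gtilt_def)
  also have "\<dots> = (\<Sum>i=1..n. - k / 2 * (x i - y i)\<^sup>2) + ell x"
    by (simp only: gtilt_def ln_exp ell_def sum.distrib)
  also have "(\<Sum>i=1..n. - k / 2 * (x i - y i)\<^sup>2) = - k / 2 * real n * distortion n x y"
    using n by (simp add: distortion_def sum_distrib_left)
  finally show ?thesis .
qed

lemma measurable_gg[measurable]: "(\<lambda>z. gg (fst z) (snd z)) \<in> borel_measurable (Rn n \<Otimes>\<^sub>M Rn n)"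
  unfolding gg_def
proof (intro borel_measurable_prod)
  fix i assume i: "i \<in> {1..n}"
  note [measurable] = measurable_fst_coord[OF i] measurable_snd_coord[OF i]
  show "(\<lambda>z. gtilt k (v i) (fst z i) (snd z i)) \<in> borel_measurable (Rn n \<Otimes>\<^sub>M Rn n)"
    unfolding gtilt_def by measurable
qed

lemma measurable_distortion[measurable]: "(\<lambda>z. distortion n (fst z) (snd z)) \<in> borel_measurable (Rn n \<Otimes>\<^sub>M Rn n)"
  unfolding distortion_def
proof (intro borel_measurable_times borel_measurable_const borel_measurable_sum)
  fix i assume i: "i \<in> {1..n}"
  note [measurable] = measurable_fst_coord[OF i] measurable_snd_coord[OF i]
  show "(\<lambda>z. (fst z i - snd z i)\<^sup>2) \<in> borel_measurable (Rn n \<Otimes>\<^sub>M Rn n)" by measurable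
qed

lemma measurable_gg': "x \<in> space (Rn n) \<Longrightarrow> (\<lambda>y. gg x y) \<in> borel_measurable (Rn n)"
  using measurable_compose[OF measurable_Pair1' measurable_gg] by simp

lemma measurable_distortion': "x \<in> space (Rn n) \<Longrightarrow> (\<lambda>y. distortion n x y) \<in> borel_measurable (Rn n)"
  using measurable_compose[OF measurable_Pair1' measurable_distortion] by simp

lemma space_PA: "space PA = space (Rn n)" by (rule sets_eq_imp_space_eq[OF sets_PA])

lemma nn_integral_Kst:
  assumes x: "x \<in> space (Rn n)" and [measurable]: "f \<in> borel_measurable (Rn n)"
  shows "(\<integral>\<^sup>+y. f y \<partial>Kst x) = (\<integral>\<^sup>+y. ennreal (gg x y) * f y \<partial>Q)"
  unfolding Kst_def
proof (rule nn_integral_density)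
  show "(\<lambda>y. ennreal (gg x y)) \<in> borel_measurable Q" "f \<in> borel_measurable Q"
    using measurable_gg'[OF x] assms(2) by (auto simp: measurable_cong_sets[OF sets_Q refl])
qed

lemma ennreal_gg: "ennreal (gg x y) = (\<Prod>i=1..n. ennreal (gtilt k (v i) (x i) (y i)))"
  unfolding gg_def by (rule prod_ennreal[symmetric]) (simp add: less_imp_le gtilt_pos)

lemma measurable_gtilt_ennreal: "(\<lambda>y. ennreal (gtilt k w x y)) \<in> borel_measurable borel"
  unfolding gtilt_def by measurable

lemma prob_Kst:
  assumes x: "x \<in> space (Rn n)" shows "prob_space (Kst x)"
proof
  have "emeasure (Kst x) (space (Kst x)) = (\<integral>\<^sup>+y. ennreal (gg x y) \<partial>Q)"
    using nn_integral_Kst[OF x, of "\<lambda>_. 1"] by simp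
  also have "\<dots> = (\<Prod>i=1..n. \<integral>\<^sup>+y. ennreal (gtilt k (v i) (x i) y) \<partial>gauss1 (v i))"
    unfolding ennreal_gg Q_def by (rule nn_integral_gaussN_prod) (rule measurable_gtilt_ennreal)
  also have "\<dots> = 1" using nn_integral_gtilt(1)[OF k v] by simp
  finally show "emeasure (Kst x) (space (Kst x)) = 1" .
qed

lemma Kst_measurable[measurable]: "Kst \<in> PA \<rightarrow>\<^sub>M prob_algebra (Rn n)"
proof (intro measurable_prob_algebraI measurable_subprob_algebra)
  fix x assume "x \<in> space PA"
  then show "prob_space (Kst x)" "subprob_space (Kst x)" "sets (Kst x) = sets (Rn n)"
    using prob_Kst[of x] sets_Kst by (auto simp: space_PA intro: prob_space_imp_subprob_space)
next
  fix A assume A[measurable]: "A \<in> sets (Rn n)"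
  interpret Q: prob_space Q by (rule prob_Q)
  have [measurable]: "(\<lambda>z. gg (fst z) (snd z)) \<in> borel_measurable (PA \<Otimes>\<^sub>M Q)"
    using measurable_gg by (simp add: measurable_cong_sets[OF sets_pair_measure_cong[OF sets_PA sets_Q] refl])
  have "(\<lambda>x. \<integral>\<^sup>+y. ennreal (gg x y) * indicator A y \<partial>Q) \<in> borel_measurable PA"
    by (rule Q.borel_measurable_nn_integral) (simp add: case_prod_beta')
  moreover have "emeasure (Kst x) A = (\<integral>\<^sup>+y. ennreal (gg x y) * indicator A y \<partial>Q)" if "x \<in> space PA" for x
    using that A measurable_gg'[of x] unfolding Kst_def space_PA
    by (intro emeasure_density) (auto simp: sets_Q measurable_cong_sets[OF sets_Q refl])
  ultimately show "(\<lambda>x. emeasure (Kst x) A) \<in> borel_measurable PA"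
    by (subst measurable_cong) auto
qed

sublocale star: test_channel n PA Kst
  by (rule test_channel.intro[OF prob_PA sets_PA Kst_measurable])

lemma nn_integral_Kst_coord:
  assumes x: "x \<in> space (Rn n)" and i: "i \<in> {1..n}"
  shows "(\<integral>\<^sup>+y. ennreal ((y i - c)\<^sup>2) \<partial>Kst x)
     = ennreal ((k * v i * x i / (1 + k * v i) - c)\<^sup>2 + v i / (1 + k * v i))"
proof -
  have "(\<integral>\<^sup>+y. ennreal ((y i - c)\<^sup>2) \<partial>Kst x) = (\<integral>\<^sup>+y. ennreal (gg x y) * ennreal ((y i - c)\<^sup>2) \<partial>Q)"
  proof (rule nn_integral_Kst[OF x])
    note [measurable] = measurable_coord_Rn[OF i]
    show "(\<lambda>y. ennreal ((y i - c)\<^sup>2)) \<in> borel_measurable (Rn n)" by measurable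
  qed
  also have "\<dots> = (\<integral>\<^sup>+y. ennreal (gtilt k (v i) (x i) y) * ennreal ((y - c)\<^sup>2) \<partial>gauss1 (v i))"
    unfolding ennreal_gg Q_def using nn_integral_gtilt(1)[OF k v] measurable_gtilt_ennreal
    by (intro nn_integral_gaussN_coord[OF i, where h = "\<lambda>y. ennreal ((y - c)\<^sup>2)"]) auto
  also have "\<dots> = ennreal ((k * v i * x i / (1 + k * v i) - c)\<^sup>2 + v i / (1 + k * v i))"
    by (rule nn_integral_gtilt(2)[OF k v[OF i]])
  finally show ?thesis .
qed

definition estar :: "(nat \<Rightarrow> real) \<Rightarrow> real" where
  "estar x = (1 / real n) * (\<Sum>i=1..n. (x i)\<^sup>2 / (1 + k * v i)\<^sup>2 + v i / (1 + k * v i))"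

lemma nn_integral_Kst_distortion:
  assumes x: "x \<in> space (Rn n)"
  shows "(\<integral>\<^sup>+y. ennreal (distortion n x y) \<partial>Kst x) = ennreal (estar x)"
proof -
  have "(\<integral>\<^sup>+y. ennreal (distortion n x y) \<partial>Kst x)
      = (\<integral>\<^sup>+y. ennreal (1 / real n) * (\<Sum>i=1..n. ennreal ((y i - x i)\<^sup>2)) \<partial>Kst x)"
    unfolding distortion_def
    by (intro nn_integral_cong, subst ennreal_mult) (auto simp: sum_nonneg power2_commute)
  also have "\<dots> = ennreal (1 / real n) * (\<Sum>i=1..n. \<integral>\<^sup>+y. ennreal ((y i - x i)\<^sup>2) \<partial>Kst x)"
  proof -
    have m: "(\<lambda>y. ennreal ((y i - x i)\<^sup>2)) \<in> borel_measurable (Kst x)" if "i \<in> {1..n}" for i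
    proof -
      note [measurable] = measurable_coord_Rn[OF that]
      show ?thesis unfolding measurable_cong_sets[OF sets_Kst refl] by measurable
    qed
    show ?thesis
      by (subst nn_integral_cmult[OF borel_measurable_sum[OF m]], assumption, subst nn_integral_sum[OF m], assumption, rule refl)
  qed
  also have "(\<Sum>i=1..n. \<integral>\<^sup>+y. ennreal ((y i - x i)\<^sup>2) \<partial>Kst x)
      = (\<Sum>i=1..n. ennreal ((x i)\<^sup>2 / (1 + k * v i)\<^sup>2 + v i / (1 + k * v i)))"
  proof (intro sum.cong refl)
    fix i assume i: "i \<in> {1..n}"
    have "k * v i * x i / (1 + k * v i) - x i = - (x i / (1 + k * v i))"
      using p_pos[OF i] by (simp add: field_simps)
    then show "(\<integral>\<^sup>+y. ennreal ((y i - x i)\<^sup>2) \<partial>Kst x) = ennreal ((x i)\<^sup>2 / (1 + k * v i)\<^sup>2 + v i / (1 + k * v i))"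
      unfolding nn_integral_Kst_coord[OF x i] by (simp add: power_divide)
  qed
  also have "ennreal (1 / real n) * \<dots> = ennreal (estar x)"
  proof -
    have "0 \<le> (x i)\<^sup>2 / (1 + k * v i)\<^sup>2 + v i / (1 + k * v i)" if "i \<in> {1..n}" for i
      using v[OF that] p_pos[OF that] k by (intro add_nonneg_nonneg divide_nonneg_nonneg) auto
    from sum_ennreal[of "{1..n}", OF this] sum_nonneg[of "{1..n}", OF this] show ?thesis
      unfolding estar_def by (simp only:) (rule ennreal_mult[symmetric], simp)
  qed
  finally show ?thesis .
qed

lemma integral_PA_square:
  assumes i: "i \<in> {1..n}"
  shows "has_bochner_integral PA (\<lambda>x. (x i)\<^sup>2) (sA i)"
proof (rule has_bochner_integral_nn_integral)
  note [measurable] = measurable_coord_Rn[OF i]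
  show "(\<lambda>x. (x i)\<^sup>2) \<in> borel_measurable PA" unfolding measurable_cong_sets[OF sets_PA refl] by measurable
  show "(\<integral>\<^sup>+x. ennreal ((x i)\<^sup>2) \<partial>PA) = ennreal (sA i)"
    unfolding PA_def using nn_integral_gaussN_marginal[OF i, of "\<lambda>x. ennreal (x\<^sup>2)" sA]
    by (simp add: nn_integral_gauss1_square[OF sA[OF i]])
qed (use sA[OF i] in auto)

lemma integral_estar: "has_bochner_integral PA estar d"
proof -
  interpret PA: prob_space PA by (rule prob_PA)
  have "has_bochner_integral PA (\<lambda>x. (1 / real n) * (\<Sum>i=1..n. (x i)\<^sup>2 / (1 + k * v i)\<^sup>2 + v i / (1 + k * v i)))
     ((1 / real n) * (\<Sum>i=1..n. sA i / (1 + k * v i)\<^sup>2 + v i / (1 + k * v i)))"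
    by (intro has_bochner_integral_mult_right has_bochner_integral_sum has_bochner_integral_add
        has_bochner_integral_divide_zero integral_PA_square)
      (auto simp: has_bochner_integral_iff PA.prob_space)
  then show ?thesis unfolding balance estar_def[abs_def] .
qed

lemma integrable_ell: "integrable PA ell"
proof -
  interpret PA: prob_space PA by (rule prob_PA)
  have "integrable PA (\<lambda>x. (x i)\<^sup>2)" if "i \<in> {1..n}" for i
    using integral_PA_square[OF that] by (simp add: has_bochner_integral_iff)
  then show ?thesis unfolding ell_def[abs_def] by auto
qed

text \<open>The Lagrangian dual value, that is, the infimum before division by n.\<close>

definition "rate = - k / 2 * real n * d + (\<integral>x. ell x \<partial>PA)"

lemma estar_nonneg: "0 \<le> estar x"
proof -
  have "0 \<le> (x i)\<^sup>2 / (1 + k * v i)\<^sup>2 + v i / (1 + k * v i)" if "i \<in> {1..n}" for i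
    using v[OF that] p_pos[OF that] k by (intro add_nonneg_nonneg divide_nonneg_nonneg) auto
  then show ?thesis unfolding estar_def by (intro mult_nonneg_nonneg sum_nonneg) auto
qed

lemma d_nonneg: "0 \<le> d"
proof -
  have "0 \<le> (\<integral>x. estar x \<partial>PA)" by (intro integral_nonneg_AE AE_I2 estar_nonneg)
  then show ?thesis using integral_estar by (simp add: has_bochner_integral_iff)
qed

lemma distortion_nonneg: "0 \<le> distortion n x y"
  unfolding distortion_def by (intro mult_nonneg_nonneg sum_nonneg) auto

lemma distortion_measurable_joint: "(\<lambda>z. ennreal (distortion n (fst z) (snd z))) \<in> borel_measurable (PA \<Otimes>\<^sub>M Rn n)"
  using measurable_distortion
  by (simp add: measurable_cong_sets[OF sets_pair_measure_cong[OF sets_PA refl] refl])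

lemma Kst_admissible: "admissible n PA d Kst"
proof -
  have "(\<integral>\<^sup>+z. ennreal (distortion n (fst z) (snd z)) \<partial>joint n PA Kst) = (\<integral>\<^sup>+x. ennreal (estar x) \<partial>PA)"
    unfolding star.nn_integral_joint[OF distortion_measurable_joint]
    by (intro nn_integral_cong) (simp add: nn_integral_Kst_distortion space_PA)
  also have "\<dots> = ennreal d"
    using integral_estar estar_nonneg by (subst nn_integral_eq_integral) (auto simp: has_bochner_integral_iff)
  finally show ?thesis using Kst_measurable by (simp add: admissible_def)
qed

lemma relent_Kst:
  assumes x: "x \<in> space (Rn n)"
  shows "relent (Kst x) Q = ennreal (- k / 2 * real n * estar x + ell x)"
proof -
  interpret Kx: prob_space "Kst x" by (rule prob_Kst[OF x])
  have m: "(\<lambda>y. distortion n x y) \<in> borel_measurable (Kst x)"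
    using measurable_distortion'[OF x] by (simp add: measurable_cong_sets[OF sets_Kst refl])
  have i: "has_bochner_integral (Kst x) (\<lambda>y. distortion n x y) (estar x)"
    using nn_integral_Kst_distortion[OF x] estar_nonneg distortion_nonneg
    by (intro has_bochner_integral_nn_integral m) auto
  have "has_bochner_integral (Kst x) (\<lambda>y. - k / 2 * real n * distortion n x y + ell x) (- k / 2 * real n * estar x + ell x)"
    by (intro has_bochner_integral_add has_bochner_integral_mult_right i)
      (auto simp: has_bochner_integral_iff Kx.prob_space)
  then have "has_bochner_integral (density Q (\<lambda>y. ennreal (gg x y))) (\<lambda>y. ln (gg x y)) (- k / 2 * real n * estar x + ell x)"
    by (simp add: ln_gg Kst_def)
  then show ?thesis
    using relent_density_eq[OF prob_Q, of "gg x"] gg_pos measurable_gg'[OF x]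
    by (simp add: Kst_def has_bochner_integral_iff measurable_cong_sets[OF sets_Q refl])
qed

text \<open>Guards against truncation, as \<open>ennreal\<close> sends negative reals to 0. Each
  coordinate is nonnegative by \<open>ln p \<ge> 1 - 1 / p\<close> and \<open>p \<ge> 1\<close> for
  \<open>p = 1 + k * v i\<close>.\<close>

lemma relent_Kst_exponent_nonneg: "0 \<le> - k / 2 * real n * estar x + ell x"
proof -
  have "- k / 2 * real n * estar x + ell x
     = (\<Sum>i=1..n. - k / 2 * ((x i)\<^sup>2 / (1 + k * v i)\<^sup>2 + v i / (1 + k * v i)) + (ln (1 + k * v i) / 2 + k * (x i)\<^sup>2 / (2 * (1 + k * v i))))"
  proof -
    have "- k / 2 * real n * estar x = - k / 2 * (\<Sum>i=1..n. (x i)\<^sup>2 / (1 + k * v i)\<^sup>2 + v i / (1 + k * v i))"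
      using n by (simp add: estar_def)
    then show ?thesis
      unfolding ell_def sum_distrib_left[of "- k / 2"] sum.distrib[of "\<lambda>i. - k / 2 * _ i"] by (simp only: sum.distrib)
  qed
  also have "\<dots> \<ge> 0"
  proof (rule sum_nonneg)
    fix i assume i: "i \<in> {1..n}"
    define p where "p = 1 + k * v i"
    have p: "p \<ge> 1" using v[OF i] k by (simp add: p_def)
    have "- ln p = ln (1 / p)" using p by (simp add: ln_div)
    also have "\<dots> \<le> 1 / p - 1" using p by (intro ln_le_minus_one) auto
    finally have 1: "(p - 1) / p \<le> ln p" using p by (simp add: diff_divide_distrib)
    have "(x i)\<^sup>2 / p\<^sup>2 \<le> (x i)\<^sup>2 / p"
      using p by (intro divide_left_mono) (auto simp: power2_eq_square)
    then have 2: "k * ((x i)\<^sup>2 / p\<^sup>2) \<le> k * ((x i)\<^sup>2 / p)" using k by (intro mult_left_mono) auto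
    have kv: "k * (v i / p) = (p - 1) / p" by (simp add: p_def)
    have "- k / 2 * (P + V) + (l / 2 + k * R / 2) = (l - k * V) / 2 + (k * R - k * P) / 2" for P V l R :: real
      by (simp add: field_simps)
    from this[of "(x i)\<^sup>2 / p\<^sup>2" "v i / p" "ln p" "(x i)\<^sup>2 / p"] have "- k / 2 * ((x i)\<^sup>2 / p\<^sup>2 + v i / p) + (ln p / 2 + k * (x i)\<^sup>2 / (2 * p))
       = (ln p - (p - 1) / p) / 2 + (k * ((x i)\<^sup>2 / p) - k * ((x i)\<^sup>2 / p\<^sup>2)) / 2"
      unfolding kv by (simp add: mult.commute)
    then show "0 \<le> - k / 2 * ((x i)\<^sup>2 / (1 + k * v i)\<^sup>2 + v i / (1 + k * v i)) + (ln (1 + k * v i) / 2 + k * (x i)\<^sup>2 / (2 * (1 + k * v i)))"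
      using 1 2 by (simp add: p_def[symmetric])
  qed
  finally show ?thesis .
qed

lemma cond_relent_Kst: "cond_relent PA Kst Q = ennreal rate"
proof -
  have i: "has_bochner_integral PA (\<lambda>x. - k / 2 * real n * estar x + ell x) rate"
    unfolding rate_def using integrable_ell
    by (intro has_bochner_integral_add has_bochner_integral_mult_right integral_estar) (auto simp: has_bochner_integral_iff)
  have "cond_relent PA Kst Q = (\<integral>\<^sup>+x. ennreal (- k / 2 * real n * estar x + ell x) \<partial>PA)"
    unfolding cond_relent_def by (intro nn_integral_cong relent_Kst) (simp add: space_PA)
  also have "\<dots> = ennreal rate"
    using i relent_Kst_exponent_nonneg by (subst nn_integral_eq_integral) (auto simp: has_bochner_integral_iff)
  finally show ?thesis .
qed

lemma rate_nonneg: "0 \<le> rate"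
proof -
  have i: "has_bochner_integral PA (\<lambda>x. - k / 2 * real n * estar x + ell x) rate"
    unfolding rate_def using integrable_ell
    by (intro has_bochner_integral_add has_bochner_integral_mult_right integral_estar) (auto simp: has_bochner_integral_iff)
  have "0 \<le> (\<integral>x. - k / 2 * real n * estar x + ell x \<partial>PA)"
    by (intro integral_nonneg_AE AE_I2 relent_Kst_exponent_nonneg)
  then show ?thesis using i by (simp add: has_bochner_integral_iff)
qed

text \<open>Tilting the optimal likelihood ratio by \<open>exp (t * indicator S)\<close> in the variational bound.\<close>

lemma cond_relent_ge:
  assumes adm: "admissible n PA d K" and S: "S \<in> sets (PA \<Otimes>\<^sub>M Rn n)"
  shows "ennreal (rate + t * measure (joint n PA K) S - (exp t - 1) * measure (joint n PA Kst) S) \<le> cond_relent PA K Q"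
proof -
  interpret PA: prob_space PA by (rule prob_PA)
  have K: "K \<in> PA \<rightarrow>\<^sub>M prob_algebra (Rn n)" using adm by (simp add: admissible_def)
  interpret K: test_channel n PA K
    by (rule test_channel.intro[OF prob_PA sets_PA K])
  \<comment> \<open>An admissible channel has finite conditional distortion only almost everywhere,
    so \<open>er\<close> is a real version and the pointwise bounds below hold off a null
    set.\<close>
  define e where "e x = (\<integral>\<^sup>+y. ennreal (distortion n x y) \<partial>K x)" for x
  define er where "er x = enn2real (e x)" for x
  have eM[measurable]: "e \<in> borel_measurable PA"
  proof -
    have "(\<lambda>x. \<integral>\<^sup>+y. ennreal (distortion n (fst (x, y)) (snd (x, y))) \<partial>K x) \<in> borel_measurable PA"
      by (rule nn_integral_measurable_subprob_algebra2[OF _ K.K_sub])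
        (use distortion_measurable_joint in \<open>simp add: case_prod_beta'\<close>)
    then show ?thesis by (simp add: e_def[abs_def])
  qed
  have e_le: "(\<integral>\<^sup>+x. e x \<partial>PA) \<le> ennreal d"
    using adm unfolding admissible_def K.nn_integral_joint[OF distortion_measurable_joint] by (simp add: e_def)
  then have "(\<integral>\<^sup>+x. e x \<partial>PA) \<noteq> \<infinity>" by (auto simp: top_unique)
  then have fin: "AE x in PA. e x \<noteq> \<infinity>" by (intro nn_integral_noteq_infinite) auto
  have er_e: "AE x in PA. ennreal (er x) = e x"
    using fin by eventually_elim (simp add: er_def less_top[symmetric])
  have er_le: "(\<integral>\<^sup>+x. ennreal (er x) \<partial>PA) \<le> ennreal d"
    using e_le nn_integral_cong_AE[OF er_e] by simp
  have er0: "0 \<le> er x" for x by (simp add: er_def)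
  have [measurable]: "er \<in> borel_measurable PA" unfolding er_def[abs_def] by measurable
  have er_int: "integrable PA er"
    using er_le er0 by (intro integrableI_nonneg) (auto intro: le_less_trans)
  have er_d: "(\<integral>x. er x \<partial>PA) \<le> d"
    using er_le nn_integral_eq_integral[OF er_int] er0 d_nonneg by (simp add: ennreal_le_iff)
  define h where "h x = - k / 2 * real n * er x + ell x + t * K.sec S x - (exp t - 1) * star.sec S x" for x
  have h_int: "integrable PA h"
    unfolding h_def[abs_def] using er_int integrable_ell K.integrable_sec[OF S] star.integrable_sec[OF S] by auto
  have "rate + t * measure (joint n PA K) S - (exp t - 1) * measure (joint n PA Kst) S \<le> (\<integral>x. h x \<partial>PA)"
  proof -
    have "(\<integral>x. h x \<partial>PA) = - k / 2 * real n * (\<integral>x. er x \<partial>PA) + (\<integral>x. ell x \<partial>PA)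
       + t * measure (joint n PA K) S - (exp t - 1) * measure (joint n PA Kst) S"
      unfolding h_def[abs_def] K.measure_joint[OF S] star.measure_joint[OF S]
      using er_int integrable_ell K.integrable_sec[OF S] star.integrable_sec[OF S] by simp
    \<comment> \<open>The distortion constraint enters here, with the direction fixed by
      \<open>k > 0\<close>.\<close>
    moreover have "k / 2 * real n * (\<integral>x. er x \<partial>PA) \<le> k / 2 * real n * d"
      using er_d k by (intro mult_left_mono) auto
    ultimately show ?thesis by (simp add: rate_def)
  qed
  then have "ennreal (rate + t * measure (joint n PA K) S - (exp t - 1) * measure (joint n PA Kst) S) \<le> ennreal (\<integral>x. h x \<partial>PA)"
    by (rule ennreal_leI)
  also have "\<dots> \<le> (\<integral>\<^sup>+x. ennreal (h x) \<partial>PA)" by (rule ennreal_integral_le_nn_integral[OF h_int])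
  also have "\<dots> \<le> (\<integral>\<^sup>+x. relent (K x) Q \<partial>PA)"
  proof (rule nn_integral_mono_AE)
    show "AE x in PA. ennreal (h x) \<le> relent (K x) Q"
      using fin er_e AE_space
    proof eventually_elim
      case (elim x)
      have x: "x \<in> space (Rn n)" using elim by (simp add: space_PA)
      interpret Kx: prob_space "K x" by (rule K.prob_space_K[OF elim(3)])
      interpret Sx: prob_space "Kst x" by (rule prob_Kst[OF x])
      have sK: "sets (K x) = sets (Rn n)" by (rule K.sets_K[OF elim(3)])
      define A where "A = {y \<in> space (Rn n). (x, y) \<in> S}"
      have A: "A \<in> sets (Rn n)" unfolding A_def by (rule K.section_sets[OF S elim(3)])
      have mK: "measure (K x) A = K.sec S x" and mS: "measure (Kst x) A = star.sec S x"
        by (simp_all add: A_def K.sec_def star.sec_def)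
      have dm: "(\<lambda>y. distortion n x y) \<in> borel_measurable (K x)"
        using measurable_distortion'[OF x] by (simp add: measurable_cong_sets[OF sK refl])
      have di: "has_bochner_integral (K x) (\<lambda>y. distortion n x y) (er x)"
        using elim(2) er0 distortion_nonneg by (intro has_bochner_integral_nn_integral dm) (auto simp: e_def)
      \<comment> \<open>The optimal log-ratio is rewarded by \<open>t\<close> on the event. Since
        \<open>exp (t * indicator A y)\<close> is affine in the indicator, the normaliser can be
        computed exactly under \<open>Kst x\<close>.\<close>
      define \<phi> where "\<phi> y = ln (gg x y) + t * indicator A y" for y
      have \<phi>i: "has_bochner_integral (K x) \<phi> (- k / 2 * real n * er x + ell x + t * K.sec S x)"
        unfolding \<phi>_def[abs_def] ln_gg mK[symmetric] using A sK
        by (intro has_bochner_integral_add has_bochner_integral_mult_right di)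
          (auto simp: has_bochner_integral_iff Kx.prob_space Kx.emeasure_eq_measure)
      have c0: "0 \<le> 1 + (exp t - 1) * star.sec S x"
      proof -
        have "- 1 \<le> exp t - 1" by simp
        then have "- 1 * star.sec S x \<le> (exp t - 1) * star.sec S x"
          using star.sec_bounds[OF elim(3), of S] by (intro mult_right_mono) auto
        then show ?thesis using star.sec_bounds[OF elim(3), of S] by simp
      qed
      have "(\<integral>\<^sup>+y. ennreal (exp (\<phi> y)) \<partial>Q) = (\<integral>\<^sup>+y. ennreal (gg x y) * ennreal (1 + (exp t - 1) * indicator A y) \<partial>Q)"
      proof (intro nn_integral_cong)
        fix y
        have "exp (\<phi> y) = gg x y * (1 + (exp t - 1) * indicator A y)"
          using gg_pos[of x y] by (simp add: \<phi>_def exp_add indicator_def)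
        then show "ennreal (exp (\<phi> y)) = ennreal (gg x y) * ennreal (1 + (exp t - 1) * indicator A y)"
          using gg_pos[of x y] by (simp add: ennreal_mult' less_imp_le)
      qed
      also have "\<dots> = (\<integral>\<^sup>+y. ennreal (1 + (exp t - 1) * indicator A y) \<partial>Kst x)"
      proof (rule nn_integral_Kst[OF x, symmetric])
        note [measurable] = A
        show "(\<lambda>y. ennreal (1 + (exp t - 1) * indicator A y)) \<in> borel_measurable (Rn n)" by measurable
      qed
      also have "\<dots> = ennreal (1 + (exp t - 1) * star.sec S x)"
      proof -
        have "has_bochner_integral (Kst x) (\<lambda>y. 1 + (exp t - 1) * indicator A y) (1 + (exp t - 1) * star.sec S x)"
          unfolding mS[symmetric] using A sets_Kst
          by (intro has_bochner_integral_add has_bochner_integral_mult_right)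
            (auto simp: has_bochner_integral_iff Sx.prob_space Sx.emeasure_eq_measure)
        moreover have "0 \<le> 1 + (exp t - 1) * indicator A y" for y by (simp add: indicator_def)
        ultimately show ?thesis by (subst nn_integral_eq_integral) (auto simp: has_bochner_integral_iff)
      qed
      finally have "(\<integral>\<^sup>+y. ennreal (exp (\<phi> y)) \<partial>Q) \<le> ennreal (1 + (exp t - 1) * star.sec S x)" by simp
      moreover have "integrable (K x) \<phi>" "integral\<^sup>L (K x) \<phi> - (1 + (exp t - 1) * star.sec S x) + 1 = h x"
        using \<phi>i by (simp_all add: has_bochner_integral_iff h_def)
      moreover have "sets (K x) = sets Q" using sK sets_Q by simp
      ultimately have "ennreal (integral\<^sup>L (K x) \<phi> - (1 + (exp t - 1) * star.sec S x) + 1) \<le> relent (K x) Q"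
        using c0 by (intro relent_ge[OF Kx.prob_space_axioms prob_Q])
      with \<open>integral\<^sup>L (K x) \<phi> - (1 + (exp t - 1) * star.sec S x) + 1 = h x\<close> show ?case by (simp only:)
    qed
  qed
  finally show ?thesis by (simp add: cond_relent_def)
qed

text \<open>The lower half is the tilted bound with \<open>S = {}\<close> and \<open>t = 0\<close>;
  the upper half evaluates the channel \<open>Kst\<close>.\<close>

lemma RR_eq: "RR n PA Q d = ennreal rate / ennreal (real n)"
proof (rule antisym)
  show "RR n PA Q d \<le> ennreal rate / ennreal (real n)"
    unfolding RR_def using Kst_admissible by (intro INF_lower2[of Kst]) (auto simp: cond_relent_Kst)
  show "ennreal rate / ennreal (real n) \<le> RR n PA Q d"
    unfolding RR_def
  proof (intro INF_greatest divide_right_mono_ennreal)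
    fix K assume "K \<in> {K. admissible n PA d K}"
    then show "ennreal rate \<le> cond_relent PA K Q" using cond_relent_ge[of K "{}" 0] by simp
  qed
qed

text \<open>For a minimiser the tilted bound reads \<open>t * p \<le> (exp t - 1) * q\<close> for
  all real \<open>t\<close>, which forces \<open>p = q\<close> on every event. Uniqueness is stated
  for joint laws because a kernel is determined only up to null sets of the source.\<close>

lemma minimiser_unique:
  assumes adm: "admissible n PA d K" and opt: "cond_relent PA K Q / ennreal (real n) = RR n PA Q d"
  shows "joint n PA K = joint n PA Kst"
proof -
  have K: "K \<in> PA \<rightarrow>\<^sub>M prob_algebra (Rn n)" using adm by (simp add: admissible_def)
  interpret K: test_channel n PA K
    by (rule test_channel.intro[OF prob_PA sets_PA K])
  have "ennreal (real n) * (cond_relent PA K Q / ennreal (real n)) = ennreal (real n) * (ennreal rate / ennreal (real n))"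
    using opt RR_eq by simp
  then have eq: "cond_relent PA K Q = ennreal rate"
    using n by (simp add: ennreal_times_divide mult.commute[of "ennreal (real n)"] ennreal_mult_divide_eq)
  show ?thesis
  proof (rule measure_eqI)
    show "sets (joint n PA K) = sets (joint n PA Kst)" by (simp add: K.sets_joint star.sets_joint)
    fix S assume "S \<in> sets (joint n PA K)"
    then have S: "S \<in> sets (PA \<Otimes>\<^sub>M Rn n)" by (simp add: K.sets_joint)
    have "t * measure (joint n PA K) S \<le> (exp t - 1) * measure (joint n PA Kst) S" for t
    proof -
      have "rate + t * measure (joint n PA K) S - (exp t - 1) * measure (joint n PA Kst) S \<le> rate"
        using cond_relent_ge[OF adm S, of t] rate_nonneg unfolding eq by (simp add: ennreal_le_iff)
      then show ?thesis by simp
    qed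
    then have "measure (joint n PA K) S = measure (joint n PA Kst) S" by (rule sandwich_exp_derivative)
    then show "emeasure (joint n PA K) S = emeasure (joint n PA Kst) S"
      unfolding K.emeasure_joint[OF S] star.emeasure_joint[OF S] K.measure_joint[OF S] star.measure_joint[OF S] by simp
  qed
qed

lemma minimiser_joint:
  "(SOME J. \<exists>K. admissible n PA d K \<and> cond_relent PA K Q / ennreal (real n) = RR n PA Q d \<and> J = joint n PA K)
     = joint n PA Kst"
proof (rule some_equality)
  show "\<exists>K. admissible n PA d K \<and> cond_relent PA K Q / ennreal (real n) = RR n PA Q d \<and> joint n PA Kst = joint n PA K"
    using Kst_admissible by (intro exI[of _ Kst]) (simp add: cond_relent_Kst RR_eq)
qed (use minimiser_unique in blast)

end

section \<open>The conditional distortion as a limit of elementary expectations\<close>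

lemma gauss1_interval_pos:
  assumes v: "v > 0" and e: "e > 0"
  shows "measure (gauss1 v) {b. \<bar>b - x\<bar> < e} > 0"
proof -
  interpret prob_space "gauss1 v" by (rule prob_space_gauss1)
  let ?A = "{b. \<bar>b - x\<bar> < e}"
  have A: "?A = {x - e<..<x + e}" by auto
  have "emeasure (gauss1 v) ?A \<noteq> 0"
  proof
    assume "emeasure (gauss1 v) ?A = 0"
    then have "(\<integral>\<^sup>+b. ennreal (normal_density 0 (sqrt v) b) * indicator ?A b \<partial>lborel) = 0"
      using v unfolding A by (simp add: gauss1_def emeasure_density)
    then have "AE b in lborel. ennreal (normal_density 0 (sqrt v) b) * indicator ?A b = 0"
      unfolding A by (subst (asm) nn_integral_0_iff_AE) auto
    then have "AE b in lborel. b \<notin> ?A"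
    proof eventually_elim
      case (elim b)
      have "normal_density 0 (sqrt v) b > 0" using v by (intro normal_density_pos) simp
      then show ?case using elim by (auto simp: indicator_def ennreal_eq_0_iff)
    qed
    then have "emeasure lborel ?A = 0"
      unfolding A by (subst (asm) AE_iff_measurable[of "{x - e<..<x + e}"]) auto
    then show False using e unfolding A by simp
  qed
  then show ?thesis by (simp add: emeasure_eq_measure zero_less_measure_iff)
qed

text \<open>Continuity pins \<open>q\<close> within \<open>r / 2\<close> of \<open>q x\<close> on a
  short interval, and the positive mass of that interval keeps the quotient meaningful.\<close>

lemma local_average_limit:
  fixes \<mu> :: "real measure" and q :: "real \<Rightarrow> real"
  assumes \<mu>: "prob_space \<mu>" and sets: "sets \<mu> = sets borel" and q: "isCont q x" "\<And>b. 0 \<le> q b"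
    and pos: "\<And>e. e > 0 \<Longrightarrow> measure \<mu> {b. \<bar>b - x\<bar> < e} > 0"
  shows "((\<lambda>e. enn2real (\<integral>\<^sup>+b. indicator {b. \<bar>b - x\<bar> < e} b * ennreal (q b) \<partial>\<mu>) / measure \<mu> {b. \<bar>b - x\<bar> < e}) \<longlongrightarrow> q x) (at_right 0)"
proof (rule tendstoI)
  interpret prob_space \<mu> by fact
  fix r :: real assume r: "r > 0"
  define D where "D e = measure \<mu> {b. \<bar>b - x\<bar> < e}" for e
  have Aset: "{b. \<bar>b - x\<bar> < e} \<in> events" for e
  proof -
    have "{b. \<bar>b - x\<bar> < e} = {x - e<..<x + e}" by auto
    then show ?thesis by (simp add: sets)
  qed
  have bnd: "(\<integral>\<^sup>+b. indicator {b. \<bar>b - x\<bar> < e} b * ennreal c \<partial>\<mu>) = ennreal (c * D e)" if "0 \<le> c" for e c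
    using Aset that by (subst nn_integral_multc) (auto simp: emeasure_eq_measure D_def mult.commute ennreal_mult)
  obtain t where t: "t > 0" "\<And>b. \<bar>b - x\<bar> < t \<Longrightarrow> \<bar>q b - q x\<bar> < r / 2"
    using q(1)[unfolded continuous_at_eps_delta, rule_format, of "r / 2"] r by (auto simp: dist_real_def)
  show "\<forall>\<^sub>F e in at_right 0. dist (enn2real (\<integral>\<^sup>+b. indicator {b. \<bar>b - x\<bar> < e} b * ennreal (q b) \<partial>\<mu>) / measure \<mu> {b. \<bar>b - x\<bar> < e}) (q x) < r"
    unfolding eventually_at_right_field
  proof (intro exI[of _ t] conjI allI impI t(1))
    fix e :: real assume e: "0 < e" "e < t"
    let ?N = "\<integral>\<^sup>+b. indicator {b. \<bar>b - x\<bar> < e} b * ennreal (q b) \<partial>\<mu>"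
    have D: "D e > 0" using pos[OF e(1)] by (simp add: D_def)
    have near: "q x - r / 2 \<le> q b \<and> q b \<le> q x + r / 2" if "\<bar>b - x\<bar> < e" for b
    proof -
      have "\<bar>q b - q x\<bar> < r / 2" using t(2)[of b] that e by auto
      then show ?thesis by linarith
    qed
    have up: "?N \<le> ennreal ((q x + r / 2) * D e)"
    proof -
      define c where "c = q x + r / 2"
      have "0 \<le> c" "\<bar>b - x\<bar> < e \<Longrightarrow> q b \<le> c" for b using q(2)[of x] r near[of b] by (auto simp: c_def)
      then have "?N \<le> ennreal (c * D e)"
        by (subst bnd[symmetric]) (auto intro!: nn_integral_mono ennreal_leI simp: indicator_def)
      then show ?thesis by (simp add: c_def)
    qed
    have lo: "ennreal (max 0 (q x - r / 2) * D e) \<le> ?N"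
      using q(2) near by (subst bnd[symmetric]) (auto intro!: nn_integral_mono ennreal_leI simp: indicator_def)
    have fin: "?N < \<top>" using up by (rule le_less_trans) simp
    have u: "enn2real ?N \<le> (q x + r / 2) * D e"
      using enn2real_mono[OF up] q(2)[of x] r D by simp
    have l: "max 0 (q x - r / 2) * D e \<le> enn2real ?N"
      using enn2real_mono[OF lo fin] D by simp
    have "enn2real ?N / D e \<le> q x + r / 2" "q x - r / 2 \<le> enn2real ?N / D e"
      using u l D by (auto simp: divide_le_eq le_divide_eq intro: order_trans[OF mult_right_mono[of "q x - r / 2" "max 0 (q x - r / 2)" "D e"]])
    then show "dist (enn2real ?N / measure \<mu> {b. \<bar>b - x\<bar> < e}) (q x) < r"
      using r unfolding D_def[symmetric] dist_real_def by linarith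
  qed
qed

context gaussian_tilt
begin

text \<open>Integrating out the output first gives the second moment about the fixed point
  \<open>x\<close> as a continuous function \<open>q\<close> of the conditioning value; the limit
  evaluates \<open>q\<close> at \<open>x\<close>.\<close>

lemma conditional_second_moment_limit:
  assumes i: "i \<in> {1..n}"
  shows "((\<lambda>e. (\<integral>z. indicator {z. \<bar>fst z i - x\<bar> < e} z * (snd z i - x)\<^sup>2 \<partial>joint n PA Kst)
       / measure (joint n PA Kst) {z \<in> space (joint n PA Kst). \<bar>fst z i - x\<bar> < e})
     \<longlongrightarrow> x\<^sup>2 / (1 + k * v i)\<^sup>2 + v i / (1 + k * v i)) (at_right 0)"
proof -
  let ?J = "joint n PA Kst"
  define q where "q b = (k * v i * b / (1 + k * v i) - x)\<^sup>2 + v i / (1 + k * v i)" for b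
  have q0: "0 \<le> q b" for b using v[OF i] p_pos[OF i] by (simp add: q_def)
  have pairs: "sets (PA \<Otimes>\<^sub>M Rn n) = sets (Rn n \<Otimes>\<^sub>M Rn n)"
    by (intro sets_pair_measure_cong sets_PA refl)
  have mp: "measurable (PA \<Otimes>\<^sub>M Rn n) N = measurable (Rn n \<Otimes>\<^sub>M Rn n) N" for N :: "'b measure"
    by (rule measurable_cong_sets[OF pairs refl])
  note [measurable] = measurable_fst_coord[OF i, of "Rn n"] measurable_snd_coord[OF i, of "Rn n"] measurable_coord_Rn[OF i]
  have nn: "(\<integral>\<^sup>+z. f (fst z i) * ennreal ((snd z i - x)\<^sup>2) \<partial>?J) = (\<integral>\<^sup>+b. f b * ennreal (q b) \<partial>gauss1 (sA i))"
    if [measurable]: "f \<in> borel_measurable borel" for f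
  proof -
    have "(\<integral>\<^sup>+z. f (fst z i) * ennreal ((snd z i - x)\<^sup>2) \<partial>?J)
       = (\<integral>\<^sup>+w. \<integral>\<^sup>+y. f (w i) * ennreal ((y i - x)\<^sup>2) \<partial>Kst w \<partial>PA)"
      by (subst star.nn_integral_joint) (simp_all add: mp)
    also have "\<dots> = (\<integral>\<^sup>+w. f (w i) * ennreal (q (w i)) \<partial>PA)"
    proof (rule nn_integral_cong)
      fix w assume w: "w \<in> space PA"
      have "(\<lambda>y. ennreal ((y i - x)\<^sup>2)) \<in> borel_measurable (Kst w)"
        unfolding measurable_cong_sets[OF sets_Kst refl] by measurable
      then show "(\<integral>\<^sup>+y. f (w i) * ennreal ((y i - x)\<^sup>2) \<partial>Kst w) = f (w i) * ennreal (q (w i))"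
        using nn_integral_Kst_coord[OF _ i, of w x] w by (simp add: nn_integral_cmult space_PA q_def)
    qed
    also have "\<dots> = (\<integral>\<^sup>+b. f b * ennreal (q b) \<partial>gauss1 (sA i))"
      unfolding PA_def by (rule nn_integral_gaussN_marginal[OF i, of "\<lambda>b. f b * ennreal (q b)"]) (unfold q_def, measurable)
    finally show ?thesis .
  qed
  have num: "(\<integral>z. indicator {z. \<bar>fst z i - x\<bar> < e} z * (snd z i - x)\<^sup>2 \<partial>?J)
     = enn2real (\<integral>\<^sup>+b. indicator {b. \<bar>b - x\<bar> < e} b * ennreal (q b) \<partial>gauss1 (sA i))" for e
  proof -
    have "(\<integral>z. indicator {z. \<bar>fst z i - x\<bar> < e} z * (snd z i - x)\<^sup>2 \<partial>?J)
       = enn2real (\<integral>\<^sup>+z. ennreal (indicator {z. \<bar>fst z i - x\<bar> < e} z * (snd z i - x)\<^sup>2) \<partial>?J)"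
    proof (rule integral_eq_nn_integral)
      have "(\<lambda>z. indicator {z. \<bar>fst z i - x\<bar> < e} z * (snd z i - x)\<^sup>2) = (\<lambda>z. (if \<bar>fst z i - x\<bar> < e then 1 else 0) * (snd z i - x)\<^sup>2)"
        by (auto simp: indicator_def)
      then show "(\<lambda>z. indicator {z. \<bar>fst z i - x\<bar> < e} z * (snd z i - x)\<^sup>2) \<in> borel_measurable ?J"
        by (simp add: measurable_cong_sets[OF star.sets_joint refl] mp)
    qed auto
    also have "(\<integral>\<^sup>+z. ennreal (indicator {z. \<bar>fst z i - x\<bar> < e} z * (snd z i - x)\<^sup>2) \<partial>?J)
       = (\<integral>\<^sup>+z. indicator {b. \<bar>b - x\<bar> < e} (fst z i) * ennreal ((snd z i - x)\<^sup>2) \<partial>?J)"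
      by (intro nn_integral_cong) (auto simp: indicator_def)
    also have "\<dots> = (\<integral>\<^sup>+b. indicator {b. \<bar>b - x\<bar> < e} b * ennreal (q b) \<partial>gauss1 (sA i))"
      by (rule nn[of "indicator {b. \<bar>b - x\<bar> < e}"]) measurable
    finally show ?thesis .
  qed
  have den: "measure ?J {z \<in> space ?J. \<bar>fst z i - x\<bar> < e} = measure (gauss1 (sA i)) {b. \<bar>b - x\<bar> < e}" for e
  proof -
    have s: "{z \<in> space ?J. \<bar>fst z i - x\<bar> < e} \<in> sets ?J"
      unfolding star.sets_joint pairs sets_eq_imp_space_eq[OF star.sets_joint] sets_eq_imp_space_eq[OF pairs] by measurable
    have s2: "{b. \<bar>b - x\<bar> < e} \<in> sets (gauss1 (sA i))" by simp
    have "emeasure ?J {z \<in> space ?J. \<bar>fst z i - x\<bar> < e} = (\<integral>\<^sup>+z. indicator {z \<in> space ?J. \<bar>fst z i - x\<bar> < e} z \<partial>?J)"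
      using s by simp
    also have "\<dots> = (\<integral>\<^sup>+z. indicator {b. \<bar>b - x\<bar> < e} (fst z i) \<partial>?J)"
      by (intro nn_integral_cong) (auto simp: indicator_def)
    also have "\<dots> = (\<integral>\<^sup>+w. \<integral>\<^sup>+y. indicator {b. \<bar>b - x\<bar> < e} (w i) \<partial>Kst w \<partial>PA)"
      by (subst star.nn_integral_joint) (simp_all add: mp)
    also have "\<dots> = (\<integral>\<^sup>+w. indicator {b. \<bar>b - x\<bar> < e} (w i) \<partial>PA)"
      by (intro nn_integral_cong) (simp add: prob_space.emeasure_space_1[OF prob_Kst] space_PA)
    also have "\<dots> = (\<integral>\<^sup>+b. indicator {b. \<bar>b - x\<bar> < e} b \<partial>gauss1 (sA i))"
      unfolding PA_def by (rule nn_integral_gaussN_marginal[OF i]) measurable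
    also have "\<dots> = emeasure (gauss1 (sA i)) {b. \<bar>b - x\<bar> < e}" using s2 by (rule nn_integral_indicator)
    finally show ?thesis by (simp add: measure_def)
  qed
  have "isCont q x" unfolding q_def by (intro continuous_intros) (use p_pos[OF i] in auto)
  from local_average_limit[OF prob_space_gauss1 sets_gauss1 this q0 gauss1_interval_pos[OF sA[OF i]]]
  have "((\<lambda>e. enn2real (\<integral>\<^sup>+b. indicator {b. \<bar>b - x\<bar> < e} b * ennreal (q b) \<partial>gauss1 (sA i)) / measure (gauss1 (sA i)) {b. \<bar>b - x\<bar> < e}) \<longlongrightarrow> q x) (at_right 0)" by simp
  moreover have "q x = x\<^sup>2 / (1 + k * v i)\<^sup>2 + v i / (1 + k * v i)"
  proof -
    have "k * v i * x / (1 + k * v i) - x = - (x / (1 + k * v i))"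
      using p_pos[OF i] by (simp add: field_simps)
    then show ?thesis by (simp add: q_def power_divide)
  qed
  ultimately show ?thesis unfolding num den by simp
qed

end

text \<open>\<open>balance\<close> makes the distortion constraint tight for the multiplier
  \<open>k\<close>, which identifies the chosen joint law with that of the tilted channel.\<close>

lemma mfun_eq:
  assumes "n \<ge> 1" "k > 0" "\<And>i. i \<in> {1..n} \<Longrightarrow> sighat2 \<sigma>2 n u i > 0" "\<And>i. i \<in> {1..n} \<Longrightarrow> nu2 a \<sigma>2 d n i \<ge> 0"
    and balance: "(1 / real n) * (\<Sum>i=1..n. sighat2 \<sigma>2 n u i / (1 + k * nu2 a \<sigma>2 d n i)\<^sup>2 + nu2 a \<sigma>2 d n i / (1 + k * nu2 a \<sigma>2 d n i)) = d"
    and i: "i \<in> {1..n}"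
  shows "mfun a \<sigma>2 d n u i = (xvec a n u i)\<^sup>2 / (1 + k * nu2 a \<sigma>2 d n i)\<^sup>2 + nu2 a \<sigma>2 d n i / (1 + k * nu2 a \<sigma>2 d n i)"
proof -
  interpret gaussian_tilt n k d "sighat2 \<sigma>2 n u" "nu2 a \<sigma>2 d n"
    by unfold_locales (use assms in auto)
  have "opt_joint a \<sigma>2 d n u = joint n PA Kst"
    using minimiser_joint by (simp add: opt_joint_def Xhat_def Ystar_def PA_def Q_def)
  then show ?thesis
    unfolding mfun_def Let_def using tendsto_Lim[OF _ conditional_second_moment_limit[OF i]] by simp
qed

section \<open>Concentration of rotated Gaussian vectors\<close>

lemma nn_integral_std_normal_exp_quadratic:
  assumes m: "m > -1"
  shows "(\<integral>\<^sup>+w. ennreal (std_normal_density w) * ennreal (exp (v * w - m * w\<^sup>2 / 2)) \<partial>lborel)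
     = ennreal (exp (v\<^sup>2 / (2 * (1 + m))) / sqrt (1 + m))"
proof -
  define p where "p = 1 + m"
  have p: "p > 0" using m by (simp add: p_def)
  define K where "K = exp (v\<^sup>2 / (2 * p)) / sqrt p"
  have K: "K \<ge> 0" using p by (simp add: K_def)
  have "std_normal_density w * exp (v * w - m * w\<^sup>2 / 2) = K * normal_density (v / p) (1 / sqrt p) w" for w
  proof -
    have e: "- w\<^sup>2 / 2 + (v * w - m * w\<^sup>2 / 2) = v\<^sup>2 / (2 * p) + - (w - v / p)\<^sup>2 / (2 * (1 / p))"
    proof -
      have m': "m = p - 1" by (simp add: p_def)
      show ?thesis using p unfolding m' by (simp add: field_simps power2_eq_square)
    qed
    have "std_normal_density w * exp (v * w - m * w\<^sup>2 / 2) = 1 / sqrt (2 * pi) * exp (- w\<^sup>2 / 2 + (v * w - m * w\<^sup>2 / 2))"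
      unfolding exp_add by (simp add: std_normal_density_def)
    also have "\<dots> = 1 / sqrt (2 * pi) * exp (v\<^sup>2 / (2 * p)) * exp (- (w - v / p)\<^sup>2 / (2 * (1 / p)))"
      unfolding e exp_add by simp
    also have "1 / sqrt (2 * pi) = 1 / sqrt p * (1 / sqrt (2 * pi * (1 / p)))"
      using p by (simp add: real_sqrt_divide real_sqrt_mult)
    finally show ?thesis using p by (simp add: normal_density_def K_def power_divide)
  qed
  then have "(\<integral>\<^sup>+w. ennreal (std_normal_density w) * ennreal (exp (v * w - m * w\<^sup>2 / 2)) \<partial>lborel)
     = (\<integral>\<^sup>+w. ennreal K * ennreal (normal_density (v / p) (1 / sqrt p) w) \<partial>lborel)"
    using K by (intro nn_integral_cong) (simp flip: ennreal_mult)
  also have "\<dots> = ennreal K * (\<integral>\<^sup>+w. ennreal (normal_density (v / p) (1 / sqrt p) w) \<partial>lborel)"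
    by (rule nn_integral_cmult) measurable
  also have "(\<integral>\<^sup>+w. ennreal (normal_density (v / p) (1 / sqrt p) w) \<partial>lborel) = 1"
    using prob_space.emeasure_space_1[OF prob_space_normal_density[of "1 / sqrt p" "v / p"]] p by (simp add: emeasure_density)
  finally show ?thesis by (simp add: K_def p_def)
qed

lemma nn_integral_gauss1_exp_quadratic:
  assumes "m > -1"
  shows "(\<integral>\<^sup>+w. ennreal (exp (v * w - m * w\<^sup>2 / 2)) \<partial>gauss1 1) = ennreal (exp (v\<^sup>2 / (2 * (1 + m))) / sqrt (1 + m))"
  using nn_integral_std_normal_exp_quadratic[OF assms, of v] by (simp add: gauss1_def nn_integral_density)

text \<open>Only even powers occur in \<open>(1 + b^2) ^ (2 * k)\<close>, and
  \<open>b ^ (2 * k)\<close> carries the central binomial coefficient; equal polynomial functions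
  have equal coefficients.\<close>

lemma polynomial_moment_coefficient:
  fixes k :: nat
  assumes "\<And>b::real. (\<Sum>j\<le>4 * k. c j * b ^ j) = (1 + b\<^sup>2) ^ (2 * k) * m"
  shows "c (2 * k) = real ((2 * k) choose k) * m"
proof -
  define d where "d j = (if even j then real ((2 * k) choose (j div 2)) * m else 0)" for j
  have "(1 + b\<^sup>2) ^ (2 * k) * m = (\<Sum>j\<le>4 * k. d j * b ^ j)" for b :: real
  proof -
    have "(1 + b\<^sup>2) ^ (2 * k) * m = (\<Sum>i\<le>2 * k. real ((2 * k) choose i) * m * b ^ (2 * i))"
      using binomial_ring[of "b\<^sup>2" 1 "2 * k"]
      by (simp add: sum_distrib_right sum_distrib_left add.commute power_mult[symmetric] mult_ac)
    also have "\<dots> = (\<Sum>i\<in>{..2 * k}. d (2 * i) * b ^ (2 * i))" by (simp add: d_def)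
    also have "\<dots> = (\<Sum>j\<in>(\<lambda>i. 2 * i) ` {..2 * k}. d j * b ^ j)"
      by (subst sum.reindex) (auto simp: inj_on_def)
    also have "\<dots> = (\<Sum>j\<le>4 * k. d j * b ^ j)"
    proof (rule sum.mono_neutral_left)
      show "\<forall>j\<in>{..4 * k} - (\<lambda>i. 2 * i) ` {..2 * k}. d j * b ^ j = 0"
      proof
        fix j assume j: "j \<in> {..4 * k} - (\<lambda>i. 2 * i) ` {..2 * k}"
        have "odd j"
        proof
          assume "even j"
          then obtain i where "j = 2 * i" by (auto elim: evenE)
          with j show False by auto
        qed
        then show "d j * b ^ j = 0" by (simp add: d_def)
      qed
    qed auto
    finally show ?thesis .
  qed
  then have "\<forall>b. (\<Sum>j\<le>4 * k. c j * b ^ j) = (\<Sum>j\<le>4 * k. d j * b ^ j)" using assms by simp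
  then have "c (2 * k) = d (2 * k)" using polyfun_eq_coeffs[where c = c and d = d and n = "4 * k"] by auto
  then show ?thesis by (simp add: d_def)
qed

text \<open>The double factorial \<open>(2 * k - 1)!!\<close>, that is, the moment of order
  \<open>2 * k\<close> of a standard normal variable.\<close>

definition nmom :: "nat \<Rightarrow> real" where "nmom k = fact (2 * k) / (2 ^ k * fact k)"

text \<open>The left side is the mixed moment extracted from \<open>E (X + b Y) ^ (4 * k)\<close>;
  its value is the product that independence would give.\<close>

lemma nmom_binomial: "real ((2 * k) choose k) * nmom (2 * k) / real ((4 * k) choose (2 * k)) = (nmom k)\<^sup>2"
proof -
  have 1: "real ((2 * k) choose k) = fact (2 * k) / (fact k * fact k)"
    by (simp add: binomial_fact mult_2)
  have 2: "real ((4 * k) choose (2 * k)) = fact (4 * k) / (fact (2 * k) * fact (2 * k))"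
    by (simp add: binomial_fact)
  have f: "(fact k :: real) \<noteq> 0" "(fact (2 * k) :: real) \<noteq> 0" "(fact (4 * k) :: real) \<noteq> 0" by simp_all
  have "2 * (2 * k) = 4 * k" "(2::real) ^ (2 * k) = 2 ^ k * 2 ^ k" by (simp_all add: mult_2 power_add)
  then show ?thesis unfolding 1 2 nmom_def using f by (simp add: field_simps power2_eq_square)
qed

lemma odd_dfact_eq: "k \<in> {1, 2, 3} \<Longrightarrow> odd_dfact k = nmom k"
  by (auto simp: odd_dfact_def nmom_def numeral_eq_Suc)

text \<open>The left side is the exponential moment of \<open>g^2 - 1\<close> at \<open>s\<close>
  for a standard normal \<open>g\<close>. The bound rests on
  \<open>ln (1 - x) \<ge> - x - 2 * x^2\<close> for x between 0 and 1/2, and for negative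
  \<open>s\<close> on the analogue for \<open>ln (1 + x)\<close>.\<close>

lemma chi_square_mgf_bound:
  fixes s :: real
  assumes "\<bar>s\<bar> \<le> 1 / 4"
  shows "exp (- s) * (1 / sqrt (1 - 2 * s)) \<le> exp (4 * s\<^sup>2)"
proof -
  have p: "1 - 2 * s > 0" using assms by (simp add: abs_le_iff)
  have "- 2 * s - 8 * s\<^sup>2 \<le> ln (1 - 2 * s)"
  proof (cases "s \<ge> 0")
    case True
    then show ?thesis using ln_one_minus_pos_lower_bound[of "2 * s"] assms by (simp add: power_mult_distrib)
  next
    case False
    then have "- 2 * s - 4 * s\<^sup>2 \<le> ln (1 - 2 * s)"
      using ln_one_plus_pos_lower_bound[of "- 2 * s"] assms by (simp add: power_mult_distrib)
    then show ?thesis using zero_le_power2[of s] by linarith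
  qed
  then have "- s - ln (1 - 2 * s) / 2 \<le> 4 * s\<^sup>2" by simp
  moreover have "1 / sqrt (1 - 2 * s) = exp (- (ln (1 - 2 * s) / 2))"
    using p by (simp add: exp_minus ln_sqrt[symmetric] inverse_eq_divide)
  ultimately show ?thesis by (simp flip: exp_add)
qed

section \<open>Rotations of a standard Gaussian family\<close>

context prob_space
begin

text \<open>The density is at most \<open>1 / (2 * s)\<close> because
  \<open>sqrt (2 * pi) \<ge> 2\<close>, and the interval has length \<open>2 * e\<close>.\<close>

lemma normal_small_ball:
  assumes X: "distributed M lborel X (normal_density 0 s)" and s: "s > 0" and e: "e \<ge> 0"
  shows "prob {\<omega> \<in> space M. \<bar>X \<omega>\<bar> < e} \<le> e / s"
proof -
  have A: "{x. \<bar>x\<bar> < e} = {- e<..<e}" by auto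
  have "{\<omega> \<in> space M. \<bar>X \<omega>\<bar> < e} = X -` {- e<..<e} \<inter> space M" by auto
  then have "emeasure M {\<omega> \<in> space M. \<bar>X \<omega>\<bar> < e} = (\<integral>\<^sup>+x. ennreal (normal_density 0 s x) * indicator {- e<..<e} x \<partial>lborel)"
    using distributed_emeasure[OF X, of "{- e<..<e}"] by simp
  also have "\<dots> \<le> (\<integral>\<^sup>+x. ennreal (1 / (2 * s)) * indicator {- e<..<e} x \<partial>lborel)"
  proof (intro nn_integral_mono mult_right_mono ennreal_leI)
    fix x
    have "2 \<le> sqrt (2 * pi)" using pi_gt3 by (intro real_le_rsqrt) simp
    then have "2 * s \<le> sqrt (2 * pi) * s" using s by (intro mult_right_mono) auto
    then have "2 * s \<le> sqrt (2 * pi * s\<^sup>2)" using s by (simp add: real_sqrt_mult)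
    then have "1 / sqrt (2 * pi * s\<^sup>2) * exp (- (x - 0)\<^sup>2 / (2 * s\<^sup>2)) \<le> 1 / (2 * s) * 1"
      using s by (intro mult_mono divide_left_mono) auto
    then show "normal_density 0 s x \<le> 1 / (2 * s)" by (simp add: normal_density_def)
  qed auto
  also have "\<dots> = ennreal (1 / (2 * s)) * emeasure lborel {- e<..<e}" by (subst nn_integral_cmult_indicator) auto
  also have "\<dots> = ennreal (1 / (2 * s) * (2 * e))" using e s by (simp add: ennreal_mult[symmetric])
  finally show ?thesis using s e by (simp add: emeasure_eq_measure ennreal_le_iff)
qed

definition std_gauss_family :: "(nat \<Rightarrow> 'a \<Rightarrow> real) \<Rightarrow> nat \<Rightarrow> bool" where
  "std_gauss_family W n \<longleftrightarrow> indep_vars (\<lambda>_. borel) W {1..n} \<and>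
     (\<forall>k\<in>{1..n}. distributed M lborel (W k) (\<lambda>x. ennreal (std_normal_density x)))"

lemma std_gauss_measurable:
  assumes "std_gauss_family W n" "k \<in> {1..n}"
  shows "W k \<in> borel_measurable M"
  using assms by (auto simp: std_gauss_family_def indep_vars_def)

text \<open>Indices with zero coefficient are dropped beforehand, since a constant has no normal
  density; positivity of the sum leaves a nonempty index set.\<close>

lemma linear_combination_normal:
  assumes W: "std_gauss_family W n" and c: "(\<Sum>k=1..n. (c k)\<^sup>2) > 0"
  shows "distributed M lborel (\<lambda>\<omega>. \<Sum>k=1..n. c k * W k \<omega>) (normal_density 0 (sqrt (\<Sum>k=1..n. (c k)\<^sup>2)))"
proof -
  define I where "I = {k\<in>{1..n}. c k \<noteq> 0}"
  have I: "finite I" "I \<subseteq> {1..n}" by (auto simp: I_def)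
  have ne: "I \<noteq> {}"
  proof
    assume "I = {}"
    then have "(\<Sum>k=1..n. (c k)\<^sup>2) = 0" by (intro sum.neutral) (auto simp: I_def)
    with c show False by simp
  qed
  have ind: "indep_vars (\<lambda>_. borel) (\<lambda>k \<omega>. c k * W k \<omega>) I"
  proof -
    have "indep_vars (\<lambda>_. borel) W {1..n}" using W by (simp add: std_gauss_family_def)
    then have "indep_vars (\<lambda>_. borel) W I" using I(2) by (rule indep_vars_subset)
    from indep_vars_compose2[OF this, of "\<lambda>k x. c k * x" "\<lambda>_. borel"] show ?thesis by simp
  qed
  have d: "distributed M lborel (\<lambda>\<omega>. c k * W k \<omega>) (normal_density 0 \<bar>c k\<bar>)" if "k \<in> I" for k
  proof -
    have "distributed M lborel (W k) (normal_density 0 1)"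
      using W that I by (auto simp: std_gauss_family_def)
    from normal_density_affine[OF this, of "c k" 0] that show ?thesis by (simp add: I_def)
  qed
  have "distributed M lborel (\<lambda>\<omega>. \<Sum>k\<in>I. c k * W k \<omega>) (normal_density (\<Sum>k\<in>I. 0) (sqrt (\<Sum>k\<in>I. \<bar>c k\<bar>\<^sup>2)))"
    by (rule sum_indep_normal[OF I(1) ne ind _ d]) (auto simp: I_def)
  moreover have "(\<Sum>k\<in>I. c k * W k \<omega>) = (\<Sum>k=1..n. c k * W k \<omega>)" for \<omega>
    using I by (intro sum.mono_neutral_left) (auto simp: I_def)
  moreover have "(\<Sum>k\<in>I. \<bar>c k\<bar>\<^sup>2) = (\<Sum>k=1..n. (c k)\<^sup>2)"
    unfolding power2_abs using I by (intro sum.mono_neutral_left) (auto simp: I_def)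
  ultimately show ?thesis by simp
qed

lemma normal_even_moment:
  assumes X: "distributed M lborel X (normal_density 0 s)" and s: "s > 0"
  shows "has_bochner_integral M (\<lambda>\<omega>. X \<omega> ^ (2 * k)) ((s\<^sup>2) ^ k * nmom k)"
proof -
  have b: "has_bochner_integral lborel (\<lambda>x. normal_density 0 s x * x ^ (2 * k)) (fact (2 * k) / ((2 / s\<^sup>2) ^ k * fact k))"
    using normal_moment_even[OF s, of 0 k] by simp
  have "integrable M (\<lambda>\<omega>. X \<omega> ^ (2 * k))"
    using distributed_integrable[OF X, of "\<lambda>x. x ^ (2 * k)"] b by (auto simp: has_bochner_integral_iff)
  moreover have "(\<integral>\<omega>. X \<omega> ^ (2 * k) \<partial>M) = fact (2 * k) / ((2 / s\<^sup>2) ^ k * fact k)"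
    using distributed_integral[OF X, of "\<lambda>x. x ^ (2 * k)"] b by (auto simp: has_bochner_integral_iff)
  moreover have "fact (2 * k) / ((2 / s\<^sup>2) ^ k * fact k) = (s\<^sup>2) ^ k * nmom k"
    using s by (simp add: nmom_def power_divide)
  ultimately show ?thesis by (simp add: has_bochner_integral_iff)
qed

text \<open>Rotation invariance is only needed for pairs, and only for even moments: the mixed moment
  is a coefficient of the polynomial \<open>b \<mapsto> E (X + b Y) ^ (4 k)\<close>.\<close>

lemma mixed_even_moment:
  assumes XY: "\<And>b::real. distributed M lborel (\<lambda>\<omega>. X \<omega> + b * Y \<omega>) (normal_density 0 (sqrt (1 + b\<^sup>2)))"
    and Y: "distributed M lborel Y (normal_density 0 1)"
  shows "has_bochner_integral M (\<lambda>\<omega>. X \<omega> ^ (2 * k) * Y \<omega> ^ (2 * k)) ((nmom k)\<^sup>2)"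
proof -
  have X: "distributed M lborel X (normal_density 0 1)" using XY[of 0] by simp
  have [measurable]: "X \<in> borel_measurable M" "Y \<in> borel_measurable M"
    using distributed_measurable[OF X] distributed_measurable[OF Y] by simp_all
  let ?N = "4 * k"
  have p4: "2 * (2 * k) = ?N" by simp
  have iX: "integrable M (\<lambda>\<omega>. X \<omega> ^ ?N)" and iY: "integrable M (\<lambda>\<omega>. Y \<omega> ^ ?N)"
    using normal_even_moment[OF X, of "2 * k"] normal_even_moment[OF Y, of "2 * k"]
    unfolding p4 by (simp_all add: has_bochner_integral_iff)
  \<comment> \<open>Mixed powers are dominated by the pure top powers, through the larger of the two
    absolute values.\<close>
  have int: "integrable M (\<lambda>\<omega>. X \<omega> ^ (?N - j) * Y \<omega> ^ j)" if j: "j \<le> ?N" for j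
  proof (rule Bochner_Integration.integrable_bound)
    show "integrable M (\<lambda>\<omega>. X \<omega> ^ ?N + Y \<omega> ^ ?N)" using iX iY by simp
    show "AE \<omega> in M. norm (X \<omega> ^ (?N - j) * Y \<omega> ^ j) \<le> norm (X \<omega> ^ ?N + Y \<omega> ^ ?N)"
    proof (intro AE_I2)
      fix \<omega>
      define m where "m = max \<bar>X \<omega>\<bar> \<bar>Y \<omega>\<bar>"
      have "norm (X \<omega> ^ (?N - j) * Y \<omega> ^ j) = \<bar>X \<omega>\<bar> ^ (?N - j) * \<bar>Y \<omega>\<bar> ^ j"
        by (simp add: abs_mult power_abs)
      also have "\<dots> \<le> m ^ (?N - j) * m ^ j"
        by (intro mult_mono power_mono) (auto simp: m_def)
      also have "\<dots> = m ^ ?N" using j by (simp flip: power_add)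
      also have "\<dots> \<le> \<bar>X \<omega>\<bar> ^ ?N + \<bar>Y \<omega>\<bar> ^ ?N" by (auto simp: m_def max_def)
      also have "\<dots> = X \<omega> ^ ?N + Y \<omega> ^ ?N" by (simp add: power_even_abs)
      finally show "norm (X \<omega> ^ (?N - j) * Y \<omega> ^ j) \<le> norm (X \<omega> ^ ?N + Y \<omega> ^ ?N)" by simp
    qed
  qed measurable
  define c where "c j = real (?N choose j) * (\<integral>\<omega>. X \<omega> ^ (?N - j) * Y \<omega> ^ j \<partial>M)" for j
  have "(\<Sum>j\<le>?N. c j * b ^ j) = (1 + b\<^sup>2) ^ (2 * k) * nmom (2 * k)" for b :: real
  proof -
    have s: "sqrt (1 + b\<^sup>2) > 0" by (simp add: add_pos_nonneg)
    have "(\<Sum>j\<le>?N. c j * b ^ j) = (\<Sum>j\<le>?N. \<integral>\<omega>. real (?N choose j) * b ^ j * (X \<omega> ^ (?N - j) * Y \<omega> ^ j) \<partial>M)"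
    proof (intro sum.cong refl)
      fix j
      have e: "(\<integral>\<omega>. real (?N choose j) * b ^ j * (X \<omega> ^ (?N - j) * Y \<omega> ^ j) \<partial>M)
        = real (?N choose j) * b ^ j * (\<integral>\<omega>. X \<omega> ^ (?N - j) * Y \<omega> ^ j \<partial>M)" by simp
      show "c j * b ^ j = (\<integral>\<omega>. real (?N choose j) * b ^ j * (X \<omega> ^ (?N - j) * Y \<omega> ^ j) \<partial>M)"
        unfolding e c_def by (simp only: mult_ac)
    qed
    also have "\<dots> = (\<integral>\<omega>. (\<Sum>j\<le>?N. real (?N choose j) * b ^ j * (X \<omega> ^ (?N - j) * Y \<omega> ^ j)) \<partial>M)"
      by (intro Bochner_Integration.integral_sum[symmetric] integrable_mult_right int) auto
    also have "\<dots> = (\<integral>\<omega>. (X \<omega> + b * Y \<omega>) ^ (2 * (2 * k)) \<partial>M)"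
    proof (intro Bochner_Integration.integral_cong refl)
      fix \<omega>
      show "(\<Sum>j\<le>?N. real (?N choose j) * b ^ j * (X \<omega> ^ (?N - j) * Y \<omega> ^ j)) = (X \<omega> + b * Y \<omega>) ^ (2 * (2 * k))"
        unfolding p4 add.commute[of "X \<omega>"] binomial_ring by (simp add: power_mult_distrib mult_ac)
    qed
    also have "\<dots> = ((sqrt (1 + b\<^sup>2))\<^sup>2) ^ (2 * k) * nmom (2 * k)"
      using normal_even_moment[OF XY s, of "2 * k"] by (simp add: has_bochner_integral_iff)
    also have "(sqrt (1 + b\<^sup>2))\<^sup>2 = 1 + b\<^sup>2" by (simp add: add_nonneg_nonneg)
    finally show ?thesis .
  qed
  then have "c (2 * k) = real ((2 * k) choose k) * nmom (2 * k)" by (rule polynomial_moment_coefficient)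
  then have "real (?N choose (2 * k)) * (\<integral>\<omega>. X \<omega> ^ (2 * k) * Y \<omega> ^ (2 * k) \<partial>M) = real ((2 * k) choose k) * nmom (2 * k)"
    by (simp add: c_def)
  moreover have "real (?N choose (2 * k)) \<noteq> 0" by simp
  ultimately have "(\<integral>\<omega>. X \<omega> ^ (2 * k) * Y \<omega> ^ (2 * k) \<partial>M) = real ((2 * k) choose k) * nmom (2 * k) / real (?N choose (2 * k))"
    by (simp add: field_simps)
  with int[of "2 * k"] nmom_binomial[of k] show ?thesis by (simp add: has_bochner_integral_iff)
qed

definition rotated :: "(nat \<Rightarrow> nat \<Rightarrow> real) \<Rightarrow> nat \<Rightarrow> (nat \<Rightarrow> 'a \<Rightarrow> real) \<Rightarrow> nat \<Rightarrow> 'a \<Rightarrow> real" where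
  "rotated Q n W i \<omega> = (\<Sum>k=1..n. Q i k * W k \<omega>)"

context
  fixes W :: "nat \<Rightarrow> 'a \<Rightarrow> real" and n :: nat and Q :: "nat \<Rightarrow> nat \<Rightarrow> real"
  assumes W: "std_gauss_family W n"
    and orth: "\<And>i j. i \<in> {1..n} \<Longrightarrow> j \<in> {1..n} \<Longrightarrow> (\<Sum>k=1..n. Q i k * Q j k) = (if i = j then 1 else 0)"
begin

lemma W_measurable[measurable]: "k \<in> {1..n} \<Longrightarrow> W k \<in> borel_measurable M"
  using W by (rule std_gauss_measurable)

lemma rotated_measurable[measurable]: "rotated Q n W i \<in> borel_measurable M"
  unfolding rotated_def[abs_def] by (intro borel_measurable_sum borel_measurable_times borel_measurable_const W_measurable)

text \<open>Orthonormality of two rows gives the variance \<open>1 + b^2\<close>, the form in which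
  \<open>mixed_even_moment\<close> expects a pair.\<close>

lemma rotated_pair_normal:
  assumes ij: "i \<in> {1..n}" "j \<in> {1..n}" "i \<noteq> j"
  shows "distributed M lborel (\<lambda>\<omega>. rotated Q n W i \<omega> + b * rotated Q n W j \<omega>) (normal_density 0 (sqrt (1 + b\<^sup>2)))"
proof -
  have s: "(\<Sum>k=1..n. (Q i k + b * Q j k)\<^sup>2) = 1 + b\<^sup>2"
  proof -
    have "(\<Sum>k=1..n. (Q i k + b * Q j k)\<^sup>2) = (\<Sum>k=1..n. Q i k * Q i k) + 2 * b * (\<Sum>k=1..n. Q i k * Q j k) + b\<^sup>2 * (\<Sum>k=1..n. Q j k * Q j k)"
      unfolding sum_distrib_left sum.distrib[symmetric] by (intro sum.cong refl) (simp add: power2_eq_square algebra_simps)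
    then show ?thesis using orth ij by simp
  qed
  have "0 < 1 + b\<^sup>2" by (simp add: add_pos_nonneg)
  then have "distributed M lborel (\<lambda>\<omega>. \<Sum>k=1..n. (Q i k + b * Q j k) * W k \<omega>) (normal_density 0 (sqrt (1 + b\<^sup>2)))"
    using linear_combination_normal[OF W, of "\<lambda>k. Q i k + b * Q j k"] unfolding s by simp
  moreover have "(\<Sum>k=1..n. (Q i k + b * Q j k) * W k \<omega>) = rotated Q n W i \<omega> + b * rotated Q n W j \<omega>" for \<omega>
    unfolding rotated_def sum_distrib_left sum.distrib[symmetric] by (intro sum.cong refl) (simp add: algebra_simps)
  ultimately show ?thesis by simp
qed

lemma rotated_normal:
  assumes i: "i \<in> {1..n}"
  shows "distributed M lborel (rotated Q n W i) (normal_density 0 1)"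
proof -
  have s: "(\<Sum>k=1..n. (Q i k)\<^sup>2) = 1" using orth[OF i i] by (simp add: power2_eq_square)
  have "distributed M lborel (\<lambda>\<omega>. \<Sum>k=1..n. Q i k * W k \<omega>) (normal_density 0 1)"
    using linear_combination_normal[OF W, of "Q i"] unfolding s by simp
  then show ?thesis by (simp add: rotated_def[abs_def])
qed

text \<open>By the mixed moments, even powers of different coordinates are uncorrelated, so the
  variance of the sum is linear in n and a fixed deviation of the average has probability of order
  1/n.\<close>

lemma even_moment_average_deviation:
  assumes n: "n \<ge> 1"
  shows "prob {\<omega> \<in> space M. \<bar>(1 / real n) * (\<Sum>i=1..n. ((rotated Q n W i \<omega>)\<^sup>2) ^ k) - nmom k\<bar> \<ge> 2} \<le> nmom (2 * k) / real n"
proof -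
  define g where "g i \<omega> = rotated Q n W i \<omega> ^ (2 * k)" for i \<omega>
  define f where "f \<omega> = (\<Sum>i=1..n. g i \<omega>)" for \<omega>
  have [measurable]: "g i \<in> borel_measurable M" for i unfolding g_def[abs_def] by measurable
  have [measurable]: "f \<in> borel_measurable M" unfolding f_def[abs_def] by measurable
  have g1: "has_bochner_integral M (g i) (nmom k)" if "i \<in> {1..n}" for i
    using normal_even_moment[OF rotated_normal[OF that], of k] by (simp add: g_def[abs_def])
  have g2: "has_bochner_integral M (\<lambda>\<omega>. g i \<omega> * g j \<omega>) (if i = j then nmom (2 * k) else (nmom k)\<^sup>2)"
    if "i \<in> {1..n}" "j \<in> {1..n}" for i j
  proof (cases "i = j")
    case True
    have "g i \<omega> * g i \<omega> = rotated Q n W i \<omega> ^ (2 * (2 * k))" for \<omega>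
      by (simp add: g_def flip: power_add)
    then show ?thesis using True normal_even_moment[OF rotated_normal[OF that(1)], of "2 * k"] by simp
  next
    case False
    then show ?thesis
      using mixed_even_moment[OF rotated_pair_normal[OF that False] rotated_normal[OF that(2)], of k]
      by (simp add: g_def)
  qed
  have Ef: "has_bochner_integral M f (real n * nmom k)"
  proof -
    have "has_bochner_integral M f (\<Sum>i=1..n. nmom k)"
      unfolding f_def[abs_def] by (intro has_bochner_integral_sum g1)
    then show ?thesis by simp
  qed
  have Ef2: "has_bochner_integral M (\<lambda>\<omega>. (f \<omega>)\<^sup>2) (\<Sum>i=1..n. \<Sum>j=1..n. if i = j then nmom (2 * k) else (nmom k)\<^sup>2)"
  proof -
    have "(f \<omega>)\<^sup>2 = (\<Sum>i=1..n. \<Sum>j=1..n. g i \<omega> * g j \<omega>)" for \<omega>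
      by (simp add: f_def power2_eq_square sum_product)
    then show ?thesis by (simp only:) (intro has_bochner_integral_sum g2)
  qed
  have "variance f = (\<Sum>i=1..n. \<Sum>j=1..n. if i = j then nmom (2 * k) else (nmom k)\<^sup>2) - (real n * nmom k)\<^sup>2"
    using Ef Ef2 by (subst variance_eq) (auto simp: has_bochner_integral_iff)
  also have "(\<Sum>i=1..n. \<Sum>j=1..n. if i = j then nmom (2 * k) else (nmom k)\<^sup>2)
     = (\<Sum>i=1..n. \<Sum>j=1..n. (nmom k)\<^sup>2 + (if j = i then nmom (2 * k) - (nmom k)\<^sup>2 else 0))"
    by (intro sum.cong) auto
  also have "\<dots> = real n * (real n * (nmom k)\<^sup>2) + real n * (nmom (2 * k) - (nmom k)\<^sup>2)"
    by (simp add: sum.distrib distrib_left)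
  also have "\<dots> - (real n * nmom k)\<^sup>2 \<le> real n * nmom (2 * k)"
    by (simp add: algebra_simps power2_eq_square)
  finally have var: "variance f \<le> real n * nmom (2 * k)" .
  have "prob {\<omega> \<in> space M. \<bar>f \<omega> - expectation f\<bar> \<ge> 2 * real n} \<le> variance f / (2 * real n)\<^sup>2"
    using Ef2 n by (intro Chebyshev_inequality) (auto simp: has_bochner_integral_iff)
  also have "\<dots> \<le> (real n * nmom (2 * k)) / (2 * real n)\<^sup>2" using var by (intro divide_right_mono) auto
  also have "\<dots> \<le> nmom (2 * k) / real n" using n by (simp add: nmom_def field_simps power2_eq_square)
  also have "{\<omega> \<in> space M. \<bar>f \<omega> - expectation f\<bar> \<ge> 2 * real n}
     = {\<omega> \<in> space M. \<bar>(1 / real n) * (\<Sum>i=1..n. ((rotated Q n W i \<omega>)\<^sup>2) ^ k) - nmom k\<bar> \<ge> 2}"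
  proof -
    have "2 * real n \<le> \<bar>F - real n * m\<bar> \<longleftrightarrow> 2 \<le> \<bar>(1 / real n) * F - m\<bar>" for F m :: real
    proof -
      have "(1 / real n) * F - m = (F - real n * m) / real n" using n by (simp add: field_simps)
      then show ?thesis using n by (simp add: le_divide_eq)
    qed
    moreover have "f \<omega> = (\<Sum>i=1..n. ((rotated Q n W i \<omega>)\<^sup>2) ^ k)" for \<omega>
      by (simp add: f_def g_def power_mult)
    ultimately show ?thesis using Ef by (simp add: has_bochner_integral_iff)
  qed
  finally show ?thesis .
qed

text \<open>Hubbard--Stratonovich: with \<open>Q\<close> orthogonal the sum of all \<open>(rotated Q n W i)\<^sup>2\<close> is the sum
  of all \<open>(W k)\<^sup>2\<close>, so a shift by a constant \<open>m\<close> makes all coefficients nonnegative; then each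
  factor \<open>exp (c g\<^sup>2 / 2)\<close> is an integral of \<open>exp (sqrt c g h)\<close> over a standard Gaussian \<open>h\<close>, and
  after exchanging the integrals the exponent is linear in every \<open>W k\<close> up to the shift.\<close>

lemma rotated_mgf:
  assumes orth': "\<And>k l. k \<in> {1..n} \<Longrightarrow> l \<in> {1..n} \<Longrightarrow> (\<Sum>i=1..n. Q i k * Q i l) = (if k = l then 1 else 0)"
    and b: "\<And>i. i \<in> {1..n} \<Longrightarrow> b i < 1"
  shows "(\<integral>\<^sup>+\<omega>. ennreal (exp (\<Sum>i=1..n. b i * (rotated Q n W i \<omega>)\<^sup>2 / 2)) \<partial>M) = ennreal (\<Prod>i=1..n. 1 / sqrt (1 - b i))"
proof -
  \<comment> \<open>Any nonnegative shift that makes all \<open>b i + m\<close> nonnegative would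
    do; it cancels at the end.\<close>
  define m where "m = (\<Sum>i=1..n. \<bar>b i\<bar>)"
  have m0: "m \<ge> 0" by (simp add: m_def sum_nonneg)
  have bm: "b i + m \<ge> 0" if "i \<in> {1..n}" for i
  proof -
    have "\<bar>b i\<bar> \<le> m" unfolding m_def using that by (intro member_le_sum) auto
    then show ?thesis by linarith
  qed
  define r where "r i = sqrt (b i + m)" for i
  have r2: "(r i)\<^sup>2 = b i + m" if "i \<in> {1..n}" for i using bm[OF that] by (simp add: r_def)
  define H where "H = gaussN n (\<lambda>_. 1)"
  interpret H: prob_space H unfolding H_def by (rule prob_space_gaussN)
  have sH: "sets H = sets (Rn n)" unfolding H_def by (rule sets_gaussN)
  interpret MH: pair_sigma_finite M H
    by (intro pair_sigma_finite.intro sigma_finite_measure_axioms H.sigma_finite_measure_axioms)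
  let ?g = "rotated Q n W"
  have sum_sq: "(\<Sum>i=1..n. (?g i \<omega>)\<^sup>2) = (\<Sum>k=1..n. (W k \<omega>)\<^sup>2)" for \<omega>
    using orthonormal_rows_parseval[of n "\<lambda>k i. Q i k" "\<lambda>k. W k \<omega>" "\<lambda>k. W k \<omega>", OF orth']
    by (simp add: rotated_def power2_eq_square mult.commute)
  define V where "V h k = (\<Sum>i=1..n. r i * h i * Q i k)" for h k
  have sum_V: "(\<Sum>k=1..n. (V h k)\<^sup>2) = (\<Sum>i=1..n. (b i + m) * (h i)\<^sup>2)" for h
  proof -
    have "(\<Sum>k=1..n. (V h k)\<^sup>2) = (\<Sum>i=1..n. r i * h i * (r i * h i))"
      unfolding V_def power2_eq_square by (rule orthonormal_rows_parseval[OF orth])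
    also have "\<dots> = (\<Sum>i=1..n. (b i + m) * (h i)\<^sup>2)"
      using r2 by (intro sum.cong refl) (simp add: power2_eq_square mult_ac)
    finally show ?thesis .
  qed
  have prod_exp: "(\<Prod>i=1..n. ennreal (exp (f i))) = ennreal (exp (\<Sum>i=1..n. f i))" for f :: "nat \<Rightarrow> real"
    by (simp add: exp_sum prod_ennreal)
  have linear: "(\<Sum>i=1..n. r i * ?g i \<omega> * h i) = (\<Sum>k=1..n. V h k * W k \<omega>)" for \<omega> h
    unfolding rotated_def V_def sum_distrib_left sum_distrib_right by (subst sum.swap) (simp add: mult_ac)
  define F where "F \<omega> h = exp ((\<Sum>i=1..n. r i * ?g i \<omega> * h i) - m * (\<Sum>k=1..n. (W k \<omega>)\<^sup>2) / 2)" for \<omega> h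
  have F_meas: "(\<lambda>(\<omega>, h). ennreal (F \<omega> h)) \<in> borel_measurable (M \<Otimes>\<^sub>M H)"
  proof -
    have 1: "(\<lambda>z. snd z i) \<in> borel_measurable (M \<Otimes>\<^sub>M H)" if "i \<in> {1..n}" for i
      using measurable_snd_coord[OF that, of M] by (simp add: measurable_cong_sets[OF sets_pair_measure_cong[OF refl sH] refl])
    have 2: "(\<lambda>z. W k (fst z)) \<in> borel_measurable (M \<Otimes>\<^sub>M H)" if "k \<in> {1..n}" for k
      by (rule measurable_compose[OF measurable_fst W_measurable[OF that]])
    have 3: "(\<lambda>z. ?g i (fst z)) \<in> borel_measurable (M \<Otimes>\<^sub>M H)" for i
      by (rule measurable_compose[OF measurable_fst rotated_measurable])
    have "(\<lambda>z. \<Sum>i=1..n. r i * ?g i (fst z) * snd z i) \<in> borel_measurable (M \<Otimes>\<^sub>M H)"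
      by (intro borel_measurable_sum borel_measurable_times borel_measurable_const 1 3)
    moreover have "(\<lambda>z. \<Sum>k=1..n. (W k (fst z))\<^sup>2) \<in> borel_measurable (M \<Otimes>\<^sub>M H)"
      by (intro borel_measurable_sum borel_measurable_power 2)
    ultimately show ?thesis unfolding F_def case_prod_beta' by measurable
  qed
  have "(\<integral>\<^sup>+\<omega>. ennreal (exp (\<Sum>i=1..n. b i * (?g i \<omega>)\<^sup>2 / 2)) \<partial>M) = (\<integral>\<^sup>+\<omega>. \<integral>\<^sup>+h. ennreal (F \<omega> h) \<partial>H \<partial>M)"
  proof (rule nn_integral_cong)
    fix \<omega>
    define c where "c = exp (- (m * (\<Sum>k=1..n. (W k \<omega>)\<^sup>2) / 2))"
    have "(\<integral>\<^sup>+h. ennreal (F \<omega> h) \<partial>H) = (\<integral>\<^sup>+h. ennreal c * (\<Prod>i=1..n. ennreal (exp (r i * ?g i \<omega> * h i))) \<partial>H)"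
    proof (intro nn_integral_cong)
      fix h
      have "F \<omega> h = c * exp (\<Sum>i=1..n. r i * ?g i \<omega> * h i)"
        unfolding F_def c_def exp_add[symmetric] by simp
      then show "ennreal (F \<omega> h) = ennreal c * (\<Prod>i=1..n. ennreal (exp (r i * ?g i \<omega> * h i)))"
        unfolding prod_exp by (simp add: c_def ennreal_mult)
    qed
    also have "\<dots> = ennreal c * (\<integral>\<^sup>+h. (\<Prod>i=1..n. ennreal (exp (r i * ?g i \<omega> * h i))) \<partial>H)"
    proof (rule nn_integral_cmult)
      have "(\<lambda>h. \<Prod>i=1..n. ennreal (exp (r i * ?g i \<omega> * h i))) \<in> borel_measurable (Rn n)"
      proof (intro borel_measurable_prod_ennreal)
        fix i assume i: "i \<in> {1..n}"
        note [measurable] = measurable_coord_Rn[OF i]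
        show "(\<lambda>h. ennreal (exp (r i * ?g i \<omega> * h i))) \<in> borel_measurable (Rn n)" by measurable
      qed
      then show "(\<lambda>h. \<Prod>i=1..n. ennreal (exp (r i * ?g i \<omega> * h i))) \<in> borel_measurable H"
        by (simp add: measurable_cong_sets[OF sH refl])
    qed
    also have "(\<integral>\<^sup>+h. (\<Prod>i=1..n. ennreal (exp (r i * ?g i \<omega> * h i))) \<partial>H) = (\<Prod>i=1..n. \<integral>\<^sup>+h. ennreal (exp (r i * ?g i \<omega> * h)) \<partial>gauss1 1)"
      unfolding H_def by (rule nn_integral_gaussN_prod) measurable
    also have "\<dots> = (\<Prod>i=1..n. ennreal (exp ((b i + m) * (?g i \<omega>)\<^sup>2 / 2)))"
    proof (intro prod.cong refl)
      fix i assume i: "i \<in> {1..n}"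
      show "(\<integral>\<^sup>+h. ennreal (exp (r i * ?g i \<omega> * h)) \<partial>gauss1 1) = ennreal (exp ((b i + m) * (?g i \<omega>)\<^sup>2 / 2))"
        using nn_integral_gauss1_exp_quadratic[of 0 "r i * ?g i \<omega>"] by (simp add: power_mult_distrib r2[OF i])
    qed
    also have "ennreal c * \<dots> = ennreal (exp (- (m * (\<Sum>i=1..n. (?g i \<omega>)\<^sup>2) / 2) + (\<Sum>i=1..n. (b i + m) * (?g i \<omega>)\<^sup>2 / 2)))"
      unfolding prod_exp c_def sum_sq[symmetric] exp_add by (simp flip: ennreal_mult)
    also have "- (m * (\<Sum>i=1..n. (?g i \<omega>)\<^sup>2) / 2) + (\<Sum>i=1..n. (b i + m) * (?g i \<omega>)\<^sup>2 / 2) = (\<Sum>i=1..n. b i * (?g i \<omega>)\<^sup>2 / 2)"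
      by (simp add: sum_distrib_left sum_divide_distrib distrib_right add_divide_distrib sum.distrib)
    finally show "ennreal (exp (\<Sum>i=1..n. b i * (?g i \<omega>)\<^sup>2 / 2)) = (\<integral>\<^sup>+h. ennreal (F \<omega> h) \<partial>H)" ..
  qed
  also have "\<dots> = (\<integral>\<^sup>+h. \<integral>\<^sup>+\<omega>. ennreal (F \<omega> h) \<partial>M \<partial>H)"
    by (rule MH.Fubini'[symmetric, OF F_meas])
  \<comment> \<open>For fixed \<open>h\<close> the noise variables factorise. The resulting exponent
    involves the sum of the \<open>(V h k)^2\<close>, which orthonormality of the rows turns back
    into a diagonal form in \<open>h\<close>.\<close>
  also have "\<dots> = (\<integral>\<^sup>+h. (\<Prod>i=1..n. ennreal (exp ((b i + m) / (1 + m) * (h i)\<^sup>2 / 2) / sqrt (1 + m))) \<partial>H)"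
  proof (rule nn_integral_cong)
    fix h
    have "(\<integral>\<^sup>+\<omega>. ennreal (F \<omega> h) \<partial>M) = (\<integral>\<^sup>+\<omega>. (\<Prod>k=1..n. ennreal (exp (V h k * W k \<omega> - m * (W k \<omega>)\<^sup>2 / 2))) \<partial>M)"
      unfolding prod_exp F_def linear by (simp add: sum_subtractf sum_distrib_left sum_divide_distrib)
    also have "\<dots> = (\<Prod>k=1..n. \<integral>\<^sup>+\<omega>. ennreal (exp (V h k * W k \<omega> - m * (W k \<omega>)\<^sup>2 / 2)) \<partial>M)"
    proof (rule indep_vars_nn_integral)
      have "indep_vars (\<lambda>_. borel) W {1..n}" using W by (simp add: std_gauss_family_def)
      from indep_vars_compose2[OF this, of "\<lambda>k x. ennreal (exp (V h k * x - m * x\<^sup>2 / 2))" "\<lambda>_. borel"]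
      show "indep_vars (\<lambda>_. borel) (\<lambda>k \<omega>. ennreal (exp (V h k * W k \<omega> - m * (W k \<omega>)\<^sup>2 / 2))) {1..n}" by simp
    qed auto
    also have "\<dots> = (\<Prod>k=1..n. ennreal (exp ((V h k)\<^sup>2 / (2 * (1 + m))) / sqrt (1 + m)))"
    proof (intro prod.cong refl)
      fix k assume "k \<in> {1..n}"
      then have "distributed M lborel (W k) (\<lambda>x. ennreal (std_normal_density x))" using W by (simp add: std_gauss_family_def)
      from distributed_nn_integral[OF this, of "\<lambda>x. ennreal (exp (V h k * x - m * x\<^sup>2 / 2))"]
      show "(\<integral>\<^sup>+\<omega>. ennreal (exp (V h k * W k \<omega> - m * (W k \<omega>)\<^sup>2 / 2)) \<partial>M) = ennreal (exp ((V h k)\<^sup>2 / (2 * (1 + m))) / sqrt (1 + m))"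
        using nn_integral_std_normal_exp_quadratic[of m "V h k"] m0 by simp
    qed
    also have "\<dots> = ennreal (exp (\<Sum>k=1..n. (V h k)\<^sup>2 / (2 * (1 + m))) * (1 / sqrt (1 + m)) ^ n)"
      using m0 by (subst prod_ennreal) (auto simp: exp_sum prod_dividef power_divide)
    also have "(\<Sum>k=1..n. (V h k)\<^sup>2 / (2 * (1 + m))) = (\<Sum>i=1..n. (b i + m) / (1 + m) * (h i)\<^sup>2 / 2)"
      unfolding sum_divide_distrib[symmetric] sum_V by (simp add: sum_divide_distrib mult.commute)
    also have "ennreal (exp (\<Sum>i=1..n. (b i + m) / (1 + m) * (h i)\<^sup>2 / 2) * (1 / sqrt (1 + m)) ^ n)
       = (\<Prod>i=1..n. ennreal (exp ((b i + m) / (1 + m) * (h i)\<^sup>2 / 2) / sqrt (1 + m)))"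
      using m0 by (subst prod_ennreal) (auto simp: exp_sum prod_dividef power_divide)
    finally show "(\<integral>\<^sup>+\<omega>. ennreal (F \<omega> h) \<partial>M) = (\<Prod>i=1..n. ennreal (exp ((b i + m) / (1 + m) * (h i)\<^sup>2 / 2) / sqrt (1 + m)))" .
  qed
  also have "\<dots> = (\<Prod>i=1..n. \<integral>\<^sup>+h. ennreal (exp ((b i + m) / (1 + m) * h\<^sup>2 / 2) / sqrt (1 + m)) \<partial>gauss1 1)"
    unfolding H_def by (rule nn_integral_gaussN_prod[of n "\<lambda>i h. ennreal (exp ((b i + m) / (1 + m) * h\<^sup>2 / 2) / sqrt (1 + m))"]) measurable
  also have "\<dots> = (\<Prod>i=1..n. ennreal (1 / sqrt (1 - b i)))"
  proof (intro prod.cong refl)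
    fix i assume i: "i \<in> {1..n}"
    \<comment> \<open>The factors \<open>sqrt (1 + m)\<close> cancel since
      \<open>1 + t = (1 - b i) / (1 + m)\<close>, which is positive by
      \<open>b i < 1\<close>.\<close>
    define t where "t = - ((b i + m) / (1 + m))"
    have m1: "1 + m > 0" using m0 by simp
    have t1: "1 + t = (1 - b i) / (1 + m)" using m1 by (simp add: t_def field_simps)
    then have "1 + t > 0" using m1 b[OF i] by simp
    have "(\<integral>\<^sup>+h. ennreal (exp ((b i + m) / (1 + m) * h\<^sup>2 / 2) / sqrt (1 + m)) \<partial>gauss1 1)
       = (\<integral>\<^sup>+h. ennreal (1 / sqrt (1 + m)) * ennreal (exp (0 * h - t * h\<^sup>2 / 2)) \<partial>gauss1 1)"
    proof (intro nn_integral_cong)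
      fix h
      have "exp ((b i + m) / (1 + m) * h\<^sup>2 / 2) / sqrt (1 + m) = 1 / sqrt (1 + m) * exp (0 * h - t * h\<^sup>2 / 2)"
        by (simp add: t_def)
      then show "ennreal (exp ((b i + m) / (1 + m) * h\<^sup>2 / 2) / sqrt (1 + m)) = ennreal (1 / sqrt (1 + m)) * ennreal (exp (0 * h - t * h\<^sup>2 / 2))"
        using m1 by (simp only:) (rule ennreal_mult, auto)
    qed
    also have "\<dots> = ennreal (1 / sqrt (1 + m)) * (\<integral>\<^sup>+h. ennreal (exp (0 * h - t * h\<^sup>2 / 2)) \<partial>gauss1 1)"
    proof (rule nn_integral_cmult)
      show "(\<lambda>h. ennreal (exp (0 * h - t * h\<^sup>2 / 2))) \<in> borel_measurable (gauss1 1)"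
        unfolding measurable_cong_sets[OF sets_gauss1 refl] by measurable
    qed
    also have "\<dots> = ennreal (1 / sqrt (1 + m)) * ennreal (1 / sqrt (1 + t))"
      using nn_integral_gauss1_exp_quadratic[of t 0] \<open>1 + t > 0\<close> by simp
    also have "\<dots> = ennreal (1 / sqrt (1 + m) * (1 / sqrt (1 + t)))"
      using m1 \<open>1 + t > 0\<close> by (simp flip: ennreal_mult)
    also have "1 / sqrt (1 + m) * (1 / sqrt (1 + t)) = 1 / sqrt (1 - b i)"
      unfolding t1 using m1 by (simp add: real_sqrt_divide)
    finally show "(\<integral>\<^sup>+h. ennreal (exp ((b i + m) / (1 + m) * h\<^sup>2 / 2) / sqrt (1 + m)) \<partial>gauss1 1) = ennreal (1 / sqrt (1 - b i))" .
  qed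
  also have "\<dots> = ennreal (\<Prod>i=1..n. 1 / sqrt (1 - b i))"
    using b by (intro prod_ennreal) (auto simp: less_imp_le)
  finally show ?thesis .
qed

text \<open>The Chernoff parameter \<open>t\<close> minimises
  \<open>- t * r + 4 * n * t^2 * B^2\<close>; the restriction on \<open>r\<close> keeps
  \<open>t * B\<close> at most \<open>1 / 4\<close>, the range of the chi-square bound.\<close>

lemma rotated_square_upper_tail:
  assumes orth': "\<And>k l. k \<in> {1..n} \<Longrightarrow> l \<in> {1..n} \<Longrightarrow> (\<Sum>i=1..n. Q i k * Q i l) = (if k = l then 1 else 0)"
    and c: "\<And>i. i \<in> {1..n} \<Longrightarrow> \<bar>c i\<bar> \<le> B" and B: "B > 0" and r: "0 < r" "r \<le> 2 * real n * B" and n: "n \<ge> 1"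
  shows "prob {\<omega> \<in> space M. (\<Sum>i=1..n. c i * ((rotated Q n W i \<omega>)\<^sup>2 - 1)) \<ge> r} \<le> exp (- (r\<^sup>2 / (16 * real n * B\<^sup>2)))"
proof -
  let ?g = "rotated Q n W"
  define t where "t = r / (8 * real n * B\<^sup>2)"
  have t: "t > 0" using r B n by (simp add: t_def)
  have tB: "t * B \<le> 1 / 4" using r B n by (simp add: t_def field_simps power2_eq_square)
  have tc: "\<bar>t * c i\<bar> \<le> 1 / 4" if "i \<in> {1..n}" for i
  proof -
    have "t * \<bar>c i\<bar> \<le> t * B" using c[OF that] t by (intro mult_left_mono) auto
    moreover have "\<bar>t * c i\<bar> = t * \<bar>c i\<bar>" using t by (simp add: abs_mult)
    ultimately show ?thesis using tB by linarith
  qed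
  define f where "f \<omega> = (\<Sum>i=1..n. c i * ((?g i \<omega>)\<^sup>2 - 1))" for \<omega>
  have [measurable]: "f \<in> borel_measurable M" unfolding f_def[abs_def] by measurable
  have "emeasure M {\<omega> \<in> space M. f \<omega> \<ge> r} \<le> ennreal (exp (- t * r)) * (\<integral>\<^sup>+\<omega>. ennreal (exp (t * f \<omega>)) * indicator (space M) \<omega> \<partial>M)"
    by (rule Chernoff_ineq_nn_integral_ge[OF t]) auto
  also have "(\<integral>\<^sup>+\<omega>. ennreal (exp (t * f \<omega>)) * indicator (space M) \<omega> \<partial>M)
     = (\<integral>\<^sup>+\<omega>. ennreal (exp (- (\<Sum>i=1..n. t * c i))) * ennreal (exp (\<Sum>i=1..n. (2 * (t * c i)) * (?g i \<omega>)\<^sup>2 / 2)) \<partial>M)"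
  proof (intro nn_integral_cong)
    fix \<omega> assume w: "\<omega> \<in> space M"
    have "t * f \<omega> = - (\<Sum>i=1..n. t * c i) + (\<Sum>i=1..n. (2 * (t * c i)) * (?g i \<omega>)\<^sup>2 / 2)"
      unfolding f_def sum_distrib_left sum_negf[symmetric] sum.distrib[symmetric]
      by (intro sum.cong refl) (simp add: algebra_simps)
    then show "ennreal (exp (t * f \<omega>)) * indicator (space M) \<omega>
      = ennreal (exp (- (\<Sum>i=1..n. t * c i))) * ennreal (exp (\<Sum>i=1..n. (2 * (t * c i)) * (?g i \<omega>)\<^sup>2 / 2))"
      using w by (simp only: exp_add) (simp add: ennreal_mult)
  qed
  also have "\<dots> = ennreal (exp (- (\<Sum>i=1..n. t * c i))) * (\<integral>\<^sup>+\<omega>. ennreal (exp (\<Sum>i=1..n. (2 * (t * c i)) * (?g i \<omega>)\<^sup>2 / 2)) \<partial>M)"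
    by (rule nn_integral_cmult) measurable
  also have "(\<integral>\<^sup>+\<omega>. ennreal (exp (\<Sum>i=1..n. (2 * (t * c i)) * (?g i \<omega>)\<^sup>2 / 2)) \<partial>M) = ennreal (\<Prod>i=1..n. 1 / sqrt (1 - 2 * (t * c i)))"
    by (rule rotated_mgf[OF orth']) (use tc in \<open>fastforce simp: abs_le_iff\<close>)+
  also have "ennreal (exp (- (\<Sum>i=1..n. t * c i))) * \<dots> = ennreal (\<Prod>i=1..n. exp (- (t * c i)) * (1 / sqrt (1 - 2 * (t * c i))))"
  proof -
    have "exp (- (\<Sum>i=1..n. t * c i)) * (\<Prod>i=1..n. 1 / sqrt (1 - 2 * (t * c i))) = (\<Prod>i=1..n. exp (- (t * c i)) * (1 / sqrt (1 - 2 * (t * c i))))"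
      unfolding prod.distrib by (simp add: sum_negf[symmetric] exp_sum)
    then show ?thesis by (simp only: ennreal_mult'[symmetric, OF exp_ge_zero])
  qed
  also have "\<dots> \<le> ennreal (exp (real n * (4 * (t * B)\<^sup>2)))"
  proof (rule ennreal_leI)
    have "(\<Prod>i=1..n. exp (- (t * c i)) * (1 / sqrt (1 - 2 * (t * c i)))) \<le> (\<Prod>i=1..n. exp (4 * (t * B)\<^sup>2))"
    proof (rule prod_mono, intro conjI)
      fix i assume i: "i \<in> {1..n}"
      have "1 - 2 * (t * c i) \<ge> 0" using tc[OF i] by (simp add: abs_le_iff)
      then show "0 \<le> exp (- (t * c i)) * (1 / sqrt (1 - 2 * (t * c i)))" by simp
      have "(t * c i)\<^sup>2 \<le> (t * B)\<^sup>2"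
        using c[OF i] t B by (intro abs_le_square_iff[THEN iffD1]) (simp add: abs_mult)
      then show "exp (- (t * c i)) * (1 / sqrt (1 - 2 * (t * c i))) \<le> exp (4 * (t * B)\<^sup>2)"
        using chi_square_mgf_bound[OF tc[OF i]] by (smt (verit) exp_le_cancel_iff)
    qed
    also have "\<dots> = exp (real n * (4 * (t * B)\<^sup>2))" by (simp add: exp_of_nat_mult)
    finally show "(\<Prod>i=1..n. exp (- (t * c i)) * (1 / sqrt (1 - 2 * (t * c i)))) \<le> exp (real n * (4 * (t * B)\<^sup>2))" .
  qed
  finally have "emeasure M {\<omega> \<in> space M. f \<omega> \<ge> r} \<le> ennreal (exp (- t * r)) * ennreal (exp (real n * (4 * (t * B)\<^sup>2)))"
    by (simp add: mult_left_mono)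
  also have "\<dots> = ennreal (exp (- t * r + real n * (4 * (t * B)\<^sup>2)))"
    unfolding exp_add by (rule ennreal_mult[symmetric]) auto
  also have "- t * r + real n * (4 * (t * B)\<^sup>2) = - (r\<^sup>2 / (16 * real n * B\<^sup>2))"
    using B n by (simp add: t_def field_simps power2_eq_square)
  finally show ?thesis by (simp add: f_def emeasure_eq_measure ennreal_le_iff)
qed

lemma rotated_square_tail:
  assumes orth': "\<And>k l. k \<in> {1..n} \<Longrightarrow> l \<in> {1..n} \<Longrightarrow> (\<Sum>i=1..n. Q i k * Q i l) = (if k = l then 1 else 0)"
    and c: "\<And>i. i \<in> {1..n} \<Longrightarrow> \<bar>c i\<bar> \<le> B" and B: "B > 0" and r: "0 < r" "r \<le> 2 * real n * B" and n: "n \<ge> 1"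
  shows "prob {\<omega> \<in> space M. \<bar>\<Sum>i=1..n. c i * ((rotated Q n W i \<omega>)\<^sup>2 - 1)\<bar> \<ge> r} \<le> 2 * exp (- (r\<^sup>2 / (16 * real n * B\<^sup>2)))"
proof -
  let ?f = "\<lambda>c \<omega>. \<Sum>i=1..n. c i * ((rotated Q n W i \<omega>)\<^sup>2 - 1)"
  have m[measurable]: "?f c \<in> borel_measurable M" for c by measurable
  have neg: "?f (\<lambda>i. - c i) \<omega> = - ?f c \<omega>" for \<omega> by (simp add: sum_negf)
  have "{\<omega> \<in> space M. \<bar>?f c \<omega>\<bar> \<ge> r} = {\<omega> \<in> space M. ?f c \<omega> \<ge> r} \<union> {\<omega> \<in> space M. ?f (\<lambda>i. - c i) \<omega> \<ge> r}"
    unfolding neg by (auto simp: abs_if)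
  then have "prob {\<omega> \<in> space M. \<bar>?f c \<omega>\<bar> \<ge> r} \<le> prob {\<omega> \<in> space M. ?f c \<omega> \<ge> r} + prob {\<omega> \<in> space M. ?f (\<lambda>i. - c i) \<omega> \<ge> r}"
    by (simp only:) (rule measure_Un_le, measurable)
  also have "\<dots> \<le> exp (- (r\<^sup>2 / (16 * real n * B\<^sup>2))) + exp (- (r\<^sup>2 / (16 * real n * B\<^sup>2)))"
    using c by (intro add_mono rotated_square_upper_tail[OF orth' _ B r n]) auto
  finally show ?thesis by simp
qed

end

end

text \<open>The error is the sum of \<open>U i * Z (Suc i)\<close> over the sum of
  \<open>(U i)^2\<close>. Cauchy-Schwarz leaves the norm of the noise, at most n, over the root of
  the sum of squares, of which only the last term is kept.\<close>

lemma aML_Uproc: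
  fixes Z :: "nat \<Rightarrow> 'a \<Rightarrow> real"
  assumes n: "n \<ge> 2" and Zb: "(\<Sum>k=1..n. (Z k \<omega>)\<^sup>2) \<le> (real n)\<^sup>2" and U: "\<bar>Uproc a Z (n - 1) \<omega>\<bar> \<ge> l" and l: "l > 0"
  shows "\<bar>aML n (\<lambda>i. Uproc a Z i \<omega>) - a\<bar> \<le> real n / l"
proof -
  let ?u = "\<lambda>i. Uproc a Z i \<omega>" and ?I = "{1..n - 1}"
  define S where "S = (\<Sum>i\<in>?I. (?u i)\<^sup>2)"
  define T where "T = (\<Sum>i\<in>?I. ?u i * Z (Suc i) \<omega>)"
  have lS: "l\<^sup>2 \<le> S"
  proof -
    have "l\<^sup>2 \<le> \<bar>?u (n - 1)\<bar>\<^sup>2" using U l by (intro power_mono) auto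
    also have "\<dots> \<le> S" unfolding S_def power2_abs using n by (intro member_le_sum) auto
    finally show ?thesis .
  qed
  have S0: "S > 0" using lS l by (smt (verit) zero_less_power)
  have "(\<Sum>i\<in>?I. ?u i * ?u (i + 1)) = a * S + T"
    unfolding S_def T_def sum_distrib_left sum.distrib[symmetric]
    by (intro sum.cong refl) (simp add: power2_eq_square algebra_simps)
  then have e: "aML n ?u - a = T / S"
    using S0 unfolding aML_def S_def[symmetric] by (simp add: add_divide_distrib)
  have "T\<^sup>2 \<le> S * (\<Sum>i\<in>?I. (Z (Suc i) \<omega>)\<^sup>2)"
    unfolding T_def S_def by (rule Cauchy_Schwarz_ineq_sum)
  also have "(\<Sum>i\<in>?I. (Z (Suc i) \<omega>)\<^sup>2) = (\<Sum>k\<in>Suc ` ?I. (Z k \<omega>)\<^sup>2)" by (subst sum.reindex) (auto simp: o_def)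
  also have "\<dots> \<le> (\<Sum>k=1..n. (Z k \<omega>)\<^sup>2)" using n by (intro sum_mono2) auto
  also note Zb
  finally have "T\<^sup>2 \<le> S * (real n)\<^sup>2" using S0 by (simp add: mult_left_mono)
  then have "(T / S)\<^sup>2 \<le> (real n)\<^sup>2 / S" using S0 by (simp add: power_divide field_simps power2_eq_square)
  also have "\<dots> \<le> (real n)\<^sup>2 / l\<^sup>2" using lS l S0 by (intro divide_left_mono) auto
  finally have "(T / S)\<^sup>2 \<le> (real n / l)\<^sup>2" by (simp add: power_divide)
  then show ?thesis unfolding e using l by (simp add: abs_le_square_iff[symmetric])
qed

lemma Uproc_eq_sum: "Uproc a Z m \<omega> = (\<Sum>k=1..m. a ^ (m - k) * Z k \<omega>)"
proof (induction m)
  case (Suc m)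
  have "(\<Sum>k=1..Suc m. a ^ (Suc m - k) * Z k \<omega>) = (\<Sum>k=1..m. a ^ (Suc m - k) * Z k \<omega>) + Z (Suc m) \<omega>" by simp
  also have "(\<Sum>k=1..m. a ^ (Suc m - k) * Z k \<omega>) = a * (\<Sum>k=1..m. a ^ (m - k) * Z k \<omega>)"
    unfolding sum_distrib_left by (intro sum.cong refl) (simp add: Suc_diff_le)
  finally show ?case using Suc by simp
qed simp

context prob_space
begin

text \<open>The first innovation enters with coefficient \<open>a ^ (m - 1)\<close>, which bounds
  the standard deviation from below.\<close>

lemma Uproc_small_ball:
  assumes W: "std_gauss_family W n" and s: "s > 0" and a: "a > 1" and m: "1 \<le> m" "m \<le> n" and e: "e \<ge> 0"
  shows "prob {\<omega> \<in> space M. \<bar>Uproc a (\<lambda>k \<omega>. s * W k \<omega>) m \<omega>\<bar> < s * a ^ (m - 1) * e} \<le> e"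
proof -
  have W': "std_gauss_family W m"
    using W m by (auto simp: std_gauss_family_def intro: indep_vars_subset)
  define v where "v = (\<Sum>k=1..m. (a ^ (m - k) * s)\<^sup>2)"
  have v: "(s * a ^ (m - 1))\<^sup>2 \<le> v"
  proof -
    have "(a ^ (m - 1) * s)\<^sup>2 \<le> v" unfolding v_def using m by (intro member_le_sum[of 1]) auto
    then show ?thesis by (simp add: mult.commute)
  qed
  have sa: "s * a ^ (m - 1) > 0" using s a by simp
  then have "0 < (s * a ^ (m - 1))\<^sup>2" by (rule zero_less_power)
  with v have v0: "v > 0" by linarith
  have sv: "s * a ^ (m - 1) \<le> sqrt v" using v sa by (simp add: real_le_rsqrt)
  have "distributed M lborel (\<lambda>\<omega>. \<Sum>k=1..m. (a ^ (m - k) * s) * W k \<omega>) (normal_density 0 (sqrt v))"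
    using linear_combination_normal[OF W', of "\<lambda>k. a ^ (m - k) * s"] v0 unfolding v_def by blast
  from normal_small_ball[OF this, of "s * a ^ (m - 1) * e"]
  have "prob {\<omega> \<in> space M. \<bar>\<Sum>k=1..m. (a ^ (m - k) * s) * W k \<omega>\<bar> < s * a ^ (m - 1) * e} \<le> s * a ^ (m - 1) * e / sqrt v"
    using v0 sa e by simp
  also have "\<dots> \<le> e" using sv sa e v0 by (simp add: divide_le_eq mult.commute[of _ e] mult_left_mono)
  finally show ?thesis unfolding Uproc_eq_sum by (simp add: mult.assoc)
qed

text \<open>The generous threshold \<open>n^2\<close> for a quantity of mean \<open>n * s^2\<close>
  makes the first moment enough for order 1/n; the exponential growth of the process can afford
  it.\<close>

lemma sum_squares_Markov:
  assumes W: "std_gauss_family W n" and n: "n \<ge> 1"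
  shows "prob {\<omega> \<in> space M. (real n)\<^sup>2 < (\<Sum>k=1..n. (s * W k \<omega>)\<^sup>2)} \<le> s\<^sup>2 / real n"
proof -
  define f where "f \<omega> = (\<Sum>k=1..n. (s * W k \<omega>)\<^sup>2)" for \<omega>
  have Wm: "k \<in> {1..n} \<Longrightarrow> W k \<in> borel_measurable M" for k using W by (rule std_gauss_measurable)
  have "has_bochner_integral M f (\<Sum>k=1..n. s\<^sup>2 * 1)"
    unfolding f_def[abs_def] power_mult_distrib
  proof (intro has_bochner_integral_sum has_bochner_integral_mult_right)
    fix k assume "k \<in> {1..n}"
    then have "distributed M lborel (W k) (normal_density 0 1)" using W by (simp add: std_gauss_family_def)
    from normal_even_moment[OF this, of 1] show "has_bochner_integral M (\<lambda>\<omega>. (W k \<omega>)\<^sup>2) 1"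
      by (simp add: nmom_def)
  qed
  then have f: "integrable M f" "expectation f = real n * s\<^sup>2" by (auto simp: has_bochner_integral_iff)
  have f0: "0 \<le> f \<omega>" for \<omega> by (simp add: f_def sum_nonneg)
  have [measurable]: "f \<in> borel_measurable M" using f by auto
  have "prob {\<omega> \<in> space M. (real n)\<^sup>2 < f \<omega>} \<le> prob {\<omega> \<in> space M. f \<omega> \<ge> (real n)\<^sup>2}"
    by (intro finite_measure_mono) auto
  also have "\<dots> \<le> expectation f / (real n)\<^sup>2"
    using f f0 n by (intro integral_Markov_inequality_measure[where A = "space M"]) auto
  also have "\<dots> = s\<^sup>2 / real n" using n by (simp add: f power2_eq_square)
  finally show ?thesis by (simp add: f_def)
qed

end

section \<open>The typical set\<close>

lemma cdist_scaled_diff: "cdist k v (s * y) - cdist k v s = s / (1 + k * v)\<^sup>2 * (y - 1)"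
  by (simp add: cdist_def diff_divide_distrib[symmetric] algebra_simps)

lemma prob_ge_one_minus:
  assumes "prob_space M" and A: "A \<in> sets M" and B: "finite J" "\<And>j. j \<in> J \<Longrightarrow> B j \<in> sets M"
    and sub: "space M - A \<subseteq> (\<Union>j\<in>J. B j)" and le: "(\<Sum>j\<in>J. measure M (B j)) \<le> c"
  shows "measure M A \<ge> 1 - c"
proof -
  interpret prob_space M by fact
  have "prob (space M - A) \<le> prob (\<Union>j\<in>J. B j)"
    using sub B by (intro finite_measure_mono) auto
  also have "\<dots> \<le> (\<Sum>j\<in>J. prob (B j))"
    using B by (intro measure_UNION_le) auto
  finally show ?thesis using prob_compl[OF A] le by linarith
qed

context rd_setup
begin

text \<open>The multiplier as a function of the data; \<open>THE\<close> is justified only where the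
  estimate is close to \<open>a\<close>.\<close>

definition kap :: "nat \<Rightarrow> (nat \<Rightarrow> real) \<Rightarrow> real" where
  "kap n u = (THE k. 0 < k \<and> ehat n k u = d)"

definition k0 :: real where "k0 = 1 / (2 * Msup)"

lemma k0_pos: "k0 > 0" using Msup_pos by (simp add: k0_def)

definition regime :: "nat \<Rightarrow> real \<Rightarrow> bool" where
  "regime n e \<longleftrightarrow> large n \<and> 1 / real n \<le> e \<and> e \<le> 1 \<and> e \<le> (a - 1) / 2 \<and> e \<le> a\<^sup>2 - a \<and>
     Ckap * e \<le> 1 / (2 * Msup) \<and> Ckap * e \<le> 1 / d"

text \<open>The last claim rewrites sublevel sets of the implicitly defined multiplier as conditions
  on the explicit \<open>ehat\<close>; it is what makes \<open>kap\<close> measurable.\<close>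

lemma kap_props:
  assumes f: "regime n e" and u: "\<bar>aML n u - a\<bar> \<le> e"
  shows "k0 \<le> kap n u" "\<bar>kap n u - 1 / \<theta> n\<bar> \<le> Ckap * e" "ehat n (kap n u) u = d"
    and "0 < c \<Longrightarrow> kap n u \<le> c \<longleftrightarrow> ehat n c u \<le> d"
proof -
  have e: "1 / real n \<le> e" "e \<le> 1" "e \<le> (a - 1) / 2" "e \<le> a\<^sup>2 - a" and l: "large n"
    and e': "Ckap * e \<le> 1 / (2 * Msup)" "Ckap * e \<le> 1 / d" using f by (auto simp: regime_def)
  obtain k where k: "k0 \<le> k" "\<bar>k - 1 / \<theta> n\<bar> \<le> Ckap * e" "ehat n k u = d"
    using ehat_root_exists[OF l e e' u] by (auto simp: k0_def)
  have kpos: "0 < k" using k k0_pos by linarith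
  have "kap n u = k"
    unfolding kap_def
  proof (rule the_equality)
    show "0 < k \<and> ehat n k u = d" using k kpos by simp
    fix k' assume "0 < k' \<and> ehat n k' u = d"
    then show "k' = k"
      using ehat_strict_antimono[OF l e u, of k k'] ehat_strict_antimono[OF l e u, of k' k] k kpos
      by (cases k k' rule: linorder_cases) auto
  qed
  with k show 1: "k0 \<le> kap n u" "\<bar>kap n u - 1 / \<theta> n\<bar> \<le> Ckap * e" "ehat n (kap n u) u = d" by auto
  show "kap n u \<le> c \<longleftrightarrow> ehat n c u \<le> d" if "0 < c"
    using ehat_strict_antimono[OF l e u, of "kap n u" c] ehat_strict_antimono[OF l e u, of c "kap n u"] 1 that k0_pos
    by (cases c "kap n u" rule: linorder_cases) auto
qed

lemma mfun_kap:
  assumes f: "regime n e" and u: "\<bar>aML n u - a\<bar> \<le> e" and i: "i \<in> {1..n}"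
  shows "mfun a \<sigma>2 d n u i = cdist (kap n u) (\<nu> n i) ((xvec a n u i)\<^sup>2)"
proof -
  have e: "1 / real n \<le> e" "e \<le> 1" "e \<le> (a - 1) / 2" "e \<le> a\<^sup>2 - a" and l: "large n"
    using f by (auto simp: regime_def)
  have k: "kap n u > 0" using kap_props(1)[OF f u] k0_pos by linarith
  have n: "n \<ge> 1" using n2'[OF l] by simp
  show ?thesis unfolding cdist_def
    using kap_props(3)[OF f u] i
    by (intro mfun_eq[OF n k sighat_pos[OF l e u] nu_nonneg[OF l]]) (simp_all add: ehat_def cdist_def)
qed

definition Clip :: real where "Clip = 2 * (1 / k0\<^sup>2 + Msup / k0)"

text \<open>The 3 bounds the average normalised square, whose deviation from 1 is at most 2 by the
  moment condition of order 1. \<open>Ckap\<close> is the multiplier error and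
  \<open>4 * Msup\<close> the tail threshold.\<close>

definition pconst :: real where "pconst = Ckap * (3 * Clip + 1 / k0\<^sup>2) + 4 * Msup"

lemma Clip_pos: "Clip > 0"
  using k0_pos Msup_pos by (simp add: Clip_def add_pos_pos)

lemma pconst_pos: "pconst > 0"
  using Clip_pos k0_pos Ckap_pos Msup_pos
  unfolding pconst_def by (intro add_pos_pos mult_pos_pos divide_pos_pos) auto

definition weight :: "nat \<Rightarrow> nat \<Rightarrow> real" where
  "weight n i = s n i / (1 + 1 / \<theta> n * \<nu> n i)\<^sup>2"

text \<open>The weight is the first summand of the true distortion at multiplier
  \<open>1 / \<theta> n\<close>, hence at most \<open>min (\<theta> n) (s n i)\<close>; so even the
  first coordinate has a bounded weight.\<close>

lemma weight_bound:
  assumes l: "large n" and i: "i \<in> {1..n}"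
  shows "\<bar>weight n i\<bar> \<le> Msup"
proof -
  have th: "\<theta> n > 0" "\<theta> n < Msup" using theta_props[OF l] theta_less[OF l] by auto
  have "0 \<le> \<nu> n i / (1 + 1 / \<theta> n * \<nu> n i)"
    using th nu_nonneg[OF l] by (intro divide_nonneg_nonneg add_nonneg_nonneg mult_nonneg_nonneg) auto
  then have "weight n i \<le> cdist (1 / \<theta> n) (\<nu> n i) (s n i)"
    by (simp add: weight_def cdist_def)
  also have "\<dots> = min (\<theta> n) (s n i)"
    unfolding nu2_def by (rule cdist_waterfilling[OF th(1) s_pos[OF l i]])
  finally have "weight n i \<le> Msup" using th by linarith
  moreover have "0 \<le> weight n i" using s_pos[OF l i] by (simp add: weight_def)
  ultimately show ?thesis by simp
qed

text \<open>Both the multiplier \<open>kap\<close> and the normalised squares \<open>y\<close> fluctuate; the former costs a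
  Lipschitz constant, the latter is compared at the deterministic multiplier \<open>1 / \<theta>\<close>.\<close>

lemma distortion_deviation:
  assumes f: "regime n e" and u: "\<bar>aML n u - a\<bar> \<le> e"
    and x: "\<And>i. i \<in> {1..n} \<Longrightarrow> (xvec a n u i)\<^sup>2 = s n i * y i" and y0: "\<And>i. i \<in> {1..n} \<Longrightarrow> 0 \<le> y i"
    and y1: "(1 / real n) * (\<Sum>i=1..n. y i) \<le> 3"
    and dev: "\<bar>\<Sum>i=1..n. weight n i * (y i - 1)\<bar> \<le> 4 * Msup * e * real n"
  shows "\<bar>(1 / real n) * (\<Sum>i=1..n. mfun a \<sigma>2 d n u i) - d\<bar> \<le> pconst * e"
proof -
  have l: "large n" using f by (simp add: regime_def)
  have n: "n \<ge> 1" using n2'[OF l] by simp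
  have e0: "e > 0"
  proof -
    have "0 < 1 / real n" using n by simp
    then show ?thesis using f unfolding regime_def by linarith
  qed
  let ?k = "kap n u" and ?c = "1 / \<theta> n"
  have th: "\<theta> n > 0" "\<theta> n < Msup" using theta_props[OF l] theta_less[OF l] by auto
  have c: "k0 \<le> ?c"
  proof -
    have "?c \<ge> 1 / Msup" using th Msup_pos by (intro divide_left_mono) auto
    moreover have "1 / (2 * Msup) \<le> 1 / Msup" using Msup_pos by (intro divide_left_mono) auto
    ultimately show ?thesis unfolding k0_def by linarith
  qed
  have k: "k0 \<le> ?k" "\<bar>?k - ?c\<bar> \<le> Ckap * e" using kap_props[OF f u] by auto
  define D1 where "D1 = (1 / real n) * (\<Sum>i=1..n. cdist ?k (\<nu> n i) (s n i * y i) - cdist ?c (\<nu> n i) (s n i * y i))"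
  define D2 where "D2 = (1 / real n) * (\<Sum>i=1..n. weight n i * (y i - 1))"
  have "(1 / real n) * (\<Sum>i=1..n. mfun a \<sigma>2 d n u i) = (1 / real n) * (\<Sum>i=1..n. cdist ?k (\<nu> n i) (s n i * y i))"
    using mfun_kap[OF f u] x by (intro arg_cong2[where f = "(*)"] sum.cong refl) simp
  also have "\<dots> = D1 + D2 + (1 / real n) * (\<Sum>i=1..n. cdist ?c (\<nu> n i) (s n i))"
    unfolding D1_def D2_def distrib_left[symmetric] sum.distrib[symmetric]
  proof (intro arg_cong2[where f = "(*)"] sum.cong refl)
    fix i
    show "cdist ?k (\<nu> n i) (s n i * y i) = cdist ?k (\<nu> n i) (s n i * y i) - cdist ?c (\<nu> n i) (s n i * y i)
       + weight n i * (y i - 1) + cdist ?c (\<nu> n i) (s n i)"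
      using cdist_scaled_diff[of ?c "\<nu> n i" "s n i" "y i"] by (simp only: weight_def)
  qed
  also have "(1 / real n) * (\<Sum>i=1..n. cdist ?c (\<nu> n i) (s n i)) = d" by (rule cdist_star[OF l])
  finally have eq: "(1 / real n) * (\<Sum>i=1..n. mfun a \<sigma>2 d n u i) - d = D1 + D2" by simp
  have "\<bar>D1\<bar> \<le> (1 / real n) * (\<Sum>i=1..n. Ckap * e * (Clip * y i + 1 / k0\<^sup>2))"
    unfolding D1_def abs_mult
  proof (intro mult_mono order_trans[OF sum_abs] sum_mono)
    fix i assume i: "i \<in> {1..n}"
    have "\<bar>cdist ?k (\<nu> n i) (s n i * y i) - cdist ?c (\<nu> n i) (s n i * y i)\<bar>
       \<le> \<bar>?k - ?c\<bar> * (2 * (1 / k0\<^sup>2 + \<theta> n / k0) * y i + 1 / k0\<^sup>2)"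
      using s_pos[OF l i] y0[OF i] by (intro cdist_lipschitz[OF k0_pos k(1) c th(1)]) (auto simp: nu2_def)
    also have "\<dots> \<le> (Ckap * e) * (Clip * y i + 1 / k0\<^sup>2)"
    proof (intro mult_mono k(2) add_mono order_refl mult_right_mono y0[OF i])
      show "2 * (1 / k0\<^sup>2 + \<theta> n / k0) \<le> Clip"
        unfolding Clip_def using th k0_pos by (intro mult_left_mono add_left_mono divide_right_mono) auto
      show "0 \<le> Clip" using Clip_pos by simp
      show "0 \<le> Ckap * e" using Ckap_pos e0 by simp
      show "0 \<le> 2 * (1 / k0\<^sup>2 + \<theta> n / k0) * y i + 1 / k0\<^sup>2" using th k0_pos y0[OF i] by simp
    qed
    finally show "\<bar>cdist ?k (\<nu> n i) (s n i * y i) - cdist ?c (\<nu> n i) (s n i * y i)\<bar> \<le> Ckap * e * (Clip * y i + 1 / k0\<^sup>2)" .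
  qed auto
  also have "\<dots> = Ckap * e * (Clip * ((1 / real n) * (\<Sum>i=1..n. y i)) + 1 / k0\<^sup>2)"
  proof -
    have "(\<Sum>i=1..n. Ckap * e * (Clip * y i + 1 / k0\<^sup>2)) = Ckap * e * (Clip * (\<Sum>i=1..n. y i) + real n * (1 / k0\<^sup>2))"
      by (simp add: sum.distrib flip: sum_distrib_left)
    then show ?thesis using n by (simp only:) (simp add: field_simps)
  qed
  also have "\<dots> \<le> Ckap * e * (Clip * 3 + 1 / k0\<^sup>2)"
    using y1 Ckap_pos e0 Clip_pos by (intro mult_left_mono add_right_mono) auto
  finally have b1: "\<bar>D1\<bar> \<le> Ckap * e * (Clip * 3 + 1 / k0\<^sup>2)" .
  have b2: "\<bar>D2\<bar> \<le> 4 * Msup * e"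
    using dev n by (simp add: D2_def abs_mult divide_le_eq)
  have "Ckap * e * (Clip * 3 + 1 / k0\<^sup>2) + 4 * Msup * e = pconst * e"
    by (simp add: pconst_def algebra_simps)
  then show ?thesis unfolding eq using b1 b2 by linarith
qed

text \<open>The bound 1/2 on \<open>eta\<close> puts the threshold in the range of the Chernoff
  bound with \<open>B = Msup\<close>. The last clause says that the estimation error, a noise norm
  of at most n against an exponentially large process value, falls below \<open>eta\<close>.\<close>

lemma eventually_regime_eta: "eventually (\<lambda>n. regime n (eta n) \<and> eta n \<le> 1 / 2 \<and> n \<ge> 3 \<and>
   real n / (sqrt \<sigma>2 * a ^ (n - 2) * (1 / real n)) \<le> eta n) sequentially"
proof -
  have lim: "(\<lambda>n. sqrt (ln (ln (real n)) / real n)) \<longlonglongrightarrow> 0" by real_asymp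
  have small: "eventually (\<lambda>n. eta n \<le> c) sequentially" if "c > 0" for c
    using order_tendstoD(2)[OF lim that] by eventually_elim (simp add: eta_def)
  have 1: "eventually (\<lambda>n. 1 / real n \<le> eta n) sequentially" unfolding eta_def by real_asymp
  have 2: "eventually (\<lambda>n. real n / (sqrt \<sigma>2 * a ^ (n - 2) * (1 / real n)) \<le> 1 / real n) sequentially"
    using a1 \<sigma>2 by real_asymp
  have aa: "a\<^sup>2 - a > 0" using a1 by (simp add: power2_eq_square)
  have 3: "eventually (\<lambda>n. eta n \<le> min (1 / 2) (min ((a - 1) / 2) (min (a\<^sup>2 - a) (min (1 / (2 * Msup) / Ckap) (1 / d / Ckap))))) sequentially"
    using a1 aa Msup_pos Ckap_pos d0 by (intro small) simp
  show ?thesis using eventually_large 1 2 3 eventually_ge_at_top[of 3]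
  proof eventually_elim
    case (elim n)
    have "eta n \<le> 1 / (2 * Msup) / Ckap" "eta n \<le> 1 / d / Ckap"
      using elim(4) by (simp_all only: min.bounded_iff)
    then have "Ckap * eta n \<le> 1 / (2 * Msup)" "Ckap * eta n \<le> 1 / d"
      unfolding pos_le_divide_eq[OF Ckap_pos] by (simp_all only: mult.commute)
    then show ?case using elim unfolding regime_def by auto
  qed
qed

text \<open>\<open>mfun\<close> rests on a choice and a limit, but on the event of a close estimate
  it equals an explicit expression in \<open>kap\<close>; off that event membership already
  fails.\<close>

lemma typset_measurable:
  fixes U :: "'a \<Rightarrow> nat \<Rightarrow> real"
  assumes f: "regime n (eta n)" and U: "\<And>i. (\<lambda>\<omega>. U \<omega> i) \<in> borel_measurable M"
  shows "{\<omega> \<in> space M. U \<omega> \<in> typset a \<sigma>2 d n p} \<in> sets M"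
proof -
  note [measurable] = U
  define G where "G = {\<omega> \<in> space M. \<bar>aML n (U \<omega>) - a\<bar> \<le> eta n}"
  have aM[measurable]: "(\<lambda>\<omega>. aML n (U \<omega>)) \<in> borel_measurable M" unfolding aML_def by measurable
  have xM[measurable]: "(\<lambda>\<omega>. xvec a n (U \<omega>) i) \<in> borel_measurable M" for i unfolding xvec_def by measurable
  have GM[measurable]: "G \<in> sets M" unfolding G_def by measurable
  have sM[measurable]: "(\<lambda>\<omega>. sighat2 \<sigma>2 n (U \<omega>) i) \<in> borel_measurable M" for i
    unfolding sighat2_def by (cases "i = 1") (simp_all, measurable)
  have eM[measurable]: "(\<lambda>\<omega>. ehat n c (U \<omega>)) \<in> borel_measurable M" for c
    unfolding ehat_def cdist_def by measurable
  \<comment> \<open>The value 1 off \<open>G\<close> is a positive default.\<close>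
  define k where "k \<omega> = (if \<omega> \<in> G then kap n (U \<omega>) else 1)" for \<omega>
  have kM[measurable]: "k \<in> borel_measurable M"
  proof (subst borel_measurable_iff_le, intro allI)
    fix c :: real
    show "{\<omega> \<in> space M. k \<omega> \<le> c} \<in> sets M"
    proof (cases "c > 0")
      case True
      have "{\<omega> \<in> space M. k \<omega> \<le> c} = {\<omega> \<in> space M. if \<omega> \<in> G then ehat n c (U \<omega>) \<le> d else 1 \<le> c}"
        using kap_props(4)[OF f _ True] by (auto simp: k_def G_def)
      also have "\<dots> \<in> sets M" by measurable
      finally show ?thesis .
    next
      case False
      have "k \<omega> > 0" for \<omega>
        using kap_props(1)[OF f, of "U \<omega>"] k0_pos by (auto simp: k_def G_def)
      then have "\<not> k \<omega> \<le> c" for \<omega> using False by (meson not_less order.strict_trans2)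
      then have "{\<omega> \<in> space M. k \<omega> \<le> c} = {}" by blast
      then show ?thesis by (simp only: sets.empty_sets)
    qed
  qed
  have "{\<omega> \<in> space M. U \<omega> \<in> typset a \<sigma>2 d n p} = {\<omega> \<in> space M. \<omega> \<in> G \<and>
     (\<forall>j\<in>{1,2,3::nat}. \<bar>(1 / real n) * (\<Sum>i=1..n. (xvec a n (U \<omega>) i ^ 2 / sig2 a \<sigma>2 n i) ^ j) - odd_dfact j\<bar> \<le> 2) \<and>
     \<bar>(1 / real n) * (\<Sum>i=1..n. cdist (k \<omega>) (\<nu> n i) ((xvec a n (U \<omega>) i)\<^sup>2)) - d\<bar> \<le> p * eta n}"
  proof (intro Collect_cong conj_cong refl)
    fix \<omega> assume w: "\<omega> \<in> space M"
    show "U \<omega> \<in> typset a \<sigma>2 d n p \<longleftrightarrow> \<omega> \<in> G \<and>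
     (\<forall>j\<in>{1,2,3::nat}. \<bar>(1 / real n) * (\<Sum>i=1..n. (xvec a n (U \<omega>) i ^ 2 / sig2 a \<sigma>2 n i) ^ j) - odd_dfact j\<bar> \<le> 2) \<and>
     \<bar>(1 / real n) * (\<Sum>i=1..n. cdist (k \<omega>) (\<nu> n i) ((xvec a n (U \<omega>) i)\<^sup>2)) - d\<bar> \<le> p * eta n"
    proof (cases "\<bar>aML n (U \<omega>) - a\<bar> \<le> eta n")
      case True
      then have "\<omega> \<in> G" using w by (simp add: G_def)
      moreover have "(\<Sum>i=1..n. mfun a \<sigma>2 d n (U \<omega>) i) = (\<Sum>i=1..n. cdist (k \<omega>) (\<nu> n i) ((xvec a n (U \<omega>) i)\<^sup>2))"
        using \<open>\<omega> \<in> G\<close> by (intro sum.cong refl) (simp add: mfun_kap[OF f True] k_def)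
      ultimately show ?thesis using True unfolding typset_def by simp
    qed (simp add: typset_def G_def)
  qed
  also have "\<dots> \<in> sets M" unfolding cdist_def by measurable
  finally show ?thesis .
qed

text \<open>With the factor 4 the exponent is exactly \<open>ln (ln n)\<close>; from n = 3 on
  \<open>ln n \<ge> 1\<close>, so the root in \<open>eta\<close> has a nonnegative argument.\<close>

lemma tail_exponent:
  assumes n: "n \<ge> 3" and r: "r = 4 * Msup * eta n * real n"
  shows "2 * exp (- (r\<^sup>2 / (16 * real n * Msup\<^sup>2))) = 2 / ln (real n)"
proof -
  have "ln (exp 1) \<le> ln (real n)" using n exp_le by (subst ln_le_cancel_iff) auto
  then have l: "ln (real n) \<ge> 1" by simp
  have "(eta n)\<^sup>2 = ln (ln (real n)) / real n" using l by (simp add: eta_def)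
  then have "r\<^sup>2 / (16 * real n * Msup\<^sup>2) = ln (ln (real n))"
    unfolding r using n Msup_pos by (simp add: power_mult_distrib field_simps power2_eq_square)
  moreover have "exp (- ln (ln (real n))) = 1 / ln (real n)" using l by (simp add: exp_minus inverse_eq_divide)
  ultimately show ?thesis by simp
qed

text \<open>A union bound over six events. The summands of the constant are their costs:
  \<open>\<sigma>2\<close> for the noise norm, 1 for the small ball, three values of
  \<open>nmom\<close> for the moments, 2 for the distortion. All but the last are bounded at order
  1/n and are relaxed to \<open>1 / ln n\<close>.\<close>

lemma typset_probability:
  fixes M :: "'a measure" and Z :: "nat \<Rightarrow> 'a \<Rightarrow> real"
  assumes M: "prob_space M" and ind: "prob_space.indep_vars M (\<lambda>_. borel) Z {1..}"
    and dist: "\<And>i. i \<ge> 1 \<Longrightarrow> distributed M lborel (Z i) (\<lambda>x. ennreal (normal_density 0 (sqrt \<sigma>2) x))"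
    and f: "regime n (eta n)" "eta n \<le> 1 / 2" "n \<ge> 3"
      "real n / (sqrt \<sigma>2 * a ^ (n - 2) * (1 / real n)) \<le> eta n"
  shows "1 - (\<sigma>2 + 1 + nmom 2 + nmom 4 + nmom 6 + 2) / ln (real n)
     \<le> measure M {\<omega> \<in> space M. (\<lambda>i. Uproc a Z i \<omega>) \<in> typset a \<sigma>2 d n pconst}"
proof -
  interpret prob_space M by fact
  define sd where "sd = sqrt \<sigma>2"
  have sd: "sd > 0" "sd\<^sup>2 = \<sigma>2" using \<sigma>2 by (simp_all add: sd_def)
  define W where "W k \<omega> = Z k \<omega> / sd" for k \<omega>
  have ZW: "(\<lambda>k \<omega>. sd * W k \<omega>) = Z" using sd by (simp add: W_def)
  have Zk: "Z k \<omega> = sd * W k \<omega>" for k \<omega> using sd by (simp add: W_def)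
  have Wn: "std_gauss_family W m" for m
    unfolding std_gauss_family_def
  proof (intro conjI ballI)
    have "indep_vars (\<lambda>_. borel) Z {1..m}" by (rule indep_vars_subset[OF ind]) auto
    from indep_vars_compose2[OF this, of "\<lambda>k x. x / sd" "\<lambda>_. borel"]
    show "indep_vars (\<lambda>_. borel) W {1..m}" by (simp add: W_def[abs_def])
    fix k assume "k \<in> {1..m}"
    then have "distributed M lborel (Z k) (normal_density 0 sd)" using dist[of k] by (simp add: sd_def)
    from normal_density_affine[OF this, of "1 / sd" 0] sd
    show "distributed M lborel (W k) (\<lambda>x. ennreal (std_normal_density x))" by (simp add: W_def[abs_def])
  qed
  have l: "large n" using f by (simp add: regime_def)
  interpret A: ar_dim a n
    using l a1 by unfold_locales (auto simp: large_def)
  define Q where "Q = A.Omat"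
  have orth: "(\<Sum>k=1..n. Q i k * Q j k) = (if i = j then 1 else 0)" if "i \<in> {1..n}" "j \<in> {1..n}" for i j
    unfolding Q_def by (rule A.Omat_orth[OF that])
  have orth': "(\<Sum>i=1..n. Q i k * Q i m) = (if k = m then 1 else 0)" if "k \<in> {1..n}" "m \<in> {1..n}" for k m
    using square_left_right_inverse[of n Q "\<lambda>k j. Q j k", OF orth that] by simp
  let ?g = "rotated Q n W" and ?U = "\<lambda>\<omega> i. Uproc a Z i \<omega>"
  have x2: "(xvec a n (?U \<omega>) i)\<^sup>2 = s n i * (?g i \<omega>)\<^sup>2" if i: "i \<in> {1..n}" for i \<omega>
  proof -
    have "sqrt (mu a n i) * xvec a n (?U \<omega>) i = (\<Sum>k=1..n. Q i k * (?U \<omega> k - a * ?U \<omega> (k - 1)))"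
      unfolding Q_def by (rule A.xvec_eq[OF i]) simp
    also have "\<dots> = (\<Sum>k=1..n. sd * (Q i k * W k \<omega>))"
    proof (intro sum.cong refl)
      fix k assume "k \<in> {1..n}"
      then obtain m where "k = Suc m" by (cases k) auto
      then show "Q i k * (?U \<omega> k - a * ?U \<omega> (k - 1)) = sd * (Q i k * W k \<omega>)" by (simp add: Zk)
    qed
    also have "\<dots> = sd * ?g i \<omega>" by (simp add: rotated_def sum_distrib_left)
    finally have "(sqrt (mu a n i))\<^sup>2 * (xvec a n (?U \<omega>) i)\<^sup>2 = sd\<^sup>2 * (?g i \<omega>)\<^sup>2"
      by (metis power_mult_distrib)
    then show ?thesis using A.mu_pos[OF i] sd by (simp add: sig2_def field_simps)
  qed
  have Zm[measurable]: "Z k \<in> borel_measurable M" if "k \<in> {1..}" for k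
    using ind that by (auto simp: indep_vars_def)
  have Um: "(\<lambda>\<omega>. ?U \<omega> i) \<in> borel_measurable M" for i
    by (induction i) auto
  define r where "r = 4 * Msup * eta n * real n"
  define L where "L = sd * a ^ (n - 2) * (1 / real n)"
  have L0: "L > 0" using sd a1 f by (simp add: L_def)
  \<comment> \<open>Indices 1 to 3 double as the order of the moment; 0, 4 and 5 stand for the noise
    norm, the small ball and the distortion.\<close>
  define B where "B j = (
     if j = 0 then {\<omega> \<in> space M. (real n)\<^sup>2 < (\<Sum>k=1..n. (sd * W k \<omega>)\<^sup>2)}
     else if j = 4 then {\<omega> \<in> space M. \<bar>Uproc a Z (n - 1) \<omega>\<bar> < L}
     else if j = 5 then {\<omega> \<in> space M. \<bar>\<Sum>i=1..n. weight n i * ((?g i \<omega>)\<^sup>2 - 1)\<bar> \<ge> r}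
     else {\<omega> \<in> space M. \<bar>(1 / real n) * (\<Sum>i=1..n. ((?g i \<omega>)\<^sup>2) ^ j) - nmom j\<bar> \<ge> 2})" for j :: nat
  let ?J = "{0, 1, 2, 3, 4, 5::nat}"
  have Wm: "k \<in> {1..n} \<Longrightarrow> W k \<in> borel_measurable M" for k by (rule std_gauss_measurable[OF Wn])
  have gm[measurable]: "?g i \<in> borel_measurable M" for i by (rule rotated_measurable[OF Wn orth])
  have Bm: "B j \<in> sets M" for j
  proof -
    have [measurable]: "(\<lambda>\<omega>. \<Sum>k=1..n. (sd * W k \<omega>)\<^sup>2) \<in> borel_measurable M"
      by (intro borel_measurable_sum borel_measurable_power borel_measurable_times borel_measurable_const Wm)
    note [measurable] = Um
    have if_sets: "(if c then X else Y) \<in> sets M" if "X \<in> sets M" "Y \<in> sets M" for c X Y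
      using that by simp
    show ?thesis unfolding B_def by (intro if_sets) measurable
  qed
  have n1: "n \<ge> 1" using f by simp
  have ln_pos: "ln (real n) > 0" using f by simp
  have inv: "1 / real n \<le> 1 / ln (real n)"
    using ln_pos f ln_le_minus_one[of "real n"] by (intro divide_left_mono) auto
  have eta_pos: "eta n > 0"
  proof -
    have "0 < 1 / real n" using f by simp
    then show ?thesis using f(1) unfolding regime_def by linarith
  qed
  show ?thesis
  proof (rule prob_ge_one_minus[OF M _ _ Bm, where J = ?J])
    show "{\<omega> \<in> space M. ?U \<omega> \<in> typset a \<sigma>2 d n pconst} \<in> sets M"
      by (rule typset_measurable[OF f(1) Um])
    show "space M - {\<omega> \<in> space M. ?U \<omega> \<in> typset a \<sigma>2 d n pconst} \<subseteq> (\<Union>j\<in>?J. B j)"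
    proof (rule ccontr)
      assume "\<not> ?thesis"
      then obtain \<omega> where w: "\<omega> \<in> space M" "?U \<omega> \<notin> typset a \<sigma>2 d n pconst" "\<And>j. j \<in> ?J \<Longrightarrow> \<omega> \<notin> B j" by blast
      have "(\<Sum>k=1..n. (Z k \<omega>)\<^sup>2) \<le> (real n)\<^sup>2" using w(1) w(3)[of 0] by (simp add: B_def Zk not_less)
      moreover have "L \<le> \<bar>Uproc a Z (n - 1) \<omega>\<bar>" using w(1) w(3)[of 4] by (simp add: B_def not_less)
      ultimately have "\<bar>aML n (?U \<omega>) - a\<bar> \<le> real n / L" using f L0 by (intro aML_Uproc) auto
      also have "\<dots> \<le> eta n" using f(4) by (simp add: L_def sd_def)
      finally have u: "\<bar>aML n (?U \<omega>) - a\<bar> \<le> eta n" .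
      have m: "\<bar>(1 / real n) * (\<Sum>i=1..n. ((?g i \<omega>)\<^sup>2) ^ j) - nmom j\<bar> < 2" if "j \<in> {1, 2, 3}" for j
        using w(1) w(3)[of j] that by (auto simp: B_def not_le)
      have c2: "\<bar>(1 / real n) * (\<Sum>i=1..n. ((xvec a n (?U \<omega>) i)\<^sup>2 / s n i) ^ j) - odd_dfact j\<bar> \<le> 2" if "j \<in> {1, 2, 3}" for j
      proof -
        have "(\<Sum>i=1..n. ((xvec a n (?U \<omega>) i)\<^sup>2 / s n i) ^ j) = (\<Sum>i=1..n. ((?g i \<omega>)\<^sup>2) ^ j)"
          using x2 s_pos[OF l] by (intro sum.cong refl) fastforce
        then show ?thesis using m[OF that] odd_dfact_eq[OF that] by simp
      qed
      have c3: "\<bar>(1 / real n) * (\<Sum>i=1..n. mfun a \<sigma>2 d n (?U \<omega>) i) - d\<bar> \<le> pconst * eta n"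
      proof (rule distortion_deviation[OF f(1) u x2])
        show "(1 / real n) * (\<Sum>i=1..n. (?g i \<omega>)\<^sup>2) \<le> 3" using m[of 1] by (simp add: nmom_def abs_less_iff)
        show "\<bar>\<Sum>i=1..n. weight n i * ((?g i \<omega>)\<^sup>2 - 1)\<bar> \<le> 4 * Msup * eta n * real n"
          using w(1) w(3)[of 5] by (simp add: B_def r_def not_le)
      qed auto
      have "?U \<omega> \<in> typset a \<sigma>2 d n pconst"
        unfolding typset_def mem_Collect_eq using u c2 c3 by blast
      with w(2) show False ..
    qed
    have "prob (B 0) \<le> \<sigma>2 / real n"
      using sum_squares_Markov[OF Wn n1, of sd] by (simp add: B_def sd)
    moreover have "prob (B 4) \<le> 1 / real n"
    proof -
      have "prob {\<omega> \<in> space M. \<bar>Uproc a (\<lambda>k \<omega>. sd * W k \<omega>) (n - 1) \<omega>\<bar> < sd * a ^ (n - 1 - 1) * (1 / real n)} \<le> 1 / real n"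
        using f a1 sd by (intro Uproc_small_ball[OF Wn[of n]]) auto
      then show ?thesis unfolding ZW by (simp add: B_def L_def numeral_2_eq_2)
    qed
    moreover have "prob (B 1) \<le> nmom 2 / real n" "prob (B 2) \<le> nmom 4 / real n" "prob (B 3) \<le> nmom 6 / real n"
      using even_moment_average_deviation[OF Wn orth n1, of 1] even_moment_average_deviation[OF Wn orth n1, of 2]
        even_moment_average_deviation[OF Wn orth n1, of 3] by (simp_all add: B_def)
    moreover have "prob (B 5) \<le> 2 / ln (real n)"
    proof -
      have "prob (B 5) \<le> 2 * exp (- (r\<^sup>2 / (16 * real n * Msup\<^sup>2)))"
        unfolding B_def using rotated_square_tail[OF Wn orth orth' weight_bound[OF l] Msup_pos _ _ n1, where r = r] f eta_pos Msup_pos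
        by (simp add: r_def)
      also have "\<dots> = 2 / ln (real n)" by (rule tail_exponent[OF f(3) r_def])
      finally show ?thesis .
    qed
    ultimately have "(\<Sum>j\<in>?J. prob (B j)) \<le> (\<sigma>2 + 1 + nmom 2 + nmom 4 + nmom 6) * (1 / real n) + 2 / ln (real n)"
      by (simp add: add_divide_distrib distrib_right)
    also have "\<dots> \<le> (\<sigma>2 + 1 + nmom 2 + nmom 4 + nmom 6) * (1 / ln (real n)) + 2 / ln (real n)"
      using inv \<sigma>2 by (intro add_right_mono mult_left_mono) (auto simp: nmom_def)
    also have "\<dots> = (\<sigma>2 + 1 + nmom 2 + nmom 4 + nmom 6 + 2) / ln (real n)" by (simp add: add_divide_distrib)
    finally show "(\<Sum>j\<in>?J. prob (B j)) \<le> (\<sigma>2 + 1 + nmom 2 + nmom 4 + nmom 6 + 2) / ln (real n)" .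
  qed simp
qed

end

theorem theorem8:
  fixes M :: "'a measure" and Z :: "nat \<Rightarrow> 'a \<Rightarrow> real" and a \<sigma>2 d :: real
  assumes "prob_space M"
    and "a > 1" and "\<sigma>2 > 0" and "0 < d" and "d < \<sigma>2 / (a^2 - 1)"
    and "prob_space.indep_vars M (\<lambda>_. borel) Z {1..}"
    and "\<And>i. i \<ge> 1 \<Longrightarrow> distributed M lborel (Z i) (\<lambda>x. ennreal (normal_density 0 (sqrt \<sigma>2) x))"
  shows "\<exists>p>0. \<exists>f. f \<in> \<Theta>(\<lambda>n. 1 / ln (real n)) \<and>
           (\<forall>\<^sub>F n in sequentially.
              measure M {\<omega> \<in> space M. (\<lambda>i. Uproc a Z i \<omega>) \<in> typset a \<sigma>2 d n p} \<ge> 1 - f n)"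
proof -
  interpret rd_setup a \<sigma>2 d using assms by unfold_locales
  define K where "K = \<sigma>2 + 1 + nmom 2 + nmom 4 + nmom 6 + 2"
  have "K > 0" using \<sigma>2 by (simp add: K_def nmom_def add_pos_pos)
  then have "(\<lambda>n. K / ln (real n)) \<in> \<Theta>(\<lambda>n. 1 / ln (real n))"
    by (intro bigthetaI bigoI[of _ K] landau_omega.bigI[of K]) (auto intro!: always_eventually)
  moreover have "\<forall>\<^sub>F n in sequentially. measure M {\<omega> \<in> space M. (\<lambda>i. Uproc a Z i \<omega>) \<in> typset a \<sigma>2 d n pconst} \<ge> 1 - K / ln (real n)"
    using eventually_regime_eta
  proof eventually_elim
    case (elim n)
    then show ?case unfolding K_def using typset_probability[OF assms(1,6,7)] by blast
  qed
  ultimately show ?thesis using pconst_pos by (intro exI[of _ pconst] conjI exI[of _ "\<lambda>n. K / ln (real n)"]) auto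
qed

end
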